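(* Let $\theta>0$, $\theta\neq 1$, $N\in\mathbb{N}$, $k\in\{1,\dots,N\}$, $M\in\mathbb{Z}_{\geq 0}$, and let $\mathbb{P}^{\theta,M}_{N,k}$ be the complex measure of total mass $1$ on $\mathfrak{X}^{\theta,M}_{N,k}$ with weights $w_k,\dots,w_N$ defined in the context. Let $\mathcal{M}\subseteq\mathbb{C}$ be an open set with $[-N\theta,M+1-\theta]\subseteq\mathcal{M}$. Suppose that there exist functions $\phi^j_r$, $j=k,\dots,N+1$, $r=1,2$, that are analytic in $\mathcal{M}$ and such that for every $j\in\{k,\dots,N\}$ $$\frac{\phi^{j+1}_1(z)}{\phi^j_1(z)}=\frac{w_j(z-1)}{w_j(z)}\quad\text{for } z\in[1-j\theta,M-\theta],$$ $$\frac{\phi^j_2(z)}{\phi^{j+1}_2(z)}=\frac{w_j(z+(N-j)\theta-1)}{w_j(z+(N-j)\theta)}\quad\text{for } z\in[1-N\theta,M-(N-j+1)\theta].$$ Then the following functions $R_1(z),R_2(z)$ are analytic in $\mathcal{M}$: $$R_1(z):=\phi^{N+1}_1(z)\,\mathbb{E}\left[\prod_{p=1}^N\frac{z-\ell^N_p-\theta}{z-\ell^N_p}\right]+\phi^k_1(z)\,\mathbb{E}\left[\prod_{p=1}^k\frac{z-\ell^k_p+\theta-1}{z-\ell^k_p-1}\right]$$ $$+\frac{\theta}{1-\theta}\sum_{j=k+1}^N\phi^j_1(z)\,\mathbb{E}\left[\prod_{p=1}^j\frac{z-\ell^j_p-\theta}{z-\ell^j_p-1}\prod_{p=1}^{j-1}\frac{z-\ell^{j-1}_p+\theta-1}{z-\ell^{j-1}_p}\right]-\mathrm{Res}_1(z),$$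 $$R_2(z):=\phi^{N+1}_2(z)\,\mathbb{E}\left[\prod_{p=1}^N\frac{z-\ell^N_p+\theta-1}{z-\ell^N_p-1}\right]+\phi^k_2(z)\,\mathbb{E}\left[\prod_{p=1}^k\frac{z-\ell^k_p+(N-k-1)\theta}{z-\ell^k_p+(N-k)\theta}\right]$$ $$+\frac{\theta}{1-\theta}\sum_{j=k+1}^N\phi^j_2(z)\,\mathbb{E}\left[\prod_{p=1}^j\frac{z-\ell^j_p+(N-j+1)\theta-1}{z-\ell^j_p+(N-j)\theta}\prod_{p=1}^{j-1}\frac{z-\ell^{j-1}_p+(N-j)\theta}{z-\ell^{j-1}_p+(N-j+1)\theta-1}\right]-\mathrm{Res}_2(z),$$ where, with $s_M=M+1-\theta$, $$\mathrm{Res}_1(z)=\frac{(-\theta)\,\phi^{N+1}_1(-N\theta)}{z+N\theta}\,\mathbb{E}\left[\prod_{p=1}^{N-1}\frac{\ell^N_p+(N+1)\theta}{\ell^N_p+N\theta}\,\mathbf{1}\{\ell^N_N=-N\theta\}\right]+\frac{\theta\,\phi^k_1(s_M)}{z-s_M}\,\mathbb{E}\left[\prod_{p=2}^k\frac{s_M-\ell^k_p+\theta-1}{s_M-\ell^k_p-1}\,\mathbf{1}\{\ell^k_1=s_M-1\}\right]$$ $$+\sum_{j=k+1}^N\frac{\theta\,\phi^j_1(s_M)}{z-s_M}\,\mathbb{E}\left[\prod_{p=2}^j\frac{s_M-\ell^j_p-\theta}{s_M-\ell^j_p-1}\prod_{p=1}^{j-1}\frac{s_M-\ell^{j-1}_p+\theta-1}{s_M-\ell^{j-1}_p}\,\mathbf{1}\{\ell^j_1=s_M-1\}\right],$$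 $$\mathrm{Res}_2(z)=\frac{\theta\,\phi^{N+1}_2(s_M)}{z-s_M}\,\mathbb{E}\left[\prod_{p=2}^N\frac{s_M-\ell^N_p+\theta-1}{s_M-\ell^N_p-1}\,\mathbf{1}\{\ell^N_1=s_M-1\}\right]+\frac{(-\theta)\,\phi^k_2(-N\theta)}{z+N\theta}\,\mathbb{E}\left[\prod_{p=1}^{k-1}\frac{\ell^k_p+(k+1)\theta}{\ell^k_p+k\theta}\,\mathbf{1}\{\ell^k_k=-k\theta\}\right]$$ $$+\sum_{j=k+1}^N\frac{(-\theta)\,\phi^j_2(-N\theta)}{z+N\theta}\,\mathbb{E}\left[\prod_{p=1}^{j-1}\frac{\ell^j_p+(j-1)\theta+1}{\ell^j_p+j\theta}\prod_{p=1}^{j-1}\frac{\ell^{j-1}_p+j\theta}{\ell^{j-1}_p+(j-1)\theta+1}\,\mathbf{1}\{\ell^j_j=-j\theta\}\right].$$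
   Context: State space. For $n\in\mathbb{N}$ let $\Lambda^M_n = \{(\lambda_1,\dots,\lambda_n)\in\mathbb{Z}^n : M \geq \lambda_1\geq\cdots\geq\lambda_n\geq 0\}$ and $\mathbb{W}^{\theta,M}_n = \{(\ell_1,\dots,\ell_n) : \ell_i = \lambda_i - i\theta,\ (\lambda_1,\dots,\lambda_n)\in\Lambda^M_n\}$. For $\ell\in\mathbb{W}^{\theta,M}_{n}$ and $m\in\mathbb{W}^{\theta,M}_{n-1}$ with $\ell_i=\lambda_i-i\theta$, $m_i=\mu_i-i\theta$, write $\ell\succeq m$ if $\lambda_1\geq\mu_1\geq\lambda_2\geq\mu_2\geq\cdots\geq\mu_{n-1}\geq\lambda_n$. Set $$\mathfrak{X}^{\theta,M}_{N,k} = \{(\ell^N,\ell^{N-1},\dots,\ell^k)\in\mathbb{W}^{\theta,M}_N\times\cdots\times\mathbb{W}^{\theta,M}_k : \ell^N\succeq\ell^{N-1}\succeq\cdots\succeq\ell^k\}.$$ Complex measure. For $j\in\{k,\dots,N\}$ let $w_j$ be a non-vanishing complex-valued function on $[-j\theta,M-\theta]$. With $\Gamma$ the Euler gamma function, $$\mathbb{P}^{\theta,M}_{N,k}(\ell^N,\dots,\ell^k) = Z_N^{-1}\, H^t(\ell^N)\, H^b(\ell^k) \prod_{j=k}^{N-1} I(\ell^{j+1},\ell^j),$$ $$I(\ell^{j+1},\ell^j) = \prod_{1\leq p<q\leq j+1}\frac{\Gamma(\ell^{j+1}_p-\ell^{j+1}_q+1-\theta)}{\Gamma(\ell^{j+1}_p-\ell^{j+1}_q)}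 \prod_{1\leq p<q\leq j}\frac{\Gamma(\ell^j_p-\ell^j_q+1)}{\Gamma(\ell^j_p-\ell^j_q+\theta)} \prod_{1\leq p<q\leq j+1}\frac{\Gamma(\ell^j_p-\ell^{j+1}_q)}{\Gamma(\ell^j_p-\ell^{j+1}_q+1-\theta)} \prod_{1\leq p\leq q\leq j}\frac{\Gamma(\ell^{j+1}_p-\ell^j_q+\theta)}{\Gamma(\ell^{j+1}_p-\ell^j_q+1)}\prod_{p=1}^j w_j(\ell^j_p),$$ $$H^t(\ell^N) = \prod_{1\leq p<q\leq N}\frac{\Gamma(\ell^N_p-\ell^N_q+1)}{\Gamma(\ell^N_p-\ell^N_q+1-\theta)}\prod_{p=1}^N w_N(\ell^N_p), \qquad H^b(\ell^k) = \prod_{1\leq p<q\leq k}\frac{\Gamma(\ell^k_p-\ell^k_q+\theta)}{\Gamma(\ell^k_p-\ell^k_q)}.$$ Here $Z_N$ is the sum of $H^t(\ell^N)H^b(\ell^k)\prod_{j=k}^{N-1}I(\ell^{j+1},\ell^j)$ over $\mathfrak{X}^{\theta,M}_{N,k}$, and it is assumed that $Z_N\neq 0$. For a function $F$ on $\mathfrak{X}^{\theta,M}_{N,k}$, $\mathbb{E}[F]=\sum_{\ell}F(\ell)\,\mathbb{P}^{\theta,M}_{N,k}(\ell)$. Conventions. Empty products are $1$, empty sums are $0$. $R_1,R_2$ are a priori meromorphic on $\mathcal{M}$; "analytic in $\mathcal{M}$" means all their singularities in $\mathcal{M}$ are removable. The ratio identities presuppose that the denominators do not vanish on the indicated intervals.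 *)

theory Defs
  imports "HOL-Complex_Analysis.Complex_Analysis"
begin

section \<open>State space\<close>

text \<open>
  Vectors indexed by \<open>1, \<dots>, n\<close> are extensional functions on \<open>{1..n}\<close>, so that sums over the
  state spaces below range over every configuration exactly once.
\<close>

definition Lambda_space :: "nat \<Rightarrow> nat \<Rightarrow> (nat \<Rightarrow> int) set" where
  "Lambda_space M n =
     {lam \<in> {1..n} \<rightarrow>\<^sub>E {0..int M}. \<forall>i\<in>{1..n}. \<forall>j\<in>{1..n}. i \<le> j \<longrightarrow> lam j \<le> lam i}"

definition W_space :: "real \<Rightarrow> nat \<Rightarrow> nat \<Rightarrow> (nat \<Rightarrow> real) set" where
  "W_space \<theta> M n = (\<lambda>lam. \<lambda>i\<in>{1..n}. of_int (lam i) - real i * \<theta>) ` Lambda_space M n"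

text \<open>
  The relation \<open>l \<succeq> m\<close> for \<open>l \<in> W_space \<theta> M n\<close> and \<open>m \<in> W_space \<theta> M (n - 1)\<close>; the integers
  \<open>\<lambda>\<^sub>i\<close>, \<open>\<mu>\<^sub>i\<close> are recovered as \<open>l i + i * \<theta>\<close>, \<open>m i + i * \<theta>\<close>.
\<close>

definition interlaces :: "real \<Rightarrow> nat \<Rightarrow> (nat \<Rightarrow> real) \<Rightarrow> (nat \<Rightarrow> real) \<Rightarrow> bool" where
  "interlaces \<theta> n l m \<longleftrightarrow>
     (\<forall>i\<in>{1..<n}. l i + real i * \<theta> \<ge> m i + real i * \<theta> \<and>
                  m i + real i * \<theta> \<ge> l (i + 1) + real (i + 1) * \<theta>)"

text \<open>A configuration \<open>L\<close> has levels \<open>L k, \<dots>, L N\<close>; \<open>L j p\<close> stands for \<open>\<ell>\<^sup>j\<^sub>p\<close>.\<close>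

definition X_space :: "real \<Rightarrow> nat \<Rightarrow> nat \<Rightarrow> nat \<Rightarrow> (nat \<Rightarrow> nat \<Rightarrow> real) set" where
  "X_space \<theta> M N k =
     {L \<in> (\<Pi>\<^sub>E j\<in>{k..N}. W_space \<theta> M j). \<forall>j\<in>{k..<N}. interlaces \<theta> (j + 1) (L (j + 1)) (L j)}"

lemma finite_W_space: "finite (W_space \<theta> M n)"
  unfolding W_space_def Lambda_space_def
  by (intro finite_imageI finite_Collect_conjI disjI1) (simp add: finite_PiE)

lemma finite_X_space: "finite (X_space \<theta> M N k)"
  unfolding X_space_def using finite_W_space by (simp add: finite_PiE)


section \<open>The complex measure\<close>

text \<open>
  On the state space all arguments of the Gamma function are positive reals. The weight functions
  \<open>w j\<close> matter only on \<open>[-j\<theta>, M-\<theta>]\<close>.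
\<close>

definition weight_I ::
    "real \<Rightarrow> (nat \<Rightarrow> real \<Rightarrow> complex) \<Rightarrow> nat \<Rightarrow> (nat \<Rightarrow> real) \<Rightarrow> (nat \<Rightarrow> real) \<Rightarrow> complex" where
  "weight_I \<theta> w j l m =
     complex_of_real (
       (\<Prod>q\<in>{1..j+1}. \<Prod>p\<in>{1..<q}. Gamma (l p - l q + 1 - \<theta>) / Gamma (l p - l q)) *
       (\<Prod>q\<in>{1..j}. \<Prod>p\<in>{1..<q}. Gamma (m p - m q + 1) / Gamma (m p - m q + \<theta>)) *
       (\<Prod>q\<in>{1..j+1}. \<Prod>p\<in>{1..<q}. Gamma (m p - l q) / Gamma (m p - l q + 1 - \<theta>)) *
       (\<Prod>q\<in>{1..j}. \<Prod>p\<in>{1..q}. Gamma (l p - m q + \<theta>) / Gamma (l p - m q + 1))) *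
     (\<Prod>p\<in>{1..j}. w j (m p))"

definition weight_Ht ::
    "real \<Rightarrow> nat \<Rightarrow> (nat \<Rightarrow> real \<Rightarrow> complex) \<Rightarrow> (nat \<Rightarrow> real) \<Rightarrow> complex" where
  "weight_Ht \<theta> N w l =
     complex_of_real
       (\<Prod>q\<in>{1..N}. \<Prod>p\<in>{1..<q}. Gamma (l p - l q + 1) / Gamma (l p - l q + 1 - \<theta>)) *
     (\<Prod>p\<in>{1..N}. w N (l p))"

definition weight_Hb :: "real \<Rightarrow> nat \<Rightarrow> (nat \<Rightarrow> real) \<Rightarrow> complex" where
  "weight_Hb \<theta> k l =
     complex_of_real (\<Prod>q\<in>{1..k}. \<Prod>p\<in>{1..<q}. Gamma (l p - l q + \<theta>) / Gamma (l p - l q))"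

definition total_weight ::
    "real \<Rightarrow> nat \<Rightarrow> nat \<Rightarrow> (nat \<Rightarrow> real \<Rightarrow> complex) \<Rightarrow> (nat \<Rightarrow> nat \<Rightarrow> real) \<Rightarrow> complex" where
  "total_weight \<theta> N k w L =
     weight_Ht \<theta> N w (L N) * weight_Hb \<theta> k (L k) *
     (\<Prod>j\<in>{k..<N}. weight_I \<theta> w j (L (j + 1)) (L j))"

definition partition_Z ::
    "real \<Rightarrow> nat \<Rightarrow> nat \<Rightarrow> nat \<Rightarrow> (nat \<Rightarrow> real \<Rightarrow> complex) \<Rightarrow> complex" where
  "partition_Z \<theta> M N k w = (\<Sum>L\<in>X_space \<theta> M N k. total_weight \<theta> N k w L)"

definition prob_P ::
    "real \<Rightarrow> nat \<Rightarrow> nat \<Rightarrow> nat \<Rightarrow> (nat \<Rightarrow> real \<Rightarrow> complex) \<Rightarrow> (nat \<Rightarrow> nat \<Rightarrow> real) \<Rightarrow> complex" where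
  "prob_P \<theta> M N k w L = inverse (partition_Z \<theta> M N k w) * total_weight \<theta> N k w L"

definition expect_E ::
    "real \<Rightarrow> nat \<Rightarrow> nat \<Rightarrow> nat \<Rightarrow> (nat \<Rightarrow> real \<Rightarrow> complex) \<Rightarrow>
     ((nat \<Rightarrow> nat \<Rightarrow> real) \<Rightarrow> complex) \<Rightarrow> complex" where
  "expect_E \<theta> M N k w F = (\<Sum>L\<in>X_space \<theta> M N k. F L * prob_P \<theta> M N k w L)"


section \<open>The observables\<close>

text \<open>
  Differences such as \<open>N - j\<close> are taken in \<open>real\<close>, so that \<open>N - k - 1\<close> is \<open>-1\<close> for \<open>k = N\<close>.
\<close>

abbreviation cpx :: "real \<Rightarrow> complex" where
  "cpx \<equiv> complex_of_real"

definition Res1 ::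
    "real \<Rightarrow> nat \<Rightarrow> nat \<Rightarrow> nat \<Rightarrow> (nat \<Rightarrow> real \<Rightarrow> complex) \<Rightarrow> (nat \<Rightarrow> complex \<Rightarrow> complex) \<Rightarrow>
     complex \<Rightarrow> complex" where
  "Res1 \<theta> M N k w \<phi> z =
     (let E = expect_E \<theta> M N k w;
          s = real M + 1 - \<theta>
      in cpx (- \<theta>) * \<phi> (N + 1) (cpx (- real N * \<theta>)) / (z + cpx (real N * \<theta>)) *
           E (\<lambda>L. cpx (
                (\<Prod>p\<in>{1..N-1}. (L N p + (real N + 1) * \<theta>) / (L N p + real N * \<theta>)) *
                of_bool (L N N = - real N * \<theta>)))
       + cpx \<theta> * \<phi> k (cpx s) / (z - cpx s) *
           E (\<lambda>L. cpx (
                (\<Prod>p\<in>{2..k}. (s - L k p + \<theta> - 1) / (s - L k p - 1)) *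
                of_bool (L k 1 = s - 1)))
       + (\<Sum>j\<in>{k+1..N}. cpx \<theta> * \<phi> j (cpx s) / (z - cpx s) *
           E (\<lambda>L. cpx (
                (\<Prod>p\<in>{2..j}. (s - L j p - \<theta>) / (s - L j p - 1)) *
                (\<Prod>p\<in>{1..j-1}. (s - L (j-1) p + \<theta> - 1) / (s - L (j-1) p)) *
                of_bool (L j 1 = s - 1)))))"

definition Res2 ::
    "real \<Rightarrow> nat \<Rightarrow> nat \<Rightarrow> nat \<Rightarrow> (nat \<Rightarrow> real \<Rightarrow> complex) \<Rightarrow> (nat \<Rightarrow> complex \<Rightarrow> complex) \<Rightarrow>
     complex \<Rightarrow> complex" where
  "Res2 \<theta> M N k w \<phi> z =
     (let E = expect_E \<theta> M N k w;
          s = real M + 1 - \<theta>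
      in cpx \<theta> * \<phi> (N + 1) (cpx s) / (z - cpx s) *
           E (\<lambda>L. cpx (
                (\<Prod>p\<in>{2..N}. (s - L N p + \<theta> - 1) / (s - L N p - 1)) *
                of_bool (L N 1 = s - 1)))
       + cpx (- \<theta>) * \<phi> k (cpx (- real N * \<theta>)) / (z + cpx (real N * \<theta>)) *
           E (\<lambda>L. cpx (
                (\<Prod>p\<in>{1..k-1}. (L k p + (real k + 1) * \<theta>) / (L k p + real k * \<theta>)) *
                of_bool (L k k = - real k * \<theta>)))
       + (\<Sum>j\<in>{k+1..N}.
           cpx (- \<theta>) * \<phi> j (cpx (- real N * \<theta>)) / (z + cpx (real N * \<theta>)) *
           E (\<lambda>L. cpx (
                (\<Prod>p\<in>{1..j-1}. (L j p + (real j - 1) * \<theta> + 1) / (L j p + real j * \<theta>)) *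
                (\<Prod>p\<in>{1..j-1}. (L (j-1) p + real j * \<theta>) / (L (j-1) p + (real j - 1) * \<theta> + 1)) *
                of_bool (L j j = - real j * \<theta>)))))"

definition R1 ::
    "real \<Rightarrow> nat \<Rightarrow> nat \<Rightarrow> nat \<Rightarrow> (nat \<Rightarrow> real \<Rightarrow> complex) \<Rightarrow> (nat \<Rightarrow> complex \<Rightarrow> complex) \<Rightarrow>
     complex \<Rightarrow> complex" where
  "R1 \<theta> M N k w \<phi> z =
     (let E = expect_E \<theta> M N k w
      in \<phi> (N + 1) z * E (\<lambda>L. \<Prod>p\<in>{1..N}. (z - cpx (L N p) - cpx \<theta>) / (z - cpx (L N p)))
       + \<phi> k z * E (\<lambda>L. \<Prod>p\<in>{1..k}. (z - cpx (L k p) + cpx \<theta> - 1) / (z - cpx (L k p) - 1))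
       + cpx (\<theta> / (1 - \<theta>)) *
         (\<Sum>j\<in>{k+1..N}. \<phi> j z *
           E (\<lambda>L. (\<Prod>p\<in>{1..j}. (z - cpx (L j p) - cpx \<theta>) / (z - cpx (L j p) - 1)) *
                  (\<Prod>p\<in>{1..j-1}. (z - cpx (L (j-1) p) + cpx \<theta> - 1) / (z - cpx (L (j-1) p)))))
       - Res1 \<theta> M N k w \<phi> z)"

definition R2 ::
    "real \<Rightarrow> nat \<Rightarrow> nat \<Rightarrow> nat \<Rightarrow> (nat \<Rightarrow> real \<Rightarrow> complex) \<Rightarrow> (nat \<Rightarrow> complex \<Rightarrow> complex) \<Rightarrow>
     complex \<Rightarrow> complex" where
  "R2 \<theta> M N k w \<phi> z =
     (let E = expect_E \<theta> M N k w
      in \<phi> (N + 1) z * E (\<lambda>L. \<Prod>p\<in>{1..N}. (z - cpx (L N p) + cpx \<theta> - 1) / (z - cpx (L N p) - 1))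
       + \<phi> k z * E (\<lambda>L. \<Prod>p\<in>{1..k}. (z - cpx (L k p) + cpx ((real N - real k - 1) * \<theta>)) /
                                      (z - cpx (L k p) + cpx ((real N - real k) * \<theta>)))
       + cpx (\<theta> / (1 - \<theta>)) *
         (\<Sum>j\<in>{k+1..N}. \<phi> j z *
           E (\<lambda>L. (\<Prod>p\<in>{1..j}. (z - cpx (L j p) + cpx ((real N - real j + 1) * \<theta>) - 1) /
                                (z - cpx (L j p) + cpx ((real N - real j) * \<theta>))) *
                  (\<Prod>p\<in>{1..j-1}. (z - cpx (L (j-1) p) + cpx ((real N - real j) * \<theta>)) /
                                  (z - cpx (L (j-1) p) + cpx ((real N - real j + 1) * \<theta>) - 1))))
       - Res2 \<theta> M N k w \<phi> z)"

text \<open>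
  The formulas above divide by zero at finitely many points, where their values in HOL carry no
  meaning. That \<open>f\<close> is analytic in \<open>A\<close> up to removable singularities means that near every point
  of \<open>A\<close>, except possibly at the point itself, \<open>f\<close> agrees with a single function analytic in \<open>A\<close>.
\<close>

definition analytic_removable_on :: "(complex \<Rightarrow> complex) \<Rightarrow> complex set \<Rightarrow> bool" where
  "analytic_removable_on f A \<longleftrightarrow>
     (\<exists>g. g analytic_on A \<and> (\<forall>z\<in>A. \<forall>\<^sub>F u in at z. f u = g u))"

end

theory Submission
  imports Defs
begin

text \<open>
  All poles are simple, or cancel. The residue of the \<open>j\<close>-th summand of \<open>R\<^sub>1\<close> at \<open>a\<close> collects the
  configurations with \<open>\<ell>\<^sup>j\<^sub>p = a - 1\<close> or \<open>\<ell>\<^sup>j\<^sup>-\<^sup>1\<^sub>p = a\<close> for some \<open>p\<close>. Moving a single particle from \<open>a - 1\<close> to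
  \<open>a\<close> on level \<open>j\<close> changes the weight exactly so that the residue of the \<open>j\<close>-th summand before the move
  cancels that of the \<open>(j + 1)\<close>-st summand after it. A particle may be blocked by the particle
  with the same index on the next level, also at \<open>a - 1\<close>; then the whole vertical string
  \<open>\<ell>\<^sup>j\<^sub>p = \<dots> = \<ell>\<^sup>i\<^sub>p = a - 1\<close> moves, and the residues of the summands \<open>j\<close> and \<open>i + 1\<close> cancel. If the string
  is blocked by a particle with a different index, the residue has a vanishing factor; if it is
  blocked by the walls \<open>0\<close> and \<open>M\<close>, the residue is the one subtracted in \<open>Res\<^sub>1\<close>. The claim for \<open>R\<^sub>2\<close> follows
  by the reflection \<open>\<lambda>\<^sub>i \<mapsto> M - \<lambda>\<^sub>n\<^sub>+\<^sub>1\<^sub>-\<^sub>i\<close>, \<open>z \<mapsto> M + 1 - (N + 1) \<theta> - z\<close>.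
\<close>

text \<open>The prefactor \<theta> / (1 - \<theta>) normalises the residues. At a pole, the
  numerator that belongs to the same particle equals 1 - \<theta> or its negative in a middle
  summand, but \<theta> or -\<theta> in the two outer ones; after scaling, every residue is \<theta>
  or -\<theta> times a product over the other particles. Moving one particle changes the weight by a
  rational function, because the Gamma factors depend on differences of positions only; the one
  non-rational piece is a quotient of values of \<open>w j\<close>, which the hypothesis on
  \<open>\<phi>\<close> converts. A string is moved one particle at a time, from its top level
  downwards, so that every intermediate array still interlaces. Consecutive single-move identities
  share a nonzero residue, which cancels and leaves the two ends of the string. A middle summand can
  have poles from both of its levels at the same point. This forces the particles between them to be
  packed as tightly as possible, and two numerators then vanish at that point too.\<close>

section \<open>Simple poles\<close>

text \<open>The pole is at most simple and its residue \<open>r\<close> is explicit data, so that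
  residues add up along sums; \<open>r = 0\<close> means a removable singularity. The value of
  \<open>f\<close> at \<open>a\<close> is ignored, because division by zero makes it meaningless
  there.\<close>

definition has_simple_part :: "(complex \<Rightarrow> complex) \<Rightarrow> complex \<Rightarrow> complex \<Rightarrow> bool" where
  "has_simple_part f a r \<longleftrightarrow>
     (\<exists>h. h analytic_on {a} \<and> (\<forall>\<^sub>F z in at a. f z = r / (z - a) + h z))"

lemma has_simple_part_analytic: "f analytic_on {a} \<Longrightarrow> has_simple_part f a 0"
  unfolding has_simple_part_def by (auto intro!: exI[of _ f])

lemma has_simple_part_add:
  assumes "has_simple_part f a r" "has_simple_part g a s"
  shows "has_simple_part (\<lambda>z. f z + g z) a (r + s)"
proof -
  obtain h1 h2 where h: "h1 analytic_on {a}" "h2 analytic_on {a}"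
      "\<forall>\<^sub>F z in at a. f z = r / (z - a) + h1 z" "\<forall>\<^sub>F z in at a. g z = s / (z - a) + h2 z"
    using assms unfolding has_simple_part_def by blast
  have "\<forall>\<^sub>F z in at a. f z + g z = (r + s) / (z - a) + (h1 z + h2 z)"
    using h(3,4) by eventually_elim (simp add: add_divide_distrib)
  then show ?thesis
    unfolding has_simple_part_def using h(1,2) by (auto intro!: exI[of _ "\<lambda>z. h1 z + h2 z"] analytic_intros)
qed

lemma has_simple_part_divide:
  assumes "g analytic_on {a}"
  shows "has_simple_part (\<lambda>z. g z / (z - a)) a (g a)"
proof -
  have "(\<lambda>z. if z = a then deriv g a else g z / (z - a) - g a / (z - a)) analytic_on {a}"
    using assms by (rule pole_theorem_analytic) (auto intro!: exI[of _ 1])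
  moreover have "\<forall>\<^sub>F z in at a. g z / (z - a) =
      g a / (z - a) + (if z = a then deriv g a else g z / (z - a) - g a / (z - a))"
    by (auto simp: eventually_at_filter)
  ultimately show ?thesis unfolding has_simple_part_def by blast
qed

lemma has_simple_part_cong:
  assumes "has_simple_part f a r" "\<forall>\<^sub>F z in at a. g z = f z"
  shows "has_simple_part g a r"
proof -
  obtain h where h: "h analytic_on {a}" "\<forall>\<^sub>F z in at a. f z = r / (z - a) + h z"
    using assms(1) unfolding has_simple_part_def by blast
  have "\<forall>\<^sub>F z in at a. g z = r / (z - a) + h z"
    using h(2) assms(2) by eventually_elim simp
  then show ?thesis using h(1) unfolding has_simple_part_def by blast
qed

lemma has_simple_part_mult:
  assumes "\<phi> analytic_on {a}" "has_simple_part f a r"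
  shows "has_simple_part (\<lambda>z. \<phi> z * f z) a (\<phi> a * r)"
proof -
  obtain h where h: "h analytic_on {a}" "\<forall>\<^sub>F z in at a. f z = r / (z - a) + h z"
    using assms(2) unfolding has_simple_part_def by blast
  have "has_simple_part (\<lambda>z. (\<phi> z * r) / (z - a) + \<phi> z * h z) a (\<phi> a * r + 0)"
    using assms(1) h(1)
    by (intro has_simple_part_add has_simple_part_divide has_simple_part_analytic analytic_intros)
  moreover have "\<forall>\<^sub>F z in at a. \<phi> z * f z = (\<phi> z * r) / (z - a) + \<phi> z * h z"
    using h(2) by eventually_elim (simp add: algebra_simps)
  ultimately show ?thesis using has_simple_part_cong by fastforce
qed

lemma has_simple_part_cmult:
  "has_simple_part f a r \<Longrightarrow> has_simple_part (\<lambda>z. c * f z) a (c * r)"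
  by (rule has_simple_part_mult[where \<phi> = "\<lambda>_. c"]) auto

lemma has_simple_part_diff:
  assumes "has_simple_part f a r" "has_simple_part g a s"
  shows "has_simple_part (\<lambda>z. f z - g z) a (r - s)"
  using has_simple_part_add[OF assms(1) has_simple_part_cmult[OF assms(2), of "-1"]] by simp

lemma has_simple_part_sum:
  assumes "\<And>i. i \<in> I \<Longrightarrow> has_simple_part (f i) a (r i)"
  shows "has_simple_part (\<lambda>z. \<Sum>i\<in>I. f i z) a (\<Sum>i\<in>I. r i)"
  using assms
  by (induction I rule: infinite_finite_induct)
     (auto intro!: has_simple_part_add has_simple_part_analytic)

lemma has_simple_part_inverse:
  "has_simple_part (\<lambda>z. c / (z - b)) a (if a = b then c else 0)"
proof (cases "a = b")
  case True
  then show ?thesis using has_simple_part_divide[of "\<lambda>_. c" b] by simp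
next
  case False
  then show ?thesis by (auto intro!: has_simple_part_analytic analytic_intros)
qed

text \<open>The local extensions glue because each of them is forced to agree with
  \<open>remove_sings f\<close>, which is defined independently of the point.\<close>

lemma analytic_removable_onI:
  assumes "\<And>a. a \<in> A \<Longrightarrow> has_simple_part f a 0"
  shows "analytic_removable_on f A"
proof -
  have *: "remove_sings f analytic_on {a} \<and> (\<forall>\<^sub>F u in at a. f u = remove_sings f u)"
    if "a \<in> A" for a
  proof -
    from assms[OF that] obtain h where h: "h analytic_on {a}" "\<forall>\<^sub>F z in at a. f z = h z"
      unfolding has_simple_part_def by auto
    have "isolated_singularity_at h a"
      using h(1) by (rule isolated_singularity_at_analytic)
    then have iso: "isolated_singularity_at f a"
      using isolated_singularity_at_cong[OF h(2)] by blast
    have "h \<midarrow>a\<rightarrow> h a"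
      using h(1) analytic_at_imp_isCont isContD by blast
    then have lim: "f \<midarrow>a\<rightarrow> h a"
      using tendsto_cong[OF h(2)] by blast
    have "remove_sings f analytic_on {a}"
      using remove_sings_analytic_at iso lim by blast
    moreover have "\<forall>\<^sub>F u in at a. remove_sings f u = f u"
      using iso by (rule eventually_remove_sings_eq_at)
    ultimately show ?thesis by (simp add: eq_commute)
  qed
  then have "remove_sings f analytic_on A"
    using analytic_on_analytic_at by blast
  then show ?thesis
    unfolding analytic_removable_on_def using * by blast
qed

text \<open>
  If two denominators vanish at \<open>a\<close>, every summand of the residue below contains a factor \<open>x / 0 = 0\<close>,
  so the formula correctly gives \<open>0\<close>.
\<close>

lemma has_simple_part_prod_ratio:
  fixes x y :: "'i \<Rightarrow> complex"
  assumes I: "finite I"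
    and few: "card {i \<in> I. y i = a} \<le> 1 \<or> card {i \<in> I. y i = a} \<le> card {i \<in> I. x i = a}"
  shows "has_simple_part (\<lambda>z. \<Prod>i\<in>I. (z - x i) / (z - y i)) a
           (\<Sum>i\<in>{i \<in> I. y i = a}. (a - x i) * (\<Prod>j\<in>I - {i}. (a - x j) / (a - y j)))"
proof -
  define D where "D = {i \<in> I. y i = a}"
  define Z where "Z = {i \<in> I. x i = a}"
  have fin: "finite D" "finite Z" "D \<subseteq> I" "Z \<subseteq> I"
    using I by (auto simp: D_def Z_def)
  consider "D = {}" | i where "D = {i}" | "2 \<le> card D"
  proof -
    have "card D = 0 \<or> card D = 1 \<or> 2 \<le> card D" by linarith
    then show ?thesis
      using that fin by (auto simp: card_1_singleton_iff)
  qed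
  then show ?thesis
  proof cases
    case 1
    then have "(\<lambda>z. \<Prod>i\<in>I. (z - x i) / (z - y i)) analytic_on {a}"
      by (intro analytic_intros) (auto simp: D_def)
    then have "has_simple_part (\<lambda>z. \<Prod>i\<in>I. (z - x i) / (z - y i)) a 0"
      by (rule has_simple_part_analytic)
    then show ?thesis using 1 by (simp only: D_def sum.empty)
  next
    case (2 i)
    then have i: "i \<in> I" "y i = a" and other: "\<And>j. j \<in> I - {i} \<Longrightarrow> y j \<noteq> a"
      by (auto simp: D_def)
    define g where "g = (\<lambda>z. (z - x i) * (\<Prod>j\<in>I - {i}. (z - x j) / (z - y j)))"
    have "g analytic_on {a}"
      unfolding g_def using other by (intro analytic_intros) (use other in force)
    moreover have "(\<lambda>z. \<Prod>i\<in>I. (z - x i) / (z - y i)) = (\<lambda>z. g z / (z - a))"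
      using I i by (simp add: g_def prod.remove[OF I i(1)] fun_eq_iff)
    ultimately show ?thesis
      using has_simple_part_divide[of g a] 2 by (simp add: D_def g_def)
  next
    case 3
    then have le: "card D \<le> card Z" using few by (auto simp: D_def Z_def)
    \<comment> \<open>All factors that vanish at \<open>a\<close> are collected into powers of
      \<open>z - a\<close>. By \<open>le\<close>, the difference of the exponents is not
      truncated.\<close>
    define g where "g = (\<lambda>z. (z - a) ^ (card Z - card D) *
      ((\<Prod>i\<in>I - Z. (z - x i)) / (\<Prod>i\<in>I - D. (z - y i))))"
    have "g analytic_on {a}"
      unfolding g_def using I by (intro analytic_intros) (auto simp: D_def)
    moreover have "\<forall>\<^sub>F z in at a. (\<Prod>i\<in>I. (z - x i) / (z - y i)) = g z"
      unfolding eventually_at_filter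
    proof (intro always_eventually allI impI)
      fix z assume z: "z \<noteq> a"
      have "(\<Prod>i\<in>I. (z - x i)) = (z - a) ^ card Z * (\<Prod>i\<in>I - Z. (z - x i))"
        using prod.subset_diff[OF fin(4) I, of "\<lambda>i. z - x i"] by (simp add: Z_def)
      moreover have "(\<Prod>i\<in>I. (z - y i)) = (z - a) ^ card D * (\<Prod>i\<in>I - D. (z - y i))"
        using prod.subset_diff[OF fin(3) I, of "\<lambda>i. z - y i"] by (simp add: D_def)
      moreover have "(z - a) ^ card Z = (z - a) ^ (card Z - card D) * (z - a) ^ card D"
        using le by (simp flip: power_add)
      ultimately show "(\<Prod>i\<in>I. (z - x i) / (z - y i)) = g z"
        using z by (simp add: prod_dividef g_def)
    qed
    ultimately have "has_simple_part (\<lambda>z. \<Prod>i\<in>I. (z - x i) / (z - y i)) a 0"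
      by (rule has_simple_part_cong[OF has_simple_part_analytic])
    moreover have "(\<Prod>j\<in>I - {i}. (a - x j) / (a - y j)) = 0" if "i \<in> D" for i
    proof -
      have "card (D - {i}) \<noteq> 0" using 3 that by simp
      then obtain j where "j \<in> D - {i}" by (metis all_not_in_conv card.empty)
      then show ?thesis using I by (auto simp: D_def intro!: prod_zero)
    qed
    ultimately show ?thesis by (simp add: D_def)
  qed
qed


section \<open>Weights under the move of one particle\<close>

text \<open>\<open>\<rho>\<close> collects the pairs whose inner index is the changed one,
  \<open>\<sigma>\<close> those whose outer index is. The inner range stays a parameter since the
  double products in the weights run over \<open>{1..<q}\<close> as well as over
  \<open>{1..q}\<close>.\<close>

lemma prod_prod_update:
  fixes h :: "'b \<Rightarrow> 'b \<Rightarrow> 'a::comm_monoid_mult"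
  assumes "finite Q" "\<And>q. q \<in> Q \<Longrightarrow> finite (R q)"
    and upd: "\<And>q r. q \<in> Q \<Longrightarrow> r \<in> R q \<Longrightarrow>
      h' r q = h r q * ((if r = p then \<rho> q else 1) * (if q = p then \<sigma> r else 1))"
  shows "(\<Prod>q\<in>Q. \<Prod>r\<in>R q. h' r q) = (\<Prod>q\<in>Q. \<Prod>r\<in>R q. h r q) *
    ((\<Prod>q\<in>{q \<in> Q. p \<in> R q}. \<rho> q) * (if p \<in> Q then \<Prod>r\<in>R p. \<sigma> r else 1))"
proof -
  have "(\<Prod>r\<in>R q. h' r q) = (\<Prod>r\<in>R q. h r q) *
      ((if p \<in> R q then \<rho> q else 1) * (if q = p then \<Prod>r\<in>R q. \<sigma> r else 1))" if "q \<in> Q" for q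
    using upd[OF that] assms(2)[OF that] by (simp add: prod.distrib prod.delta)
  then have "(\<Prod>q\<in>Q. \<Prod>r\<in>R q. h' r q) = (\<Prod>q\<in>Q. \<Prod>r\<in>R q. h r q) *
      ((\<Prod>q\<in>Q. if p \<in> R q then \<rho> q else 1) *
       (\<Prod>q\<in>Q. if q = p then \<Prod>r\<in>R q. \<sigma> r else 1))"
    by (simp add: prod.distrib)
  then show ?thesis
    using assms(1) by (simp add: prod.inter_filter prod.delta)
qed

text \<open>Every quotient in the weights has this form, with \<open>x\<close> a difference of two
  positions; a unit shift of \<open>x\<close> then multiplies it by a rational factor.\<close>

definition Gamma_ratio :: "real \<Rightarrow> real \<Rightarrow> real \<Rightarrow> real" where
  "Gamma_ratio c d x = Gamma (x + c) / Gamma (x + d)"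

lemma Gamma_ratio_plus1:
  assumes "x + c > 0" "x + d > 0"
  shows "Gamma_ratio c d (x + 1) = Gamma_ratio c d x * ((x + c) / (x + d))"
proof -
  have "x + c \<notin> \<int>\<^sub>\<le>\<^sub>0" "x + d \<notin> \<int>\<^sub>\<le>\<^sub>0"
    using assms nonpos_Ints_nonpos by force+
  then have "Gamma (x + 1 + c) = (x + c) * Gamma (x + c)" "Gamma (x + 1 + d) = (x + d) * Gamma (x + d)"
    using Gamma_plus1[of "x + c"] Gamma_plus1[of "x + d"] by (simp_all add: add_ac)
  then show ?thesis by (simp add: Gamma_ratio_def mult_ac)
qed

lemma Gamma_ratio_minus1:
  assumes "x + c > 1" "x + d > 1"
  shows "Gamma_ratio c d (x - 1) = Gamma_ratio c d x * ((x - 1 + d) / (x - 1 + c))"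
  using Gamma_ratio_plus1[of "x - 1" c d] assms by simp

lemma weight_I_Gamma_ratio:
  "weight_I \<theta> w j l m =
     complex_of_real (
       (\<Prod>q\<in>{1..j+1}. \<Prod>p\<in>{1..<q}. Gamma_ratio (1 - \<theta>) 0 (l p - l q)) *
       (\<Prod>q\<in>{1..j}. \<Prod>p\<in>{1..<q}. Gamma_ratio 1 \<theta> (m p - m q)) *
       (\<Prod>q\<in>{1..j+1}. \<Prod>p\<in>{1..<q}. Gamma_ratio 0 (1 - \<theta>) (m p - l q)) *
       (\<Prod>q\<in>{1..j}. \<Prod>p\<in>{1..q}. Gamma_ratio \<theta> 1 (l p - m q))) *
     (\<Prod>p\<in>{1..j}. w j (m p))"
  unfolding weight_I_def Gamma_ratio_def by (simp only: add_diff_eq add_0_right)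

lemma weight_Ht_Gamma_ratio:
  "weight_Ht \<theta> N w l =
     complex_of_real (\<Prod>q\<in>{1..N}. \<Prod>p\<in>{1..<q}. Gamma_ratio 1 (1 - \<theta>) (l p - l q)) *
     (\<Prod>p\<in>{1..N}. w N (l p))"
  unfolding weight_Ht_def Gamma_ratio_def by (simp only: add_diff_eq add_0_right)

lemma weight_Hb_Gamma_ratio:
  "weight_Hb \<theta> k l =
     complex_of_real (\<Prod>q\<in>{1..k}. \<Prod>p\<in>{1..<q}. Gamma_ratio \<theta> 0 (l p - l q))"
  unfolding weight_Hb_def Gamma_ratio_def by (simp only: add_diff_eq add_0_right)

text \<open>Differences to particles on the right grow by one, those to particles on the left shrink
  by one. The spacing \<theta>, required on the left after the move, together with
  \<open>c, d > - \<theta>\<close> keeps all Gamma arguments positive, so the functional equation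
  applies.\<close>

lemma triangle_move:
  fixes l :: "nat \<Rightarrow> real"
  assumes p: "p \<in> {1..n}" and lp: "l p = a - 1"
    and pos: "c > - \<theta>" "d > - \<theta>"
    and right: "\<And>q. q \<in> {p<..n} \<Longrightarrow> l q + \<theta> \<le> a - 1"
    and left: "\<And>q. q \<in> {1..<p} \<Longrightarrow> a + \<theta> \<le> l q"
  shows "(\<Prod>q\<in>{1..n}. \<Prod>r\<in>{1..<q}. Gamma_ratio c d ((l(p := a)) r - (l(p := a)) q)) =
    (\<Prod>q\<in>{1..n}. \<Prod>r\<in>{1..<q}. Gamma_ratio c d (l r - l q)) *
    ((\<Prod>q\<in>{p<..n}. (a - 1 - l q + c) / (a - 1 - l q + d)) *
     (\<Prod>q\<in>{1..<p}. (l q - a + d) / (l q - a + c)))"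
proof -
  have *: "Gamma_ratio c d ((l(p := a)) r - (l(p := a)) q) = Gamma_ratio c d (l r - l q) *
      ((if r = p then (a - 1 - l q + c) / (a - 1 - l q + d) else 1) *
       (if q = p then (l r - a + d) / (l r - a + c) else 1))"
    if q: "q \<in> {1..n}" and r: "r \<in> {1..<q}" for q r
  proof -
    consider "r = p" "q \<in> {p<..n}" | "q = p" "r \<in> {1..<p}" | "r \<noteq> p" "q \<noteq> p"
      using q r by force
    then show ?thesis
    proof cases
      case 1
      then have "q \<noteq> p" by auto
      with 1 show ?thesis
        using Gamma_ratio_plus1[of "a - 1 - l q" c d] right[of q] pos lp by simp
    next
      case 2
      then have "r \<noteq> p" "l r - (a - 1) - 1 = l r - a" by auto
      with 2 show ?thesis
        using Gamma_ratio_minus1[of "l r - (a - 1)" c d] left[of r] pos lp by simp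
    qed auto
  qed
  have "{q \<in> {1..n}. p \<in> {1..<q}} = {p<..n}" using p by auto
  then show ?thesis
    using prod_prod_update[where Q = "{1..n}" and R = "\<lambda>q. {1..<q}" and p = p, OF _ _ *] p by simp
qed

lemma prod_move:
  fixes f :: "real \<Rightarrow> 'a::comm_monoid_mult" and p n :: nat
  assumes "p \<in> {1..n}" "l p = b"
  shows "(\<Prod>q\<in>{1..n}. f ((l(p := a)) q)) * f b = (\<Prod>q\<in>{1..n}. f (l q)) * f a"
proof -
  have "(\<Prod>q\<in>{1..n} - {p}. f ((l(p := a)) q)) = (\<Prod>q\<in>{1..n} - {p}. f (l q))"
    by (intro prod.cong) auto
  then show ?thesis
    unfolding prod.remove[OF finite_atLeastAtMost assms(1)] using assms(2) by (simp add: mult_ac)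
qed

text \<open>
  The weight of a level is the product of a factor shared with the level above and one shared with
  the level below. Separately, they change under a move by ratios of different shape for the
  particles to the left and to the right of the moved one; \<open>kappa\<close> compensates this and
  cancels from the product of both.
\<close>

definition kappa :: "real \<Rightarrow> (nat \<Rightarrow> real) \<Rightarrow> nat \<Rightarrow> real \<Rightarrow> real" where
  "kappa \<theta> l p a = (\<Prod>q\<in>{1..<p}. ((a - l q - \<theta>) / (a - l q - 1)) * ((a - l q + \<theta> - 1) / (a - l q)))"

lemma prod_minus_split:
  assumes "p \<in> {1..n::nat}"
  shows "prod f ({1..n} - {p}) = prod f {1..<p} * prod f {p<..n}"
  using assms by (subst prod.union_disjoint [symmetric]) (auto intro!: prod.cong)

lemma prod_atMost_split:
  assumes "p \<le> (n::nat)"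
  shows "prod f {1..n} = prod f {1..p} * prod f {p<..n}"
  using assms by (subst prod.union_disjoint [symmetric]) (auto intro!: prod.cong)

lemma prod_lessThan_split:
  assumes "1 \<le> p" "p \<le> Suc n"
  shows "prod f {1..n} = prod f {1..<p} * prod f {p..n}"
  using assms by (subst prod.union_disjoint [symmetric]) (auto intro!: prod.cong)

lemma prod_eq_1: "(\<And>q. q \<in> S \<Longrightarrow> f q * g q = (1::'a::comm_monoid_mult)) \<Longrightarrow> prod f S * prod g S = 1"
  by (simp flip: prod.distrib)

lemma mult_combine:
  fixes x :: "'a::comm_monoid_mult"
  assumes "x * b = y * c" "p * u = q * v"
  shows "(x * p) * b * u = (y * q) * c * v"
proof -
  have "(x * p) * b * u = (x * b) * (p * u)" by (simp add: mult_ac)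
  then show ?thesis unfolding assms by (simp add: mult_ac)
qed

text \<open>On the top level \<open>weight_Ht\<close> takes the place of the coupling to a level
  above, and the product on the left is \<open>coef_B\<close> for \<open>i = N\<close>. Particles to
  the right of \<open>p\<close> cancel exactly, those to the left leave
  \<open>kappa\<close>.\<close>

lemma weight_Ht_move:
  fixes l :: "nat \<Rightarrow> real"
  assumes \<theta>: "\<theta> > 0" and p: "p \<in> {1..n}" and lp: "l p = a - 1"
    and right: "\<And>q. q \<in> {p<..n} \<Longrightarrow> l q + \<theta> \<le> a - 1"
    and left: "\<And>q. q \<in> {1..<p} \<Longrightarrow> a + \<theta> \<le> l q"
  shows "weight_Ht \<theta> n w (l(p := a)) * cpx (\<Prod>q\<in>{1..n} - {p}. (a - l q - \<theta>) / (a - l q)) * w n (a - 1) =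
    weight_Ht \<theta> n w l * cpx (kappa \<theta> l p a) * w n a"
proof -
  define G where "G = (\<lambda>l::nat \<Rightarrow> real. \<Prod>q\<in>{1..n}. \<Prod>r\<in>{1..<q}. Gamma_ratio 1 (1 - \<theta>) (l r - l q))"
  have G: "G (l(p := a)) = G l *
    ((\<Prod>q\<in>{p<..n}. (a - 1 - l q + 1) / (a - 1 - l q + (1 - \<theta>))) *
     (\<Prod>q\<in>{1..<p}. (l q - a + (1 - \<theta>)) / (l q - a + 1)))"
    unfolding G_def using \<theta> by (intro triangle_move) (use assms in auto)
  have 1: "(\<Prod>q\<in>{p<..n}. (a - 1 - l q + 1) / (a - 1 - l q + (1 - \<theta>))) *
      (\<Prod>q\<in>{p<..n}. (a - l q - \<theta>) / (a - l q)) = 1"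
  proof (rule prod_eq_1)
    fix q assume "q \<in> {p<..n}"
    then have "a - l q > 0" "a - l q - \<theta> > 0" using right[of q] \<theta> by auto
    then show "(a - 1 - l q + 1) / (a - 1 - l q + (1 - \<theta>)) * ((a - l q - \<theta>) / (a - l q)) = 1"
      by (simp add: divide_simps) (simp add: algebra_simps)?
  qed
  have 2: "(\<Prod>q\<in>{1..<p}. (l q - a + (1 - \<theta>)) / (l q - a + 1)) *
      (\<Prod>q\<in>{1..<p}. (a - l q - \<theta>) / (a - l q)) = kappa \<theta> l p a"
    unfolding kappa_def prod.distrib[symmetric]
  proof (intro prod.cong refl)
    fix q assume "q \<in> {1..<p}"
    have "(l q - a + (1 - \<theta>)) / (l q - a + 1) = (a - l q + \<theta> - 1) / (a - l q - 1)"
      by (subst minus_divide_divide[symmetric]) (simp add: algebra_simps)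
    then show "(l q - a + (1 - \<theta>)) / (l q - a + 1) * ((a - l q - \<theta>) / (a - l q)) =
       (a - l q - \<theta>) / (a - l q - 1) * ((a - l q + \<theta> - 1) / (a - l q))"
      by simp
  qed
  have "G (l(p := a)) * (\<Prod>q\<in>{1..n} - {p}. (a - l q - \<theta>) / (a - l q)) = G l * kappa \<theta> l p a"
    unfolding G prod_minus_split[OF p] 2[symmetric] using 1 by (simp add: mult_ac)
  then have e: "cpx (G (l(p := a))) * cpx (\<Prod>q\<in>{1..n} - {p}. (a - l q - \<theta>) / (a - l q)) =
      cpx (G l) * cpx (kappa \<theta> l p a)"
    by (simp only: of_real_mult[symmetric])
  have W: "weight_Ht \<theta> n w l' = cpx (G l') * (\<Prod>p\<in>{1..n}. w n (l' p))" for l'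
    unfolding weight_Ht_Gamma_ratio G_def ..
  have "(\<Prod>q\<in>{1..n}. w n ((l(p := a)) q)) * w n (a - 1) = (\<Prod>q\<in>{1..n}. w n (l q)) * w n a"
    using p lp by (rule prod_move)
  with e show ?thesis unfolding W by (rule mult_combine)
qed

text \<open>On the bottom level \<open>weight_Hb\<close> takes the place of the coupling to a level
  below, and the product on the right is \<open>coef_A\<close> for \<open>j = k\<close>. Here
  \<open>kappa\<close> accompanies the moved weight, in \<open>weight_Ht_move\<close> the original
  one; this is why it drops out when both are combined.\<close>

lemma weight_Hb_move:
  fixes l :: "nat \<Rightarrow> real"
  assumes \<theta>: "\<theta> > 0" and p: "p \<in> {1..n}" and lp: "l p = a - 1"
    and right: "\<And>q. q \<in> {p<..n} \<Longrightarrow> l q + \<theta> \<le> a - 1"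
    and left: "\<And>q. q \<in> {1..<p} \<Longrightarrow> a + \<theta> \<le> l q"
  shows "weight_Hb \<theta> n (l(p := a)) * cpx (kappa \<theta> l p a) =
    weight_Hb \<theta> n l * cpx (\<Prod>q\<in>{1..n} - {p}. (a - l q + \<theta> - 1) / (a - l q - 1))"
proof -
  define G where "G = (\<lambda>l::nat \<Rightarrow> real. \<Prod>q\<in>{1..n}. \<Prod>r\<in>{1..<q}. Gamma_ratio \<theta> 0 (l r - l q))"
  have G: "G (l(p := a)) = G l *
    ((\<Prod>q\<in>{p<..n}. (a - 1 - l q + \<theta>) / (a - 1 - l q + 0)) *
     (\<Prod>q\<in>{1..<p}. (l q - a + 0) / (l q - a + \<theta>)))"
    unfolding G_def using \<theta> by (intro triangle_move) (use assms in auto)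
  have 1: "(\<Prod>q\<in>{p<..n}. (a - 1 - l q + \<theta>) / (a - 1 - l q + 0)) =
      (\<Prod>q\<in>{p<..n}. (a - l q + \<theta> - 1) / (a - l q - 1))"
    by (intro prod.cong) (auto simp: algebra_simps)
  have 2: "(\<Prod>q\<in>{1..<p}. (l q - a + 0) / (l q - a + \<theta>)) * kappa \<theta> l p a =
      (\<Prod>q\<in>{1..<p}. (a - l q + \<theta> - 1) / (a - l q - 1))"
    unfolding kappa_def prod.distrib[symmetric]
  proof (intro prod.cong refl)
    fix q assume q: "q \<in> {1..<p}"
    have "(l q - a + 0) / (l q - a + \<theta>) = (a - l q) / (a - l q - \<theta>)"
      by (subst minus_divide_divide[symmetric]) (simp add: algebra_simps)
    moreover have "a - l q \<noteq> 0" "a - l q - \<theta> \<noteq> 0" using left[OF q] \<theta> by auto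
    ultimately show "(l q - a + 0) / (l q - a + \<theta>) *
       ((a - l q - \<theta>) / (a - l q - 1) * ((a - l q + \<theta> - 1) / (a - l q))) =
       (a - l q + \<theta> - 1) / (a - l q - 1)"
      by simp
  qed
  have "G (l(p := a)) * kappa \<theta> l p a =
      G l * (\<Prod>q\<in>{1..n} - {p}. (a - l q + \<theta> - 1) / (a - l q - 1))"
    unfolding G prod_minus_split[OF p] 2[symmetric] 1[symmetric] by (simp add: mult_ac)
  then have e: "cpx (G (l(p := a))) * cpx (kappa \<theta> l p a) =
      cpx (G l) * cpx (\<Prod>q\<in>{1..n} - {p}. (a - l q + \<theta> - 1) / (a - l q - 1))"
    by (simp only: of_real_mult[symmetric])
  have W: "weight_Hb \<theta> n l' = cpx (G l')" for l'
    unfolding weight_Hb_Gamma_ratio G_def ..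
  show ?thesis unfolding W by (rule e)
qed

text \<open>The row \<open>m\<close> changes below a fixed row \<open>l\<close>. The two mixed
  products reach the entries of \<open>l\<close> with \<open>q > p\<close> and
  \<open>q \<le> p\<close> respectively, and both change by the reciprocal of the same rational
  factor, so the whole row \<open>l\<close> cancels against the product. Within \<open>m\<close> the
  right-hand particles cancel and the left-hand ones leave \<open>kappa\<close>.\<close>

lemma weight_I_move_lower:
  fixes l m :: "nat \<Rightarrow> real"
  assumes \<theta>: "\<theta> > 0" and p: "p \<in> {1..n}" and mp: "m p = a - 1"
    and right: "\<And>q. q \<in> {p<..n} \<Longrightarrow> m q + \<theta> \<le> a - 1"
    and left: "\<And>q. q \<in> {1..<p} \<Longrightarrow> a + \<theta> \<le> m q"
    and right': "\<And>q. q \<in> {p<..n+1} \<Longrightarrow> l q + \<theta> \<le> a - 1"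
    and left': "\<And>q. q \<in> {1..p} \<Longrightarrow> a \<le> l q"
  shows "weight_I \<theta> w n l (m(p := a)) * cpx ((\<Prod>q\<in>{1..n+1}. (a - l q - \<theta>) / (a - l q - 1)) *
      (\<Prod>q\<in>{1..n} - {p}. (a - m q + \<theta> - 1) / (a - m q))) * w n (a - 1) =
    weight_I \<theta> w n l m * cpx (kappa \<theta> m p a) * w n a"
proof -
  define U where "U = (\<lambda>m::nat \<Rightarrow> real. \<Prod>q\<in>{1..n}. \<Prod>r\<in>{1..<q}. Gamma_ratio 1 \<theta> (m r - m q))"
  define P where "P = (\<lambda>m::nat \<Rightarrow> real. \<Prod>q\<in>{1..n+1}. \<Prod>r\<in>{1..<q}. Gamma_ratio 0 (1 - \<theta>) (m r - l q))"
  define Q where "Q = (\<lambda>m::nat \<Rightarrow> real. \<Prod>q\<in>{1..n}. \<Prod>r\<in>{1..q}. Gamma_ratio \<theta> 1 (l r - m q))"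
  define V where "V = (\<Prod>q\<in>{1..n+1}. \<Prod>r\<in>{1..<q}. Gamma_ratio (1 - \<theta>) 0 (l r - l q))"
  have U: "U (m(p := a)) = U m *
    ((\<Prod>q\<in>{p<..n}. (a - 1 - m q + 1) / (a - 1 - m q + \<theta>)) *
     (\<Prod>q\<in>{1..<p}. (m q - a + \<theta>) / (m q - a + 1)))"
    unfolding U_def using \<theta> by (intro triangle_move) (use assms in auto)
  have *: "Gamma_ratio 0 (1 - \<theta>) ((m(p := a)) r - l q) = Gamma_ratio 0 (1 - \<theta>) (m r - l q) *
     ((if r = p then (a - 1 - l q) / (a - l q - \<theta>) else 1) * (if q = p then 1 else 1))"
    if "q \<in> {1..n+1}" "r \<in> {1..<q}" for q r
    using that mp \<theta> right'[of q] Gamma_ratio_plus1[of "a - 1 - l q" 0 "1 - \<theta>"]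
    by (auto simp: algebra_simps)
  have "{q \<in> {1..n+1}. p \<in> {1..<q}} = {p<..n+1}" using p by auto
  then have P: "P (m(p := a)) = P m * (\<Prod>q\<in>{p<..n+1}. (a - 1 - l q) / (a - l q - \<theta>))"
    unfolding P_def
    using prod_prod_update[where Q = "{1..n+1}" and R = "\<lambda>q. {1..<q}" and p = p, OF _ _ *] p
    by simp
  have *: "Gamma_ratio \<theta> 1 (l r - (m(p := a)) q) = Gamma_ratio \<theta> 1 (l r - m q) *
     ((if r = p then 1 else 1) * (if q = p then (l r - a + 1) / (l r - a + \<theta>) else 1))"
    if "q \<in> {1..n}" "r \<in> {1..q}" for q r
    using that mp \<theta> left'[of r] Gamma_ratio_minus1[of "l r - m p" \<theta> 1]
    by (auto simp: algebra_simps)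
  have Q: "Q (m(p := a)) = Q m * (\<Prod>q\<in>{1..p}. (l q - a + 1) / (l q - a + \<theta>))"
    unfolding Q_def
    using prod_prod_update[where Q = "{1..n}" and R = "\<lambda>q. {1..q}" and p = p, OF _ _ *] p
    by simp
  have 1: "(\<Prod>q\<in>{p<..n}. (a - 1 - m q + 1) / (a - 1 - m q + \<theta>)) *
      (\<Prod>q\<in>{p<..n}. (a - m q + \<theta> - 1) / (a - m q)) = 1"
  proof (rule prod_eq_1)
    fix q assume "q \<in> {p<..n}"
    then have "a - m q > 0" "a - m q + \<theta> - 1 > 0" using right[of q] \<theta> by auto
    then show "(a - 1 - m q + 1) / (a - 1 - m q + \<theta>) * ((a - m q + \<theta> - 1) / (a - m q)) = 1"
      by (simp add: divide_simps) (simp add: algebra_simps)?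
  qed
  have 2: "(\<Prod>q\<in>{1..<p}. (m q - a + \<theta>) / (m q - a + 1)) *
      (\<Prod>q\<in>{1..<p}. (a - m q + \<theta> - 1) / (a - m q)) = kappa \<theta> m p a"
    unfolding kappa_def prod.distrib[symmetric]
  proof (intro prod.cong refl)
    fix q assume "q \<in> {1..<p}"
    have "(m q - a + \<theta>) / (m q - a + 1) = (a - m q - \<theta>) / (a - m q - 1)"
      by (subst minus_divide_divide[symmetric]) (simp add: algebra_simps)
    then show "(m q - a + \<theta>) / (m q - a + 1) * ((a - m q + \<theta> - 1) / (a - m q)) =
       (a - m q - \<theta>) / (a - m q - 1) * ((a - m q + \<theta> - 1) / (a - m q))"
      by simp
  qed
  have 3: "(\<Prod>q\<in>{p<..n+1}. (a - 1 - l q) / (a - l q - \<theta>)) *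
     (\<Prod>q\<in>{p<..n+1}. (a - l q - \<theta>) / (a - l q - 1)) = 1"
  proof (rule prod_eq_1)
    fix q assume "q \<in> {p<..n+1}"
    then have "a - l q - 1 > 0" "a - l q - \<theta> > 0" using right'[of q] \<theta> by auto
    then show "(a - 1 - l q) / (a - l q - \<theta>) * ((a - l q - \<theta>) / (a - l q - 1)) = 1"
      by (simp add: divide_simps) (simp add: algebra_simps)?
  qed
  have 4: "(\<Prod>q\<in>{1..p}. (l q - a + 1) / (l q - a + \<theta>)) *
     (\<Prod>q\<in>{1..p}. (a - l q - \<theta>) / (a - l q - 1)) = 1"
  proof (intro prod_eq_1)
    fix q assume q: "q \<in> {1..p}"
    have "(l q - a + 1) / (l q - a + \<theta>) = (a - l q - 1) / (a - l q - \<theta>)"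
      by (subst minus_divide_divide[symmetric]) (simp add: algebra_simps)
    moreover have "a - l q - 1 \<noteq> 0" "a - l q - \<theta> \<noteq> 0" using left'[OF q] \<theta> by auto
    ultimately show "(l q - a + 1) / (l q - a + \<theta>) * ((a - l q - \<theta>) / (a - l q - 1)) = 1"
      by simp
  qed
  have B: "(\<Prod>q\<in>{1..n+1}. (a - l q - \<theta>) / (a - l q - 1)) * (\<Prod>q\<in>{1..n} - {p}. (a - m q + \<theta> - 1) / (a - m q)) =
     ((\<Prod>q\<in>{1..p}. (a - l q - \<theta>) / (a - l q - 1)) * (\<Prod>q\<in>{p<..n+1}. (a - l q - \<theta>) / (a - l q - 1))) *
     ((\<Prod>q\<in>{1..<p}. (a - m q + \<theta> - 1) / (a - m q)) * (\<Prod>q\<in>{p<..n}. (a - m q + \<theta> - 1) / (a - m q)))"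
    (is "?B = _")
    unfolding prod_minus_split[OF p] using p by (subst prod_atMost_split[of p]) auto
  have "(V * U (m(p := a)) * P (m(p := a)) * Q (m(p := a))) * ?B = (V * U m * P m * Q m) * kappa \<theta> m p a"
    unfolding B U P Q using 1 2 3 4 by algebra
  then have e: "cpx (V * U (m(p := a)) * P (m(p := a)) * Q (m(p := a))) * cpx ?B =
      cpx (V * U m * P m * Q m) * cpx (kappa \<theta> m p a)"
    by (simp only: of_real_mult[symmetric])
  have W: "weight_I \<theta> w n l m' = cpx (V * U m' * P m' * Q m') * (\<Prod>p\<in>{1..n}. w n (m' p))" for m'
    unfolding weight_I_Gamma_ratio V_def U_def P_def Q_def ..
  have "(\<Prod>q\<in>{1..n}. w n ((m(p := a)) q)) * w n (a - 1) = (\<Prod>q\<in>{1..n}. w n (m q)) * w n a"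
    using p mp by (rule prod_move)
  with e show ?thesis unfolding W by (rule mult_combine)
qed

text \<open>The row \<open>l\<close> changes above a fixed row \<open>m\<close>. The two mixed
  products reach the entries of \<open>m\<close> with \<open>q < p\<close> and
  \<open>q \<ge> p\<close>, with the same rational factor, and together give the product over all of
  \<open>m\<close>. Within \<open>l\<close> the factor \<open>kappa\<close> corrects the left-hand
  particles.\<close>

lemma weight_I_move_upper:
  fixes l m :: "nat \<Rightarrow> real"
  assumes \<theta>: "\<theta> > 0" and p: "p \<in> {1..n+1}" and lp: "l p = a - 1"
    and right: "\<And>q. q \<in> {p<..n+1} \<Longrightarrow> l q + \<theta> \<le> a - 1"
    and left: "\<And>q. q \<in> {1..<p} \<Longrightarrow> a + \<theta> \<le> l q"
    and right': "\<And>q. q \<in> {p..n} \<Longrightarrow> m q \<le> a - 1"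
    and left': "\<And>q. q \<in> {1..<p} \<Longrightarrow> a + \<theta> \<le> m q"
  shows "weight_I \<theta> w n (l(p := a)) m * cpx (kappa \<theta> l p a) =
    weight_I \<theta> w n l m * cpx ((\<Prod>q\<in>{1..n+1} - {p}. (a - l q - \<theta>) / (a - l q - 1)) *
      (\<Prod>q\<in>{1..n}. (a - m q + \<theta> - 1) / (a - m q)))"
proof -
  define U where "U = (\<Prod>q\<in>{1..n}. \<Prod>r\<in>{1..<q}. Gamma_ratio 1 \<theta> (m r - m q))"
  define P where "P = (\<lambda>l::nat \<Rightarrow> real. \<Prod>q\<in>{1..n+1}. \<Prod>r\<in>{1..<q}. Gamma_ratio 0 (1 - \<theta>) (m r - l q))"
  define Q where "Q = (\<lambda>l::nat \<Rightarrow> real. \<Prod>q\<in>{1..n}. \<Prod>r\<in>{1..q}. Gamma_ratio \<theta> 1 (l r - m q))"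
  define V where "V = (\<lambda>l::nat \<Rightarrow> real. \<Prod>q\<in>{1..n+1}. \<Prod>r\<in>{1..<q}. Gamma_ratio (1 - \<theta>) 0 (l r - l q))"
  have V: "V (l(p := a)) = V l *
    ((\<Prod>q\<in>{p<..n+1}. (a - 1 - l q + (1 - \<theta>)) / (a - 1 - l q + 0)) *
     (\<Prod>q\<in>{1..<p}. (l q - a + 0) / (l q - a + (1 - \<theta>))))"
    unfolding V_def using \<theta> by (intro triangle_move) (use assms in auto)
  have *: "Gamma_ratio 0 (1 - \<theta>) (m r - (l(p := a)) q) = Gamma_ratio 0 (1 - \<theta>) (m r - l q) *
     ((if r = p then 1 else 1) * (if q = p then (a - m r + \<theta> - 1) / (a - m r) else 1))"
    if "q \<in> {1..n+1}" "r \<in> {1..<q}" for q r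
  proof (cases "q = p")
    case True
    have "(m r - a + (1 - \<theta>)) / (m r - a) = (a - m r + \<theta> - 1) / (a - m r)"
      by (subst minus_divide_divide[symmetric]) (simp add: algebra_simps)
    then show ?thesis
      using that lp \<theta> True left'[of r] Gamma_ratio_minus1[of "m r - l p" 0 "1 - \<theta>"]
      by (simp add: algebra_simps)
  qed auto
  have P: "P (l(p := a)) = P l * (\<Prod>q\<in>{1..<p}. (a - m q + \<theta> - 1) / (a - m q))"
    unfolding P_def
    using prod_prod_update[where Q = "{1..n+1}" and R = "\<lambda>q. {1..<q}" and p = p, OF _ _ *] p
    by simp
  have *: "Gamma_ratio \<theta> 1 ((l(p := a)) r - m q) = Gamma_ratio \<theta> 1 (l r - m q) *
     ((if r = p then (a - m q + \<theta> - 1) / (a - m q) else 1) * (if q = p then 1 else 1))"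
    if "q \<in> {1..n}" "r \<in> {1..q}" for q r
    using that lp \<theta> right'[of q] Gamma_ratio_plus1[of "a - 1 - m q" \<theta> 1]
    by (auto simp: algebra_simps)
  have "{q \<in> {1..n}. p \<in> {1..q}} = {p..n}" using p by auto
  then have Q: "Q (l(p := a)) = Q l * (\<Prod>q\<in>{p..n}. (a - m q + \<theta> - 1) / (a - m q))"
    unfolding Q_def
    using prod_prod_update[where Q = "{1..n}" and R = "\<lambda>q. {1..q}" and p = p, OF _ _ *] p
    by simp
  have 1: "(\<Prod>q\<in>{p<..n+1}. (a - 1 - l q + (1 - \<theta>)) / (a - 1 - l q + 0)) =
      (\<Prod>q\<in>{p<..n+1}. (a - l q - \<theta>) / (a - l q - 1))"
    by (intro prod.cong) (auto simp: algebra_simps)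
  have 2: "(\<Prod>q\<in>{1..<p}. (l q - a + 0) / (l q - a + (1 - \<theta>))) * kappa \<theta> l p a =
      (\<Prod>q\<in>{1..<p}. (a - l q - \<theta>) / (a - l q - 1))"
    unfolding kappa_def prod.distrib[symmetric]
  proof (intro prod.cong refl)
    fix q assume q: "q \<in> {1..<p}"
    have "(l q - a + 0) / (l q - a + (1 - \<theta>)) = (a - l q) / (a - l q + \<theta> - 1)"
      by (subst minus_divide_divide[symmetric]) (simp add: algebra_simps)
    moreover have "a - l q \<noteq> 0" "a - l q + \<theta> - 1 \<noteq> 0" using left[OF q] \<theta> by auto
    ultimately show "(l q - a + 0) / (l q - a + (1 - \<theta>)) *
       ((a - l q - \<theta>) / (a - l q - 1) * ((a - l q + \<theta> - 1) / (a - l q))) =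
       (a - l q - \<theta>) / (a - l q - 1)"
      by simp
  qed
  have A: "(\<Prod>q\<in>{1..n+1} - {p}. (a - l q - \<theta>) / (a - l q - 1)) * (\<Prod>q\<in>{1..n}. (a - m q + \<theta> - 1) / (a - m q)) =
     ((\<Prod>q\<in>{1..<p}. (a - l q - \<theta>) / (a - l q - 1)) * (\<Prod>q\<in>{p<..n+1}. (a - l q - \<theta>) / (a - l q - 1))) *
     ((\<Prod>q\<in>{1..<p}. (a - m q + \<theta> - 1) / (a - m q)) * (\<Prod>q\<in>{p..n}. (a - m q + \<theta> - 1) / (a - m q)))"
    (is "?A = _")
    unfolding prod_minus_split[OF p] using p by (subst prod_lessThan_split[of p n]) auto
  have "(V (l(p := a)) * U * P (l(p := a)) * Q (l(p := a))) * kappa \<theta> l p a = (V l * U * P l * Q l) * ?A"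
    unfolding A V P Q 1 2[symmetric] by (simp only: mult_ac)
  then have e: "cpx (V (l(p := a)) * U * P (l(p := a)) * Q (l(p := a))) * cpx (kappa \<theta> l p a) =
      cpx (V l * U * P l * Q l) * cpx ?A"
    by (simp only: of_real_mult[symmetric])
  have W: "weight_I \<theta> w n l' m = cpx (V l' * U * P l' * Q l') * (\<Prod>p\<in>{1..n}. w n (m p))" for l'
    unfolding weight_I_Gamma_ratio V_def U_def P_def Q_def ..
  show ?thesis unfolding W using mult_combine[OF e, of "\<Prod>p\<in>{1..n}. w n (m p)" 1 "\<Prod>p\<in>{1..n}. w n (m p)" 1] by simp
qed


section \<open>Moving strings of particles\<close>

lemma Ints_less_imp_add1_le:
  fixes x y :: real
  assumes "x \<in> \<int>" "y \<in> \<int>" "x < y"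
  shows "x + 1 \<le> y"
  using assms by (auto elim!: Ints_cases)

text \<open>Membership is reduced to integrality, bounds and inequalities between neighbours, the
  form in which it can be verified for an array obtained by a move.\<close>

lemma W_space_iff:
  "l \<in> W_space \<theta> M n \<longleftrightarrow> l \<in> extensional {1..n} \<and>
     (\<forall>p\<in>{1..n}. l p + real p * \<theta> \<in> \<int> \<and> 0 \<le> l p + real p * \<theta> \<and> l p + real p * \<theta> \<le> real M) \<and>
     (\<forall>p\<in>{1..<n}. l (p + 1) + \<theta> \<le> l p)" (is "_ \<longleftrightarrow> ?R")
proof
  assume "l \<in> W_space \<theta> M n"
  then obtain lam where lam: "lam \<in> Lambda_space M n"
    and l: "l = (\<lambda>i\<in>{1..n}. of_int (lam i) - real i * \<theta>)"
    unfolding W_space_def by blast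
  have bound: "0 \<le> lam p \<and> lam p \<le> int M" if "p \<in> {1..n}" for p
    using lam that unfolding Lambda_space_def by (auto simp: PiE_def Pi_def)
  have "lam (p + 1) \<le> lam p" if "p \<in> {1..<n}" for p
    using lam that unfolding Lambda_space_def by auto
  then have "real_of_int (lam (p + 1)) \<le> real_of_int (lam p)" if "p \<in> {1..<n}" for p
    using that by simp
  moreover have "0 \<le> real_of_int (lam p) \<and> real_of_int (lam p) \<le> real M" if "p \<in> {1..n}" for p
    using bound[OF that] by linarith
  ultimately show ?R
    unfolding l by (auto simp: algebra_simps)
next
  assume R: ?R
  define lam where "lam = (\<lambda>i\<in>{1..n}. \<lfloor>l i + real i * \<theta>\<rfloor>)"
  have lam: "real_of_int (lam p) = l p + real p * \<theta>" if "p \<in> {1..n}" for p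
    using R that by (auto simp: lam_def elim!: Ints_cases)
  have step: "lam (p + 1) \<le> lam p" if "p \<in> {1..<n}" for p
  proof -
    have "real_of_int (lam (p + 1)) \<le> real_of_int (lam p)"
      using R that by (subst (1 2) lam) (auto simp: algebra_simps)
    then show ?thesis by simp
  qed
  have anti: "lam q \<le> lam p" if "p \<in> {1..n}" "p \<le> q" "q \<le> n" for p q
    using that(2,3)
  proof (induction q rule: dec_induct)
    case (step m)
    then have "lam (m + 1) \<le> lam m" using that(1) by (intro \<open>\<And>p. p \<in> {1..<n} \<Longrightarrow> lam (p + 1) \<le> lam p\<close>) auto
    then show ?case using step by simp
  qed simp
  have "lam \<in> {1..n} \<rightarrow>\<^sub>E {0..int M}"
  proof (intro PiE_I)
    fix p assume p: "p \<in> {1..n}"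
    have "0 \<le> real_of_int (lam p)" "real_of_int (lam p) \<le> real M"
      using R p by (auto simp: lam)
    then show "lam p \<in> {0..int M}" by simp
  qed (auto simp: lam_def)
  then have "lam \<in> Lambda_space M n"
    unfolding Lambda_space_def using anti by auto
  moreover have "l = (\<lambda>i\<in>{1..n}. of_int (lam i) - real i * \<theta>)"
    using R by (auto simp: fun_eq_iff lam extensional_def)
  ultimately show "l \<in> W_space \<theta> M n"
    unfolding W_space_def by blast
qed

lemma X_space_iff:
  "L \<in> X_space \<theta> M N k \<longleftrightarrow> L \<in> extensional {k..N} \<and>
     (\<forall>j\<in>{k..N}. L j \<in> extensional {1..j}) \<and>
     (\<forall>j\<in>{k..N}. \<forall>p\<in>{1..j}. L j p + real p * \<theta> \<in> \<int> \<and>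
        0 \<le> L j p + real p * \<theta> \<and> L j p + real p * \<theta> \<le> real M) \<and>
     (\<forall>j\<in>{k..N}. \<forall>p\<in>{1..<j}. L j (p + 1) + \<theta> \<le> L j p) \<and>
     (\<forall>j\<in>{k..<N}. \<forall>p\<in>{1..j}. L j p \<le> L (j + 1) p \<and> L (j + 1) (p + 1) + \<theta> \<le> L j p)"
  unfolding X_space_def interlaces_def PiE_def Pi_def mem_Collect_eq Int_iff W_space_iff
  by (auto simp: algebra_simps atLeastLessThanSuc_atLeastAtMost)

text \<open>The string is set to an absolute position instead of being shifted by one. The same
  function thus moves up (to \<open>a\<close>) and down (to \<open>a - 1\<close>), and the two undo
  each other on a string of constant position.\<close>

definition move_string :: "(nat \<Rightarrow> nat \<Rightarrow> real) \<Rightarrow> nat \<Rightarrow> nat \<Rightarrow> nat \<Rightarrow> real \<Rightarrow> nat \<Rightarrow> nat \<Rightarrow> real" where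
  "move_string L j i p b = (\<lambda>m q. if m \<in> {j..i} \<and> q = p then b else L m q)"

lemma move_string_apply:
  "m \<in> {j..i} \<Longrightarrow> move_string L j i p b m p = b"
  "m \<notin> {j..i} \<Longrightarrow> move_string L j i p b m = L m"
  "q \<noteq> p \<Longrightarrow> move_string L j i p b m q = L m q"
  by (auto simp: move_string_def)

text \<open>
  Up to the factor \<open>\<theta>\<close>, \<open>coef_A\<close> is the residue at \<open>a\<close> of the \<open>j\<close>-th summand of \<open>R1\<close> if \<open>L j p = a - 1\<close>; up
  to the factor \<open>- \<theta>\<close>, \<open>coef_B\<close> is the residue of the \<open>(i + 1)\<close>-st summand if \<open>L i p = a\<close>.
\<close>

definition coef_A :: "real \<Rightarrow> nat \<Rightarrow> (nat \<Rightarrow> nat \<Rightarrow> real) \<Rightarrow> nat \<Rightarrow> nat \<Rightarrow> real \<Rightarrow> real" where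
  "coef_A \<theta> k L j p a =
     (if j = k then \<Prod>q\<in>{1..j} - {p}. (a - L j q + \<theta> - 1) / (a - L j q - 1)
      else (\<Prod>q\<in>{1..j} - {p}. (a - L j q - \<theta>) / (a - L j q - 1)) *
           (\<Prod>q\<in>{1..j-1}. (a - L (j-1) q + \<theta> - 1) / (a - L (j-1) q)))"

definition coef_B :: "real \<Rightarrow> nat \<Rightarrow> (nat \<Rightarrow> nat \<Rightarrow> real) \<Rightarrow> nat \<Rightarrow> nat \<Rightarrow> real \<Rightarrow> real" where
  "coef_B \<theta> N L i p a =
     (if i = N then \<Prod>q\<in>{1..i} - {p}. (a - L i q - \<theta>) / (a - L i q)
      else (\<Prod>q\<in>{1..i+1}. (a - L (i+1) q - \<theta>) / (a - L (i+1) q - 1)) *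
           (\<Prod>q\<in>{1..i} - {p}. (a - L i q + \<theta> - 1) / (a - L i q)))"

text \<open>The context is instantiated twice, with the given data and with the reflected data. The
  nonvanishing of the denominator is part of \<open>ratio\<close>, since a quotient by zero would
  silently be zero.\<close>

locale corners =
  fixes \<theta> :: real and N k M :: nat
    and w :: "nat \<Rightarrow> real \<Rightarrow> complex" and \<phi> :: "nat \<Rightarrow> complex \<Rightarrow> complex"
  assumes \<theta>_pos: "\<theta> > 0"
    and k_pos: "1 \<le> k" and k_le_N: "k \<le> N"
    and w_nonzero: "\<And>j x. j \<in> {k..N} \<Longrightarrow> x \<in> {- real j * \<theta> .. real M - \<theta>} \<Longrightarrow> w j x \<noteq> 0"
    and ratio: "\<And>j x. j \<in> {k..N} \<Longrightarrow> x \<in> {1 - real j * \<theta> .. real M - \<theta>} \<Longrightarrow>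
        \<phi> j (cpx x) \<noteq> 0 \<and> \<phi> (j + 1) (cpx x) / \<phi> j (cpx x) = w j (x - 1) / w j x"
begin

abbreviation X :: "(nat \<Rightarrow> nat \<Rightarrow> real) set" where "X \<equiv> X_space \<theta> M N k"
abbreviation A where "A \<equiv> coef_A \<theta> k"
abbreviation B where "B \<equiv> coef_B \<theta> N"
abbreviation tw where "tw \<equiv> total_weight \<theta> N k w"

section \<open>Order relations between the particles of a configuration\<close>

lemma X_int:
  "L \<in> X \<Longrightarrow> j \<in> {k..N} \<Longrightarrow> p \<in> {1..j} \<Longrightarrow> L j p + real p * \<theta> \<in> \<int>"
  by (auto simp: X_space_iff)

lemma X_nonneg:
  "L \<in> X \<Longrightarrow> j \<in> {k..N} \<Longrightarrow> p \<in> {1..j} \<Longrightarrow> 0 \<le> L j p + real p * \<theta>"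
  by (auto simp: X_space_iff)

lemma X_le_M:
  "L \<in> X \<Longrightarrow> j \<in> {k..N} \<Longrightarrow> p \<in> {1..j} \<Longrightarrow> L j p + real p * \<theta> \<le> real M"
  by (auto simp: X_space_iff)

lemma X_bounds:
  assumes "L \<in> X" "j \<in> {k..N}" "p \<in> {1..j}"
  shows "- real j * \<theta> \<le> L j p" "L j p \<le> real M - \<theta>"
proof -
  have "real p * \<theta> \<le> real j * \<theta>" "1 * \<theta> \<le> real p * \<theta>"
    using assms \<theta>_pos by (auto intro!: mult_right_mono)
  then show "- real j * \<theta> \<le> L j p" "L j p \<le> real M - \<theta>"
    using X_nonneg[OF assms] X_le_M[OF assms] by auto
qed

lemma X_row:
  assumes L: "L \<in> X" "j \<in> {k..N}" and "q \<in> {1..<p}" "p \<le> j"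
  shows "L j p + \<theta> \<le> L j q"
proof -
  have "q + 1 \<le> p" using assms by simp
  then show ?thesis using \<open>p \<le> j\<close>
  proof (induction p rule: dec_induct)
    case base
    then show ?case using L \<open>q \<in> {1..<p}\<close> by (auto simp: X_space_iff)
  next
    case (step m)
    then have "L j (m + 1) + \<theta> \<le> L j m"
      using L \<open>q \<in> {1..<p}\<close> by (auto simp: X_space_iff)
    then show ?case using step \<theta>_pos by simp
  qed
qed

lemma X_row_le:
  assumes "L \<in> X" "j \<in> {k..N}" and "q \<in> {1..p}" "p \<le> j"
  shows "L j p \<le> L j q"
  using X_row[OF assms(1,2), of q p] assms \<theta>_pos by (cases "q = p") auto

lemma X_up:
  assumes "L \<in> X" "j \<in> {k..<N}" "q \<in> {1..p}" "p \<le> j"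
  shows "L j p \<le> L (j + 1) q"
proof -
  have "L j p \<le> L (j + 1) p" using assms by (auto simp: X_space_iff)
  also have "\<dots> \<le> L (j + 1) q" using assms by (intro X_row_le) auto
  finally show ?thesis .
qed

lemma X_down:
  assumes "L \<in> X" "j \<in> {k..<N}" "q \<in> {1..<p}" "p \<le> j + 1"
  shows "L (j + 1) p + \<theta> \<le> L j q"
proof -
  have "L (j + 1) p \<le> L (j + 1) (q + 1)" using assms by (intro X_row_le) auto
  moreover have "L (j + 1) (q + 1) + \<theta> \<le> L j q" using assms by (auto simp: X_space_iff)
  ultimately show ?thesis by simp
qed

lemma X_mono:
  assumes "L \<in> X" "k \<le> j" "j \<le> m" "m \<le> N" "p \<in> {1..j}"
  shows "L j p \<le> L m p"
  using assms(3,4)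
proof (induction m rule: dec_induct)
  case (step m)
  then show ?case using X_up[of L m p p] assms by auto
qed simp

text \<open>The level ranges reach one step beyond the string: by interlacing, the particle with
  index \<open>p - 1\<close> on level \<open>j - 1\<close> bounds the string from above, and the one
  with index \<open>p + 1\<close> on level \<open>i + 1\<close> bounds it from below. The neighbours
  with index \<open>p\<close> itself appear in \<open>above\<close> and
  \<open>below\<close>.\<close>

lemma move_string_in_X:
  assumes L: "L \<in> X" and ji: "k \<le> j" "j \<le> i" "i \<le> N" and p: "p \<in> {1..j}"
    and b: "b + real p * \<theta> \<in> \<int>" "0 \<le> b + real p * \<theta>" "b + real p * \<theta> \<le> real M"
    and left: "\<And>m. 1 < p \<Longrightarrow> k \<le> m \<Longrightarrow> j \<le> m + 1 \<Longrightarrow> m \<le> i \<Longrightarrow> b + \<theta> \<le> L m (p - 1)"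
    and right: "\<And>m. p < m \<Longrightarrow> m \<le> N \<Longrightarrow> j \<le> m \<Longrightarrow> m \<le> i + 1 \<Longrightarrow> L m (p + 1) + \<theta> \<le> b"
    and above: "i < N \<Longrightarrow> b \<le> L (i + 1) p"
    and below: "k < j \<Longrightarrow> p < j \<Longrightarrow> L (j - 1) p \<le> b"
  shows "move_string L j i p b \<in> X"
  unfolding X_space_iff
proof (intro conjI ballI)
  let ?U = "move_string L j i p b"
  have "?U m = L m" if "m \<notin> {k..N}" for m
    using that ji by (intro move_string_apply) auto
  then show "?U \<in> extensional {k..N}"
    using L by (auto simp: X_space_iff extensional_def)
  fix m assume m: "m \<in> {k..N}"
  show "?U m \<in> extensional {1..m}"
    using L m p ji by (auto simp: X_space_iff extensional_def move_string_def)
  {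
    fix q assume q: "q \<in> {1..m}"
    show "?U m q + real q * \<theta> \<in> \<int>" "0 \<le> ?U m q + real q * \<theta>" "?U m q + real q * \<theta> \<le> real M"
      using L m q b X_int X_nonneg X_le_M by (auto simp: move_string_def)
  }
  fix q assume q: "q \<in> {1..<m}"
  consider "m \<in> {j..i}" "q + 1 = p" | "m \<in> {j..i}" "q = p" | "m \<notin> {j..i} \<or> (q + 1 \<noteq> p \<and> q \<noteq> p)"
    by blast
  then show "?U m (q + 1) + \<theta> \<le> ?U m q"
  proof cases
    case 1
    then show ?thesis using left[of m] m q by (auto simp: move_string_def)
  next
    case 2
    then show ?thesis using right[of m] m q by (auto simp: move_string_def)
  next
    case 3
    then show ?thesis using X_row[OF L m, of q "q + 1"] q by (auto simp: move_string_def)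
  qed
next
  let ?U = "move_string L j i p b"
  fix m q assume m: "m \<in> {k..<N}" and q: "q \<in> {1..m}"
  show "?U m q \<le> ?U (m + 1) q"
  proof (cases "q = p")
    case True
    consider "m \<in> {j..i}" "m + 1 \<in> {j..i}" | "m = i" | "m + 1 = j" | "m \<notin> {j..i}" "m + 1 \<notin> {j..i}"
      using ji by fastforce
    then show ?thesis
    proof cases
      case 2
      then show ?thesis using above m ji True by (auto simp: move_string_def)
    next
      case 3
      then show ?thesis using below m ji True q by (auto simp: move_string_def)
    next
      case 4
      then show ?thesis using X_up[OF L m, of q q] q by (auto simp: move_string_def)
    qed (auto simp: move_string_def True)
  next
    case False
    then show ?thesis using X_up[OF L m, of q q] q by (auto simp: move_string_def)
  qed
  consider "m + 1 \<in> {j..i}" "q + 1 = p" | "m \<in> {j..i}" "q = p" |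
     "m + 1 \<notin> {j..i} \<or> q + 1 \<noteq> p" "m \<notin> {j..i} \<or> q \<noteq> p"
    by blast
  then show "?U (m + 1) (q + 1) + \<theta> \<le> ?U m q"
  proof cases
    case 1
    then show ?thesis using left[of m] m q by (auto simp: move_string_def)
  next
    case 2
    then show ?thesis using right[of "m + 1"] m q by (auto simp: move_string_def)
  next
    case 3
    then show ?thesis using X_down[OF L m, of q "q + 1"] q by (auto simp: move_string_def)
  qed
qed

text \<open>\<open>g\<close> couples level \<open>m\<close> to the level above and carries its
  weight \<open>w m\<close>, \<open>h\<close> couples it to the level below; no particle of level
  \<open>m\<close> enters the remaining factor.\<close>

lemma total_weight_factor:
  assumes "m \<in> {k..N}"
  defines "g \<equiv> \<lambda>L j. if j = N then weight_Ht \<theta> N w (L N) else weight_I \<theta> w j (L (j + 1)) (L j)"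
  defines "h \<equiv> \<lambda>L j. if j = k then weight_Hb \<theta> k (L k) else g L (j - 1)"
  shows "tw L = g L m * h L m *
     ((if m = k then 1 else weight_Hb \<theta> k (L k)) * (\<Prod>j\<in>{k..N} - {m} - {j. j + 1 = m}. g L j))"
proof -
  have "{k..N} - {N} = {k..<N}" by auto
  then have "(\<Prod>j\<in>{k..N}. g L j) = weight_Ht \<theta> N w (L N) *
      (\<Prod>j\<in>{k..<N}. weight_I \<theta> w j (L (j + 1)) (L j))"
    using k_le_N by (subst prod.remove[of _ N]) (auto simp: g_def intro!: prod.cong)
  then have tw: "tw L = weight_Hb \<theta> k (L k) * (\<Prod>j\<in>{k..N}. g L j)"
    by (simp add: total_weight_def)
  have g: "(\<Prod>j\<in>{k..N}. g L j) = g L m * (\<Prod>j\<in>{k..N} - {m}. g L j)"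
    using assms(1) by (intro prod.remove) auto
  show ?thesis
  proof (cases "m = k")
    case True
    then have "{k..N} - {m} - {j. j + 1 = m} = {k..N} - {m}" by auto
    then show ?thesis using True by (simp add: tw g h_def)
  next
    case False
    have "(\<Prod>j\<in>{k..N} - {m}. g L j) = g L (m - 1) * (\<Prod>j\<in>{k..N} - {m} - {m - 1}. g L j)"
      using assms(1) False k_pos by (intro prod.remove) auto
    moreover have "{j. j + 1 = m} = {m - 1}" using assms(1) k_pos by auto
    ultimately show ?thesis using False by (simp add: tw g h_def)
  qed
qed

text \<open>\<open>low\<close> describes the change of the upward coupling and \<open>up\<close>
  that of the downward coupling. What is left is the quotient of \<open>w m (a - 1)\<close> and
  \<open>w m a\<close>, which \<open>ratio\<close> expresses through \<open>\<phi>\<close>.\<close>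

lemma single_move:
  assumes L: "L \<in> X" and m: "m \<in> {k..N}" and p: "p \<in> {1..m}" and Lp: "L m p = a - 1"
    and U: "move_string L m m p a \<in> X"
  shows "tw L * cpx (A L m p a) * \<phi> m (cpx a) =
    tw (move_string L m m p a) * cpx (B L m p a) * \<phi> (m + 1) (cpx a)"
proof -
  let ?U = "move_string L m m p a"
  define g where "g = (\<lambda>L j. if j = N then weight_Ht \<theta> N w (L N) else weight_I \<theta> w j (L (j + 1)) (L j))"
  define h where "h = (\<lambda>L j. if j = k then weight_Hb \<theta> k (L k) else g L (j - 1))"
  define rest where "rest = (\<lambda>L. (if m = k then 1 else weight_Hb \<theta> k (L k)) *
    (\<Prod>j\<in>{k..N} - {m} - {j. j + 1 = m}. g L j))"
  have tw: "tw L = g L m * h L m * rest L" for L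
    unfolding g_def h_def rest_def by (rule total_weight_factor[OF m])
  have Um: "?U m = (L m)(p := a)"
    by (auto simp: move_string_def)
  have Uother: "?U j = L j" if "j \<noteq> m" for j
    using that by (auto simp: move_string_def)
  have right: "L m q + \<theta> \<le> a - 1" if "q \<in> {p<..m}" for q
    using X_row[OF L m, of p q] that p Lp by auto
  \<comment> \<open>The spacing on the left is needed after the move, hence it is read off the moved
    array.\<close>
  have left: "a + \<theta> \<le> L m q" if "q \<in> {1..<p}" for q
    using X_row[OF U m, of q p] that p by (auto simp: Um)
  have "rest ?U = rest L"
  proof -
    have "(\<Prod>j\<in>{k..N} - {m} - {j. j + 1 = m}. g ?U j) = (\<Prod>j\<in>{k..N} - {m} - {j. j + 1 = m}. g L j)"
    proof (intro prod.cong refl)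
      fix j assume "j \<in> {k..N} - {m} - {j. j + 1 = m}"
      then have "j \<noteq> m" "j + 1 \<noteq> m" by auto
      then show "g ?U j = g L j" by (auto simp: g_def Uother)
    qed
    then show ?thesis by (auto simp: rest_def Uother)
  qed
  have low: "g ?U m * cpx (B L m p a) * w m (a - 1) = g L m * cpx (kappa \<theta> (L m) p a) * w m a"
  proof (cases "m = N")
    case True
    then show ?thesis
      using weight_Ht_move[where l = "L N" and n = N and p = p and a = a and w = w, OF \<theta>_pos] p Lp right left
      by (simp add: g_def coef_B_def Um[unfolded True])
  next
    case False
    have right': "L (m + 1) q + \<theta> \<le> a - 1" if "q \<in> {p<..m+1}" for q
      using X_down[OF L, of m p q] that m False p Lp by auto
    have left': "a \<le> L (m + 1) q" if "q \<in> {1..p}" for q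
      using X_up[OF U, of m q p] that m False p by (auto simp: Um Uother)
    show ?thesis
      using weight_I_move_lower[where l = "L (m + 1)" and m = "L m" and n = m and p = p and a = a and w = w,
          OF \<theta>_pos p Lp right left right' left'] False
      by (simp add: g_def coef_B_def Um Uother)
  qed
  have up: "h ?U m * cpx (kappa \<theta> (L m) p a) = h L m * cpx (A L m p a)"
  proof (cases "m = k")
    case True
    then show ?thesis
      using weight_Hb_move[where l = "L k" and n = k and p = p and a = a, OF \<theta>_pos] p Lp right left
      by (simp add: h_def coef_A_def Um[unfolded True])
  next
    case False
    define n where "n = m - 1"
    have n: "m = n + 1" "n \<in> {k..<N}" using m False k_pos by (auto simp: n_def)
    have Un: "?U (n + 1) = (L (n + 1))(p := a)" "?U n = L n"
      using Um Uother[of n] n(1) by simp_all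
    have right': "L n q \<le> a - 1" if "q \<in> {p..n}" for q
      using X_up[OF L n(2), of p q] that p Lp n(1) by auto
    have left': "a + \<theta> \<le> L n q" if "q \<in> {1..<p}" for q
      using X_down[OF U n(2), of q p] that p unfolding Un by (auto simp: n(1))
    have n': "m - Suc 0 = n" "Suc n = m" "n \<noteq> N" "n \<noteq> m" using n by auto
    have "h L' m = weight_I \<theta> w n (L' m) (L' n)" for L'
      using False by (simp add: h_def g_def n')
    moreover have "A L m p a = (\<Prod>q\<in>{1..n+1} - {p}. (a - L m q - \<theta>) / (a - L m q - 1)) *
      (\<Prod>q\<in>{1..n}. (a - L n q + \<theta> - 1) / (a - L n q))"
      using False by (simp add: coef_A_def n')
    ultimately show ?thesis
      using weight_I_move_upper[where l = "L m" and m = "L n" and n = n and p = p and a = a and w = w,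
          OF \<theta>_pos _ Lp _ left right' left'] p right
      by (simp only: Um Uother[OF n'(4)] n(1)[symmetric])
  qed
  \<comment> \<open>The interval on which the ratio hypothesis is posed is exactly what a legal move
    gives: \<open>a - 1\<close> obeys the lower bound before it, \<open>a\<close> the upper bound
    after it.\<close>
  have a: "a \<in> {1 - real m * \<theta> .. real M - \<theta>}"
    using X_bounds(1)[OF L m p] X_bounds(2)[OF U m p] Lp by (simp add: Um)
  have wa: "w m a \<noteq> 0" using w_nonzero[OF m] a by auto
  have r: "\<phi> (m + 1) (cpx a) * w m a = w m (a - 1) * \<phi> m (cpx a)"
    using ratio[OF m a] wa by (auto simp: divide_simps mult_ac split: if_splits)
  \<comment> \<open>\<open>kappa\<close> is eliminated by substituting \<open>up\<close> and then
    \<open>low\<close>; the only factor divided out is \<open>w m a\<close>.\<close>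
  have "(tw L * cpx (A L m p a) * \<phi> m (cpx a)) * w m a =
      (g L m * cpx (kappa \<theta> (L m) p a) * w m a) * h ?U m * rest L * \<phi> m (cpx a)"
    unfolding tw using up by algebra
  also have "\<dots> = (tw ?U * cpx (B L m p a) * \<phi> (m + 1) (cpx a)) * w m a"
    unfolding low[symmetric] tw \<open>rest ?U = rest L\<close> using r by algebra
  finally show ?thesis using wa by simp
qed

text \<open>The lowest particle may stay behind at \<open>a - 1\<close>, since this is below the
  raised particle on the next level; the other bounds are inherited from the fully moved array. This
  provides the intermediate arrays of a move from the top down.\<close>

lemma move_string_shorten:
  assumes L: "L \<in> X" and U: "move_string L j i p a \<in> X"
    and ji: "k \<le> j" "j < i" "i \<le> N" and p: "p \<in> {1..j}" and Lp: "L j p = a - 1"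
  shows "move_string L (j + 1) i p a \<in> X"
proof (rule move_string_in_X[OF L])
  let ?U = "move_string L j i p a"
  have Up: "?U m p = a" if "m \<in> {j..i}" for m
    using that by (rule move_string_apply)
  show "a + real p * \<theta> \<in> \<int>" "0 \<le> a + real p * \<theta>" "a + real p * \<theta> \<le> real M"
    using X_int[OF U, of j p] X_nonneg[OF U, of j p] X_le_M[OF U, of j p] ji p Up by auto
  fix m
  show "a + \<theta> \<le> L m (p - 1)" if "1 < p" "k \<le> m" "j + 1 \<le> m + 1" "m \<le> i"
  proof -
    have "?U m (p - 1) = L m (p - 1)" using that by (intro move_string_apply) auto
    then show ?thesis using X_row[OF U, of m "p - 1" p] that ji p Up[of m] by auto
  qed
  show "L m (p + 1) + \<theta> \<le> a" if "p < m" "m \<le> N" "j + 1 \<le> m" "m \<le> i + 1"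
  proof -
    have "?U m (p + 1) = L m (p + 1)" by (intro move_string_apply) auto
    moreover have "m - 1 \<in> {k..<N}" "m - 1 \<in> {j..i}" "m - 1 + 1 = m" "p \<in> {1..<p + 1}" "p + 1 \<le> m - 1 + 1"
      using that ji p by auto
    ultimately show ?thesis using X_down[OF U, of "m - 1" p "p + 1"] Up[of "m - 1"] by simp
  qed
next
  let ?U = "move_string L j i p a"
  show "a \<le> L (i + 1) p" if "i < N"
    using X_up[OF U, of i p p] ji p that by (auto simp: move_string_def)
qed (use ji p Lp in auto)

text \<open>This allows the residue shared by two consecutive moves to be cancelled. On level
  \<open>j\<close> the factors are controlled by the moved array left of \<open>p\<close> and by the
  original one right of \<open>p\<close>; on level \<open>j - 1\<close> by \<open>gap\<close> left
  of \<open>p\<close>, and from \<open>p\<close> on by the vertical neighbour at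
  \<open>a - 1\<close>.\<close>

lemma coef_A_nonzero:
  assumes L: "L \<in> X" and U: "move_string L j i p a \<in> X"
    and ji: "k < j" "j \<le> i" "i \<le> N" and p: "p \<in> {1..j-1}" and Lp: "L j p = a - 1" "L (j - 1) p = a - 1"
    and gap: "\<And>q. q \<in> {1..<p} \<Longrightarrow> a + \<theta> \<le> L (j - 1) q"
  shows "A L j p a \<noteq> 0"
proof -
  have pj: "p \<in> {1..j}" using p by auto
  have nz1: "a - L j q - \<theta> \<noteq> 0 \<and> a - L j q - 1 \<noteq> 0" if "q \<in> {1..j} - {p}" for q
  proof (cases "q < p")
    case True
    then show ?thesis
      using X_row[OF U, of j q p] that ji pj \<theta>_pos by (auto simp: move_string_def)
  next
    case False
    then show ?thesis
      using X_row[OF L, of j p q] that ji pj Lp \<theta>_pos by auto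
  qed
  have nz2: "a - L (j - 1) q + \<theta> - 1 \<noteq> 0 \<and> a - L (j - 1) q \<noteq> 0" if "q \<in> {1..j-1}" for q
  proof (cases "q < p")
    case True
    then show ?thesis using gap[of q] that \<theta>_pos by auto
  next
    case False
    moreover have "j - 1 \<in> {k..N}" using ji by auto
    ultimately have "L (j - 1) q \<le> L (j - 1) p"
      using X_row_le[OF L, of "j - 1" p q] that p by auto
    then show ?thesis using Lp \<theta>_pos by auto
  qed
  show ?thesis
    unfolding coef_A_def using nz1 nz2 ji by auto
qed

text \<open>Induction on the lower end: the part above level \<open>j\<close> moves first, giving
  \<open>V\<close>, then the particle on level \<open>j\<close> follows. The residue at the junction
  occurs in both identities, as \<open>coef_A\<close> for \<open>L\<close> and as
  \<open>coef_B\<close> for \<open>V\<close>; it is nonzero and cancels.\<close>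

lemma string_move:
  assumes "L \<in> X" "k \<le> j" "j \<le> i" "i \<le> N" "p \<in> {1..j}"
    and "\<And>m. m \<in> {j..i} \<Longrightarrow> L m p = a - 1" and "move_string L j i p a \<in> X"
  shows "tw L * cpx (A L j p a) * \<phi> j (cpx a) =
    tw (move_string L j i p a) * cpx (B L i p a) * \<phi> (i + 1) (cpx a)"
  using \<open>j \<le> i\<close> assms(2,5,6,7)
proof (induction j rule: inc_induct)
  case base
  then show ?case using assms by (intro single_move) auto
next
  case (step j)
  define V where "V = move_string L (j + 1) i p a"
  let ?U = "move_string L j i p a"
  have L: "L \<in> X" by fact
  have U: "?U \<in> X" by fact
  have Lp: "L m p = a - 1" if "m \<in> {j..i}" for m using step that by auto
  have V: "V \<in> X"
    unfolding V_def using step assms by (intro move_string_shorten[OF L U]) auto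
  have IH: "tw L * cpx (A L (j + 1) p a) * \<phi> (j + 1) (cpx a) = tw V * cpx (B L i p a) * \<phi> (i + 1) (cpx a)"
    using step.IH step.prems V Lp by (auto simp: V_def)
  have VU: "move_string V j j p a = ?U"
    using step by (auto simp: V_def move_string_def fun_eq_iff)
  have Vj: "V j = L j" "V (j - 1) = L (j - 1)"
    by (auto simp: V_def move_string_apply)
  have Vj1: "V (j + 1) = (L (j + 1))(p := a)"
    using step by (auto simp: V_def move_string_def)
  have single: "tw V * cpx (A V j p a) * \<phi> j (cpx a) = tw ?U * cpx (B V j p a) * \<phi> (j + 1) (cpx a)"
    using single_move[OF V, of j p a] step assms U by (auto simp: VU Vj)
  have AV: "A V j p a = A L j p a"
    by (simp only: coef_A_def Vj)
  \<comment> \<open>The index \<open>p\<close> contributes \<theta> to either side: as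
    \<open>(- \<theta>) / (- 1)\<close> on level \<open>j + 1\<close> of \<open>V\<close>, where the
    particle is already at \<open>a\<close>, and as \<open>\<theta> / 1\<close> on level
    \<open>j\<close> of \<open>L\<close>, where it is still at \<open>a - 1\<close>. All other
    factors agree.\<close>
  have BV: "B V j p a = A L (j + 1) p a"
  proof -
    have p: "p \<in> {1..j + 1}" "p \<in> {1..j}" using step by auto
    have "(\<Prod>q\<in>{1..j+1} - {p}. (a - V (j+1) q - \<theta>) / (a - V (j+1) q - 1)) =
       (\<Prod>q\<in>{1..j+1} - {p}. (a - L (j+1) q - \<theta>) / (a - L (j+1) q - 1))"
      unfolding Vj1 by (intro prod.cong) auto
    then have 1: "(\<Prod>q\<in>{1..j+1}. (a - V (j+1) q - \<theta>) / (a - V (j+1) q - 1)) =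
       \<theta> * (\<Prod>q\<in>{1..j+1} - {p}. (a - L (j+1) q - \<theta>) / (a - L (j+1) q - 1))"
      unfolding prod.remove[OF finite_atLeastAtMost p(1)] by (simp add: Vj1[simplified])
    have 2: "(\<Prod>q\<in>{1..j}. (a - L j q + \<theta> - 1) / (a - L j q)) =
       \<theta> * (\<Prod>q\<in>{1..j} - {p}. (a - L j q + \<theta> - 1) / (a - L j q))"
      unfolding prod.remove[OF finite_atLeastAtMost p(2)] using Lp[of j] step.hyps by simp
    have "j \<noteq> N" "j + 1 \<noteq> k" "j + 1 - 1 = j" using step assms by auto
    then show ?thesis
      by (simp only: coef_A_def coef_B_def Vj 1 2 if_False mult_ac)
  qed
  have "A L (j + 1) p a \<noteq> 0"
  proof (rule coef_A_nonzero[OF L V[unfolded V_def]])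
    fix q assume "q \<in> {1..<p}"
    then show "a + \<theta> \<le> L (j + 1 - 1) q"
      using X_row[OF U, of j q p] step assms by (auto simp: move_string_def)
  qed (use step assms Lp in auto)
  moreover have "\<phi> (j + 1) (cpx a) \<noteq> 0"
  proof -
    have "a \<in> {1 - real (j + 1) * \<theta> .. real M - \<theta>}"
    proof -
      have "- real (j + 1) * \<theta> \<le> a - 1"
        using X_bounds(1)[OF L, of "j + 1" p] step assms Lp[of "j + 1"] by auto
      moreover have "a \<le> real M - \<theta>"
        using X_bounds(2)[OF U, of "j + 1" p] step assms by (auto simp: move_string_def)
      ultimately show ?thesis by (simp add: algebra_simps)
    qed
    then show ?thesis using ratio[of "j + 1" a] step assms by auto
  qed
  moreover have "(tw L * cpx (A L j p a) * \<phi> j (cpx a)) * (cpx (A L (j + 1) p a) * \<phi> (j + 1) (cpx a)) =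
    (tw ?U * cpx (B L i p a) * \<phi> (i + 1) (cpx a)) * (cpx (A L (j + 1) p a) * \<phi> (j + 1) (cpx a))"
    using IH single unfolding AV BV by algebra
  ultimately show ?case by simp
qed

text \<open>Vertical contacts are absorbed by taking the longest run of particles at
  \<open>a - 1\<close>. The only other obstacle for \<open>p > 1\<close> is the particle with index
  \<open>p - 1\<close>, and its lowest relevant occurrence is decisive because positions with fixed
  index increase with the level; contact there makes a numerator of \<open>coef_A\<close> vanish.
  For \<open>p = 1\<close> only the wall at \<open>M\<close> remains.\<close>

lemma string_up_exists:
  assumes L: "L \<in> X" and j: "j \<in> {k..N}" and p: "p \<in> {1..j}" and Lp: "L j p = a - 1"
    and nz: "A L j p a \<noteq> 0" and bd: "p = 1 \<Longrightarrow> a \<noteq> real M + 1 - \<theta>"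
  obtains i where "j \<le> i" "i \<le> N" "\<And>m. m \<in> {j..i} \<Longrightarrow> L m p = a - 1"
    "move_string L j i p a \<in> X"
proof -
  define I where "I = {i \<in> {j..N}. \<forall>m\<in>{j..i}. L m p = a - 1}"
  have I: "finite I" "j \<in> I" using j Lp by (auto simp: I_def)
  define i where "i = Max I"
  have "i \<in> I" using Max_in[OF I(1)] I(2) by (auto simp: i_def)
  then have i: "j \<le> i" "i \<le> N" and str: "\<And>m. m \<in> {j..i} \<Longrightarrow> L m p = a - 1"
    by (auto simp: I_def)
  have int: "a - 1 + real p * \<theta> \<in> \<int>" using X_int[OF L j p] Lp by simp
  have jump: "x + \<theta> \<ge> a" if "x + real p * \<theta> + \<theta> \<in> \<int>" "a - 1 < x + \<theta>" for x
    using Ints_less_imp_add1_le[OF int that(1)] that(2) by simp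
  \<comment> \<open>Above the bottom level the decisive neighbour sits on level
    \<open>j - 1\<close>, which by monotonicity is at most its position on level \<open>j\<close>;
    on level \<open>k\<close> it is the neighbour in the same row.\<close>
  have left0: "a + \<theta> \<le> L (if j = k then k else j - 1) (p - 1)" if "1 < p"
  proof -
    define m where "m = (if j = k then k else j - 1)"
    have m: "m \<in> {k..N}" "p - 1 \<in> {1..m}" "m \<le> j" using j p that by (auto simp: m_def)
    have p1: "p - 1 \<in> {1..<p}" using that by auto
    have ge: "a - 1 + \<theta> \<le> L m (p - 1)"
    proof (cases "j = k")
      case True
      then show ?thesis using X_row[OF L j p1] p Lp by (simp add: m_def)
    next
      case False
      then obtain n where n: "j = n + 1" "n \<in> {k..<N}" "m = n"
        using j k_pos by (cases j) (auto simp: m_def)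
      then show ?thesis using X_down[OF L n(2) p1] p Lp by simp
    qed
    moreover have "a - 1 + \<theta> \<noteq> L m (p - 1)"
    proof
      assume eq: "a - 1 + \<theta> = L m (p - 1)"
      have "A L j p a = 0"
      proof (cases "j = k")
        case True
        then have "\<exists>q\<in>{1..j} - {p}. (a - L j q + \<theta> - 1) / (a - L j q - 1) = 0"
          using eq p that by (intro bexI[of _ "p - 1"]) (auto simp: m_def)
        then show ?thesis using True by (simp add: coef_A_def prod_zero)
      next
        case False
        then have "\<exists>q\<in>{1..j-1}. (a - L (j-1) q + \<theta> - 1) / (a - L (j-1) q) = 0"
          using eq p that by (intro bexI[of _ "p - 1"]) (auto simp: m_def)
        then have "(\<Prod>q\<in>{1..j-1}. (a - L (j-1) q + \<theta> - 1) / (a - L (j-1) q)) = 0"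
          by (intro prod_zero) auto
        then show ?thesis using False by (simp only: coef_A_def if_False mult_zero_right)
      qed
      with nz show False by simp
    qed
    ultimately have "a - 1 + real p * \<theta> < L m (p - 1) + real (p - 1) * \<theta>"
      using that by (simp add: of_nat_diff algebra_simps)
    from Ints_less_imp_add1_le[OF int X_int[OF L m(1,2)] this]
    show ?thesis using that by (simp add: m_def of_nat_diff algebra_simps)
  qed
  have left: "a + \<theta> \<le> L m (p - 1)" if "1 < p" "k \<le> m" "j \<le> m + 1" "m \<le> i" for m
  proof -
    define m0 where "m0 = (if j = k then k else j - 1)"
    have "L m0 (p - 1) \<le> L m (p - 1)"
      using that j p i by (intro X_mono[OF L]) (auto simp: m0_def)
    then show ?thesis using left0 that by (simp add: m0_def)
  qed
  have above: "a \<le> L (i + 1) p" if "i < N"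
  proof -
    have ip: "i \<in> {k..<N}" "p \<le> i" "i \<in> {j..i}" using j p i that by auto
    have ge: "a - 1 \<le> L (i + 1) p"
      using X_up[OF L ip(1), of p p] p ip str[OF ip(3)] by auto
    moreover have "L (i + 1) p \<noteq> a - 1"
    proof
      assume "L (i + 1) p = a - 1"
      then have "i + 1 \<in> I"
        using str i that by (auto simp: I_def le_Suc_eq)
      then show False using Max_ge[OF I(1), of "i + 1"] by (simp add: i_def)
    qed
    ultimately have "a - 1 + real p * \<theta> < L (i + 1) p + real p * \<theta>" by simp
    from Ints_less_imp_add1_le[OF int X_int[OF L] this] show ?thesis
      using ip p by auto
  qed
  have aM: "a + real p * \<theta> \<le> real M"
  proof (cases "p = 1")
    case True
    have "a - 1 + real p * \<theta> \<le> real M" "a - 1 + real p * \<theta> \<noteq> real M"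
      using X_le_M[OF L j p] Lp bd True by auto
    then show ?thesis
      using Ints_less_imp_add1_le[OF int, of "real M"] by simp
  next
    case False
    define m where "m = (if j = k then k else j - 1)"
    have m: "m \<in> {k..N}" "p - 1 \<in> {1..m}" using j p False by (auto simp: m_def)
    then show ?thesis
      using X_le_M[OF L m] left0 p False by (simp add: m_def of_nat_diff algebra_simps)
  qed
  have "move_string L j i p a \<in> X"
  proof (rule move_string_in_X[OF L])
    have "a + real p * \<theta> = (a - 1 + real p * \<theta>) + 1" by simp
    then show "a + real p * \<theta> \<in> \<int>" using int Ints_add Ints_1 by metis
    show "0 \<le> a + real p * \<theta>" using X_nonneg[OF L j p] Lp by simp
    show "L m (p + 1) + \<theta> \<le> a" if "p < m" "m \<le> N" "j \<le> m" "m \<le> i + 1" for m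
    proof (cases "m = j")
      case True
      then show ?thesis using X_row[OF L j, of p "p + 1"] that p Lp by auto
    next
      case False
      then have "m - 1 \<in> {k..<N}" "m - 1 \<in> {j..i}" "m - 1 + 1 = m" using that j by auto
      then show ?thesis
        using X_down[OF L, of "m - 1" p "p + 1"] str[of "m - 1"] that p by simp
    qed
    show "L (j - 1) p \<le> a" if "k < j" "p < j"
    proof -
      have "j - 1 \<in> {k..<N}" "j - 1 + 1 = j" "p \<le> j - 1" using that j by auto
      then show ?thesis using X_up[OF L, of "j - 1" p p] p Lp by simp
    qed
  qed (use j i p left above aM in auto)
  then show thesis using that i str by blast
qed

text \<open>The counterpart for downward moves: the run of particles at \<open>a\<close> is extended
  downwards as far as possible, and contact with the particle of index \<open>p + 1\<close> on its
  highest relevant level makes a numerator of \<open>coef_B\<close> vanish. That particle is absent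
  only for \<open>i = N\<close> and \<open>p = N\<close>, where the wall at 0 takes over.\<close>

lemma string_down_exists:
  assumes L: "L \<in> X" and i: "i \<in> {k..N}" and p: "p \<in> {1..i}" and Lp: "L i p = a"
    and nz: "B L i p a \<noteq> 0" and bd: "i = N \<Longrightarrow> p = N \<Longrightarrow> a \<noteq> - real N * \<theta>"
  obtains j where "k \<le> j" "j \<le> i" "p \<le> j" "\<And>m. m \<in> {j..i} \<Longrightarrow> L m p = a"
    "move_string L j i p (a - 1) \<in> X"
proof -
  \<comment> \<open>The maximum with \<open>p\<close> is needed because index \<open>p\<close>
    exists only on levels at least \<open>p\<close>.\<close>
  define J where "J = {j \<in> {max k p..i}. \<forall>m\<in>{j..i}. L m p = a}"
  have J: "finite J" "i \<in> J" using i p Lp by (auto simp: J_def)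
  define j where "j = Min J"
  have "j \<in> J" using Min_in[OF J(1)] J(2) by (auto simp: j_def)
  then have j: "k \<le> j" "j \<le> i" "p \<le> j" and str: "\<And>m. m \<in> {j..i} \<Longrightarrow> L m p = a"
    by (auto simp: J_def)
  have int: "a + real p * \<theta> \<in> \<int>" using X_int[OF L i p] Lp by simp
  have right0: "L (if i = N then N else i + 1) (p + 1) + \<theta> \<le> a - 1" if "i < N \<or> p < N"
  proof -
    define m where "m = (if i = N then N else i + 1)"
    have m: "m \<in> {k..N}" "p + 1 \<in> {1..m}" using i p that by (auto simp: m_def)
    have ge: "L m (p + 1) + \<theta> \<le> a"
    proof (cases "i = N")
      case True
      then show ?thesis using X_row[OF L i, of p "p + 1"] m p Lp by (auto simp: m_def)
    next
      case False
      then show ?thesis using X_down[OF L, of i p "p + 1"] i p Lp by (auto simp: m_def)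
    qed
    moreover have "L m (p + 1) + \<theta> \<noteq> a"
    proof
      assume eq: "L m (p + 1) + \<theta> = a"
      have "B L i p a = 0"
      proof (cases "i = N")
        case True
        then have "\<exists>q\<in>{1..i} - {p}. (a - L i q - \<theta>) / (a - L i q) = 0"
          using eq m by (intro bexI[of _ "p + 1"]) (auto simp: m_def)
        then show ?thesis using True by (simp add: coef_B_def prod_zero)
      next
        case False
        then have "\<exists>q\<in>{1..i+1}. (a - L (i+1) q - \<theta>) / (a - L (i+1) q - 1) = 0"
          using eq m by (intro bexI[of _ "p + 1"]) (auto simp: m_def)
        then have "(\<Prod>q\<in>{1..i+1}. (a - L (i+1) q - \<theta>) / (a - L (i+1) q - 1)) = 0"
          by (intro prod_zero) auto
        then show ?thesis using False by (simp only: coef_B_def if_False mult_zero_left)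
      qed
      with nz show False by simp
    qed
    ultimately have "L m (p + 1) + real (p + 1) * \<theta> < a + real p * \<theta>"
      by (simp add: algebra_simps)
    from Ints_less_imp_add1_le[OF X_int[OF L m] int this]
    show ?thesis by (simp add: m_def algebra_simps)
  qed
  have right: "L m (p + 1) + \<theta> \<le> a - 1" if "p < m" "m \<le> N" "j \<le> m" "m \<le> i + 1" for m
  proof -
    define m0 where "m0 = (if i = N then N else i + 1)"
    have "L m (p + 1) \<le> L m0 (p + 1)"
      using that i p j by (intro X_mono[OF L]) (auto simp: m0_def)
    moreover have "i < N \<or> p < N" using that by auto
    ultimately show ?thesis using right0 by (simp add: m0_def)
  qed
  have below: "L (j - 1) p \<le> a - 1" if "k < j" "p < j"
  proof -
    have jp: "j - 1 \<in> {k..N}" "j - 1 \<in> {k..<N}" "p \<in> {1..j-1}" "j - 1 + 1 = j" "j \<in> {j..i}"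
      using that i j p by auto
    have le: "L (j - 1) p \<le> a"
      using X_up[OF L jp(2), of p p] jp str[OF jp(5)] by auto
    moreover have "L (j - 1) p \<noteq> a"
    proof
      assume "L (j - 1) p = a"
      then have "L m p = a" if "m \<in> {j-1..i}" for m
        using str that by (cases "m = j - 1") auto
      then have "j - 1 \<in> J"
        using jp j by (auto simp: J_def)
      then have "j \<le> j - 1" unfolding j_def using J(1) by (intro Min_le)
      then show False using that by simp
    qed
    ultimately have "L (j - 1) p + real p * \<theta> < a + real p * \<theta>" by simp
    from Ints_less_imp_add1_le[OF X_int[OF L jp(1,3)] int this] show ?thesis by simp
  qed
  have a0: "0 \<le> a - 1 + real p * \<theta>"
  proof (cases "i = N \<and> p = N")
    case True
    then have "0 < a + real p * \<theta>"
      using X_nonneg[OF L i p] Lp bd by auto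
    then show ?thesis using Ints_less_imp_add1_le[OF _ int, of 0] by simp
  next
    case False
    define m where "m = (if i = N then N else i + 1)"
    have m: "m \<in> {k..N}" "p + 1 \<in> {1..m}" "i < N \<or> p < N" using i p False by (auto simp: m_def)
    then show ?thesis
      using X_nonneg[OF L m(1,2)] right0 by (simp add: m_def algebra_simps)
  qed
  have "move_string L j i p (a - 1) \<in> X"
  proof (rule move_string_in_X[OF L])
    have "a - 1 + real p * \<theta> = (a + real p * \<theta>) - 1" by simp
    then show "a - 1 + real p * \<theta> \<in> \<int>" using int Ints_diff Ints_1 by metis
    show "a - 1 + real p * \<theta> \<le> real M" using X_le_M[OF L i p] Lp by simp
    show "a - 1 + \<theta> \<le> L m (p - 1)" if "1 < p" "k \<le> m" "j \<le> m + 1" "m \<le> i" for m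
    proof (cases "m + 1 = j")
      case True
      moreover have "p - 1 \<in> {1..<p}" using that by auto
      ultimately show ?thesis
        using X_down[OF L, of m "p - 1" p] str[of j] that p(1) i j(2,3) by simp
    next
      case False
      moreover have "p - 1 \<in> {1..<p}" using that by auto
      ultimately show ?thesis
        using X_row[OF L, of m "p - 1" p] str[of m] that p(1) i j(2,3) by simp
    qed
    show "a - 1 \<le> L (i + 1) p" if "i < N"
      using X_up[OF L, of i p p] that p i Lp by auto
  qed (use j i p right below a0 in auto)
  then show thesis using that j str by blast
qed

text \<open>
  The triples with nonzero contribution on either side correspond bijectively to the movable strings
  \<open>Q\<close>: a movable string is determined by its lower end before the move, and by its upper end after it.
\<close>

lemma cancellation:
  fixes a :: real
  shows "(\<Sum>(L, j, p)\<in>(SIGMA L:X. SIGMA j:{k..N}. {1..j}).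
      if L j p = a - 1 \<and> \<not> (p = 1 \<and> a = real M + 1 - \<theta>)
      then tw L * cpx (A L j p a) * \<phi> j (cpx a) else 0) =
    (\<Sum>(L, i, p)\<in>(SIGMA L:X. SIGMA i:{k..N}. {1..i}).
      if L i p = a \<and> \<not> (i = N \<and> p = N \<and> a = - real N * \<theta>)
      then tw L * cpx (B L i p a) * \<phi> (i + 1) (cpx a) else 0)"
    (is "sum ?f ?T = sum ?g ?T")
proof -
  define Q where "Q = {(L, j, i, p) | L j i p. L \<in> X \<and> k \<le> j \<and> j \<le> i \<and> i \<le> N \<and> p \<in> {1..j} \<and>
    (\<forall>m\<in>{j..i}. L m p = a - 1) \<and> move_string L j i p a \<in> X}"
  define F where "F = (\<lambda>(L :: nat \<Rightarrow> nat \<Rightarrow> real, j :: nat, i :: nat, p :: nat). (L, j, p))"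
  define G where "G = (\<lambda>(L :: nat \<Rightarrow> nat \<Rightarrow> real, j :: nat, i :: nat, p :: nat). (move_string L j i p a, i, p))"
  have finT: "finite ?T" using finite_X_space by auto
  \<comment> \<open>A movable string never touches the critical wall positions, so the guards in
    \<open>?f\<close> and \<open>?g\<close> are satisfied on all of \<open>Q\<close>.\<close>
  have aM: "a \<noteq> real M + 1 - \<theta>" if "(L, j, i, p) \<in> Q" for L j i p
    using that X_bounds(2)[of "move_string L j i p a" j p] by (auto simp: Q_def move_string_def)
  have aN: "a \<noteq> - real N * \<theta>" if "(L, j, i, p) \<in> Q" for L j i p
  proof -
    have "real i * \<theta> \<le> real N * \<theta>" using that \<theta>_pos by (auto simp: Q_def intro!: mult_right_mono)
    then show ?thesis
      using that X_bounds(1)[of L i p] by (auto simp: Q_def)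
  qed
  have F: "inj_on F Q"
  proof (rule inj_onI)
    fix x y assume xy: "x \<in> Q" "y \<in> Q" "F x = F y"
    then obtain L j p i1 i2 where eq: "x = (L, j, i1, p)" "y = (L, j, i2, p)"
      by (auto simp: F_def Q_def)
    \<comment> \<open>If the second string reached higher, raising only the first would put its top
      particle at \<open>a\<close> beneath one still at \<open>a - 1\<close>, against
      interlacing.\<close>
    have *: "i2 \<le> i1" if "(L, j, i1, p) \<in> Q" "(L, j, i2, p) \<in> Q" for i1 i2
    proof (rule ccontr)
      assume "\<not> i2 \<le> i1"
      then have "move_string L j i1 p a i1 p \<le> move_string L j i1 p a (i1 + 1) p"
        using that by (intro X_up) (auto simp: Q_def)
      moreover have "L (i1 + 1) p = a - 1"
        using that \<open>\<not> i2 \<le> i1\<close> by (auto simp: Q_def)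
      ultimately show False using that by (auto simp: move_string_def Q_def)
    qed
    show "x = y" using *[of i1 i2] *[of i2 i1] xy eq by auto
  qed
  have G: "inj_on G Q"
  proof (rule inj_onI)
    fix x y assume xy: "x \<in> Q" "y \<in> Q" "G x = G y"
    then obtain L1 L2 j1 j2 p i where eq: "x = (L1, j1, i, p)" "y = (L2, j2, i, p)"
      and U: "move_string L1 j1 i p a = move_string L2 j2 i p a"
      by (auto simp: G_def Q_def)
    \<comment> \<open>Otherwise the common image shows that the particle of \<open>L2\<close> on
      level \<open>j2 - 1\<close>, which its own move does not touch, is already at
      \<open>a\<close>, while the one above it is at \<open>a - 1\<close>.\<close>
    have *: "j2 \<le> j1" if "(L1, j1, i, p) \<in> Q" "(L2, j2, i, p) \<in> Q"
      "move_string L1 j1 i p a = move_string L2 j2 i p a" for L1 L2 j1 j2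
    proof (rule ccontr)
      assume "\<not> j2 \<le> j1"
      then have j: "j1 < j2" "j2 - 1 + 1 = j2" by auto
      have "L2 (j2 - 1) p \<le> L2 (j2 - 1 + 1) p"
        using that j by (intro X_up) (auto simp: Q_def)
      moreover have "L2 j2 p = a - 1" using that by (auto simp: Q_def)
      moreover have "move_string L1 j1 i p a (j2 - 1) p = L2 (j2 - 1) p"
        unfolding that(3) using j by (subst move_string_apply(2)) auto
      moreover have "move_string L1 j1 i p a (j2 - 1) p = a"
        using j that(2) by (intro move_string_apply) (auto simp: Q_def)
      ultimately show False using j by simp
    qed
    have j: "j1 = j2" using *[of L1 j1 L2 j2] *[of L2 j2 L1 j1] xy U eq by auto
    have "L1 m q = L2 m q" for m q
    proof (cases "m \<in> {j1..i} \<and> q = p")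
      case True
      then show ?thesis using xy(1,2) j unfolding eq by (auto simp: Q_def)
    next
      case False
      then show ?thesis using fun_cong[OF fun_cong[OF U], of m q] j
        unfolding move_string_def by (auto split: if_splits)
    qed
    then have "L1 = L2" by blast
    then show "x = y" using eq j by simp
  qed
  have "sum ?f ?T = sum ?f (F ` Q)"
  proof (rule sum.mono_neutral_right[OF finT])
    show "F ` Q \<subseteq> ?T" by (auto simp: F_def Q_def)
    show "\<forall>x\<in>?T - F ` Q. ?f x = 0"
    proof
      fix x assume x: "x \<in> ?T - F ` Q"
      obtain L j p where xe: "x = (L, j, p)" using prod_cases3 by blast
      show "?f x = 0"
      proof (rule ccontr)
        assume "?f x \<noteq> 0"
        then have c: "L j p = a - 1" "p = 1 \<Longrightarrow> a \<noteq> real M + 1 - \<theta>" "A L j p a \<noteq> 0"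
          by (auto simp: xe split: if_splits)
        have Lj: "L \<in> X" "j \<in> {k..N}" "p \<in> {1..j}" using x xe by auto
        obtain i where i: "j \<le> i" "i \<le> N" "\<And>m. m \<in> {j..i} \<Longrightarrow> L m p = a - 1"
            "move_string L j i p a \<in> X"
          using string_up_exists[OF Lj c(1,3,2)] by blast
        then have "(L, j, i, p) \<in> Q" using Lj by (auto simp: Q_def)
        then have "x \<in> F ` Q" by (force simp: F_def xe)
        with x show False by simp
      qed
    qed
  qed
  also have "\<dots> = (\<Sum>x\<in>Q. ?f (F x))" by (simp add: sum.reindex[OF F])
  also have "\<dots> = (\<Sum>x\<in>Q. ?g (G x))"
  proof (intro sum.cong refl)
    fix x assume x: "x \<in> Q"
    then obtain L j i p where xe: "x = (L, j, i, p)" by (auto simp: Q_def)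
    \<comment> \<open>\<open>coef_B\<close> omits the moved particle on level \<open>i\<close>, and
      level \<open>i + 1\<close> is not affected by the move.\<close>
    have B: "B (move_string L j i p a) i p a = B L i p a"
    proof -
      have *: "(\<Prod>q\<in>{1..i} - {p}. f (move_string L j i p a i q)) = (\<Prod>q\<in>{1..i} - {p}. f (L i q))"
        for f :: "real \<Rightarrow> real"
        by (intro prod.cong) (auto simp: move_string_def)
      note *[of "\<lambda>x. (a - x - \<theta>) / (a - x)"] *[of "\<lambda>x. (a - x + \<theta> - 1) / (a - x)"]
      moreover have "move_string L j i p a (i + 1) = L (i + 1)"
        by (intro move_string_apply) auto
      ultimately show ?thesis by (simp only: coef_B_def)
    qed
    have "tw L * cpx (A L j p a) * \<phi> j (cpx a) =
        tw (move_string L j i p a) * cpx (B L i p a) * \<phi> (i + 1) (cpx a)"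
      using x xe by (intro string_move) (auto simp: Q_def)
    moreover have "L j p = a - 1" "move_string L j i p a i p = a"
      using x xe by (auto simp: Q_def move_string_def)
    moreover have "a \<noteq> real M + 1 - \<theta>" "a \<noteq> - real N * \<theta>"
      using aM aN x unfolding xe by blast+
    ultimately show "?f (F x) = ?g (G x)"
      by (simp add: xe F_def G_def B)
  qed
  also have "\<dots> = sum ?g (G ` Q)" by (simp add: sum.reindex[OF G])
  also have "\<dots> = sum ?g ?T"
  proof (rule sum.mono_neutral_left[OF finT])
    show "G ` Q \<subseteq> ?T" by (auto simp: G_def Q_def)
    show "\<forall>x\<in>?T - G ` Q. ?g x = 0"
    proof
      fix x assume x: "x \<in> ?T - G ` Q"
      obtain L i p where xe: "x = (L, i, p)" using prod_cases3 by blast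
      show "?g x = 0"
      proof (rule ccontr)
        assume "?g x \<noteq> 0"
        then have c: "L i p = a" "i = N \<Longrightarrow> p = N \<Longrightarrow> a \<noteq> - real N * \<theta>" "B L i p a \<noteq> 0"
          by (auto simp: xe split: if_splits)
        have Li: "L \<in> X" "i \<in> {k..N}" "p \<in> {1..i}" using x xe by auto
        obtain j where j: "k \<le> j" "j \<le> i" "p \<le> j" "\<And>m. m \<in> {j..i} \<Longrightarrow> L m p = a"
            "move_string L j i p (a - 1) \<in> X"
          using string_down_exists[OF Li c(1,3,2)] by blast
        have LL: "move_string (move_string L j i p (a - 1)) j i p a = L"
          using j(4) by (auto simp: move_string_def fun_eq_iff)
        have "(move_string L j i p (a - 1), j, i, p) \<in> Q"
          using Li j LL by (auto simp: Q_def move_string_apply)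
        then have "G (move_string L j i p (a - 1), j, i, p) \<in> G ` Q" by (rule imageI)
        then have "x \<in> G ` Q" by (simp add: G_def LL xe)
        with x show False by simp
      qed
    qed
  qed
  finally show ?thesis .
qed


section \<open>Residues\<close>

abbreviation E where "E \<equiv> expect_E \<theta> M N k w"

lemma has_simple_part_expect:
  assumes "\<And>L. L \<in> X \<Longrightarrow> has_simple_part (\<lambda>z. F z L) a (r L)"
  shows "has_simple_part (\<lambda>z. E (F z)) a (E r)"
  unfolding expect_E_def
proof (rule has_simple_part_sum)
  fix L assume "L \<in> X"
  from has_simple_part_cmult[OF assms[OF this], of "prob_P \<theta> M N k w L"]
  show "has_simple_part (\<lambda>z. F z L * prob_P \<theta> M N k w L) a (r L * prob_P \<theta> M N k w L)"
    by (simp add: mult.commute)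
qed

lemma card_level_le_1:
  assumes "L \<in> X" "j \<in> {k..N}"
  shows "card {p \<in> {1..j}. L j p = x} \<le> 1"
proof -
  have "p = q" if "p \<in> {1..j}" "q \<in> {1..j}" "L j p = x" "L j q = x" for p q
    using X_row[OF assms, of p q] X_row[OF assms, of q p] that \<theta>_pos
    by (cases p q rule: linorder_cases) auto
  then have "\<forall>p\<in>{p \<in> {1..j}. L j p = x}. \<forall>q\<in>{p \<in> {1..j}. L j p = x}. p = q"
    by blast
  moreover have "finite {p \<in> {1..j}. L j p = x}" by simp
  ultimately show ?thesis by (simp only: card_le_Suc0_iff_eq One_nat_def)
qed

lemma X_row_gap:
  assumes L: "L \<in> X" "j \<in> {k..N}" and q: "1 \<le> q" "q \<le> p" "p \<le> j"
  shows "L j p + (real p - real q) * \<theta> \<le> L j q"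
  using q(2,3)
proof (induction p rule: dec_induct)
  case (step m)
  then show ?case using X_row[OF L, of m "Suc m"] q by (auto simp: algebra_simps)
qed simp

lemma cpx_add_1_eq_iff: "cpx x + 1 = cpx b \<longleftrightarrow> x = b - 1"
  using of_real_eq_iff[of "x + 1" b, where 'a = complex] by (simp add: eq_diff_eq)

section \<open>Residues of the individual summands for a fixed configuration\<close>

lemma simple_part_top:
  assumes "L \<in> X"
  shows "has_simple_part (\<lambda>z. \<Prod>p\<in>{1..N}. (z - cpx (L N p) - cpx \<theta>) / (z - cpx (L N p))) (cpx b)
    (cpx (- \<theta>) * (\<Sum>p\<in>{1..N}. if L N p = b then cpx (B L N p b) else 0))"
proof -
  have "has_simple_part (\<lambda>z. \<Prod>p\<in>{1..N}. (z - (cpx (L N p) + cpx \<theta>)) / (z - cpx (L N p))) (cpx b)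
    (\<Sum>p\<in>{p \<in> {1..N}. cpx (L N p) = cpx b}. (cpx b - (cpx (L N p) + cpx \<theta>)) *
      (\<Prod>q\<in>{1..N} - {p}. (cpx b - (cpx (L N q) + cpx \<theta>)) / (cpx b - cpx (L N q))))"
    using card_level_le_1[OF assms, of N b] k_le_N by (intro has_simple_part_prod_ratio) auto
  also have "(\<Sum>p\<in>{p \<in> {1..N}. cpx (L N p) = cpx b}. (cpx b - (cpx (L N p) + cpx \<theta>)) *
      (\<Prod>q\<in>{1..N} - {p}. (cpx b - (cpx (L N q) + cpx \<theta>)) / (cpx b - cpx (L N q)))) =
    cpx (- \<theta>) * (\<Sum>p\<in>{1..N}. if L N p = b then cpx (B L N p b) else 0)"
    unfolding of_real_eq_iff sum.inter_filter[OF finite_atLeastAtMost] sum_distrib_left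
    by (intro sum.cong refl) (simp add: coef_B_def diff_diff_eq)
  finally show ?thesis by (simp only: diff_diff_eq)
qed

lemma simple_part_bottom:
  assumes "L \<in> X"
  shows "has_simple_part (\<lambda>z. \<Prod>p\<in>{1..k}. (z - cpx (L k p) + cpx \<theta> - 1) / (z - cpx (L k p) - 1)) (cpx b)
    (cpx \<theta> * (\<Sum>p\<in>{1..k}. if L k p = b - 1 then cpx (A L k p b) else 0))"
proof -
  have eq: "cpx (L k p) + 1 = cpx b \<longleftrightarrow> L k p = b - 1" for p
    by (rule cpx_add_1_eq_iff)
  have num: "z - (cpx (L k p) + 1 - cpx \<theta>) = z - cpx (L k p) + cpx \<theta> - 1" for z p
    by simp
  have den: "z - (cpx (L k p) + 1) = z - cpx (L k p) - 1" for z p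
    by simp
  have "has_simple_part (\<lambda>z. \<Prod>p\<in>{1..k}. (z - (cpx (L k p) + 1 - cpx \<theta>)) / (z - (cpx (L k p) + 1))) (cpx b)
    (\<Sum>p\<in>{p \<in> {1..k}. cpx (L k p) + 1 = cpx b}. (cpx b - (cpx (L k p) + 1 - cpx \<theta>)) *
      (\<Prod>q\<in>{1..k} - {p}. (cpx b - (cpx (L k q) + 1 - cpx \<theta>)) / (cpx b - (cpx (L k q) + 1))))"
    using card_level_le_1[OF assms, of k "b - 1"] k_le_N
    by (intro has_simple_part_prod_ratio disjI1) (simp_all only: eq finite_atLeastAtMost atLeastAtMost_iff order_refl simp_thms)
  also have "(\<Sum>p\<in>{p \<in> {1..k}. cpx (L k p) + 1 = cpx b}. (cpx b - (cpx (L k p) + 1 - cpx \<theta>)) *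
      (\<Prod>q\<in>{1..k} - {p}. (cpx b - (cpx (L k q) + 1 - cpx \<theta>)) / (cpx b - (cpx (L k q) + 1)))) =
    cpx \<theta> * (\<Sum>p\<in>{1..k}. if L k p = b - 1 then cpx (A L k p b) else 0)"
    unfolding eq sum.inter_filter[OF finite_atLeastAtMost] sum_distrib_left num den
    by (intro sum.cong refl) (simp add: coef_A_def)
  finally show ?thesis by (simp only: num den)
qed

text \<open>Such double poles occur only if \<open>\<theta> = 1 / (p - q)\<close>.\<close>

lemma double_pole_cancels:
  assumes L: "L \<in> X" and j: "j \<in> {k<..N}" and p: "p \<in> {1..j}" and q: "q \<in> {1..j-1}"
    and Lp: "L j p = b - 1" and Lq: "L (j - 1) q = b"
  shows "q + 1 \<in> {1..j}" "L j (q + 1) = b - \<theta>" "p - 1 \<in> {1..j-1}" "L (j - 1) (p - 1) = b + \<theta> - 1"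
proof -
  obtain n where n: "j = n + 1" "n \<in> {k..<N}" "j - 1 = n" using j by (cases j) auto
  have jj: "j \<in> {k..N}" "n \<in> {k..N}" using j n by auto
  have qp: "q < p"
  proof (rule ccontr)
    assume "\<not> q < p"
    then have "L n q \<le> L (n + 1) p" using q p n by (intro X_up[OF L n(2)]) auto
    then show False using Lp Lq n by simp
  qed
  have qp1: "L j p + (real p - real (q + 1)) * \<theta> \<le> L j (q + 1)"
    using qp p by (intro X_row_gap[OF L jj(1)]) auto
  have "L j (q + 1) + \<theta> \<le> b"
    using X_down[OF L n(2), of q "q + 1"] q Lq n by auto
  then have le: "b - 1 + real p * \<theta> \<le> b + real q * \<theta>"
    using qp1 Lp qp by (simp add: of_nat_diff algebra_simps)
  have qn: "q \<in> {1..n}" using q n by auto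
  have int: "b - 1 + real p * \<theta> \<in> \<int>" "b + real q * \<theta> \<in> \<int>"
    using X_int[OF L jj(1) p] X_int[OF L jj(2) qn] Lp Lq n(3) by auto
  \<comment> \<open>Both sides are integers. A strict inequality would leave a gap of at least one,
    hence \<open>p * \<theta> \<le> q * \<theta>\<close>, contradicting \<open>q < p\<close>.
    Equality makes all row inequalities between the two indices tight.\<close>
  have "b - 1 + real p * \<theta> = b + real q * \<theta>"
  proof (rule ccontr)
    assume "b - 1 + real p * \<theta> \<noteq> b + real q * \<theta>"
    then have "b - 1 + real p * \<theta> + 1 \<le> b + real q * \<theta>"
      using le by (intro Ints_less_imp_add1_le[OF int]) simp
    moreover have "real q * \<theta> < real p * \<theta>" using qp \<theta>_pos by simp
    ultimately show False by simp
  qed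
  then have one: "(real p - real q) * \<theta> = 1" by (simp add: algebra_simps)
  show "q + 1 \<in> {1..j}" using q by auto
  show "L j (q + 1) = b - \<theta>"
    using \<open>L j (q + 1) + \<theta> \<le> b\<close> qp1 Lp one qp by (simp add: of_nat_diff algebra_simps)
  have "1 < p" using q qp by auto
  then show pn: "p - 1 \<in> {1..j-1}" using p by auto
  have "L j p + \<theta> \<le> L n (p - 1)"
    using X_down[OF L n(2), of "p - 1" p] \<open>1 < p\<close> p n by auto
  moreover have "L n (p - 1) + (real (p - 1) - real q) * \<theta> \<le> L n q"
    using qp q pn n by (intro X_row_gap[OF L jj(2)]) auto
  ultimately show "L (j - 1) (p - 1) = b + \<theta> - 1"
    using Lp Lq one qp n by (simp add: of_nat_diff algebra_simps)
qed

text \<open>Both rows are merged into one index set by a disjoint sum, so that their poles are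
  counted jointly. Each row contributes at most one; if both do, \<open>double_pole_cancels\<close>
  supplies two numerator zeros, \<open>Inl (q + 1)\<close> and \<open>Inr (p - 1)\<close>.\<close>

lemma simple_part_middle:
  assumes L: "L \<in> X" and j: "j \<in> {k<..N}"
  shows "has_simple_part
    (\<lambda>z. (\<Prod>p\<in>{1..j}. (z - cpx (L j p) - cpx \<theta>) / (z - cpx (L j p) - 1)) *
         (\<Prod>p\<in>{1..j-1}. (z - cpx (L (j-1) p) + cpx \<theta> - 1) / (z - cpx (L (j-1) p)))) (cpx b)
    (cpx (1 - \<theta>) * (\<Sum>p\<in>{1..j}. if L j p = b - 1 then cpx (A L j p b) else 0) -
     cpx (1 - \<theta>) * (\<Sum>p\<in>{1..j-1}. if L (j-1) p = b then cpx (B L (j-1) p b) else 0))"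
proof -
  obtain n where n: "j = n + 1" "n \<in> {k..<N}" "j - 1 = n" using j by (cases j) auto
  have jj: "j \<in> {k..N}" "n \<in> {k..N}" using j n by auto
  define I where "I = {1..j} <+> {1..n}"
  define x where "x = case_sum (\<lambda>p. cpx (L j p) + cpx \<theta>) (\<lambda>p. cpx (L n p) + 1 - cpx \<theta>)"
  define y where "y = case_sum (\<lambda>p. cpx (L j p) + 1) (\<lambda>p. cpx (L n p))"
  define D1 where "D1 = {p \<in> {1..j}. L j p = b - 1}"
  define D2 where "D2 = {p \<in> {1..n}. L n p = b}"
  have fin: "finite I" by (simp add: I_def)
  have eq: "cpx (L j p) + 1 = cpx b \<longleftrightarrow> L j p = b - 1" for p
    by (rule cpx_add_1_eq_iff)
  have D: "{i \<in> I. y i = cpx b} = D1 <+> D2"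
    by (auto simp: I_def y_def D1_def D2_def eq)
  have c1: "card D1 \<le> 1" "card D2 \<le> 1"
    using card_level_le_1[OF L] jj by (auto simp: D1_def D2_def)
  have cD: "card (D1 <+> D2) = card D1 + card D2"
    by (intro card_Plus) (auto simp: D1_def D2_def)
  have "card (D1 <+> D2) \<le> 1 \<or> card (D1 <+> D2) \<le> card {i \<in> I. x i = cpx b}"
  proof (cases "D1 = {} \<or> D2 = {}")
    case True
    then show ?thesis using c1 cD by auto
  next
    case False
    then obtain p q where pq: "p \<in> {1..j}" "q \<in> {1..j-1}" "L j p = b - 1" "L (j - 1) q = b"
      by (auto simp: D1_def D2_def n)
    note * = double_pole_cancels[OF L j pq]
    have "{Inl (q + 1), Inr (p - 1)} \<subseteq> {i \<in> I. x i = cpx b}"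
      using * by (auto simp: I_def x_def n)
    then have "card {Inl (q + 1), Inr (p - 1)} \<le> card {i \<in> I. x i = cpx b}"
      using fin by (intro card_mono) auto
    then show ?thesis using c1 cD by auto
  qed
  then have "has_simple_part (\<lambda>z. \<Prod>i\<in>I. (z - x i) / (z - y i)) (cpx b)
      (\<Sum>i\<in>D1 <+> D2. (cpx b - x i) * (\<Prod>i'\<in>I - {i}. (cpx b - x i') / (cpx b - y i')))"
    using has_simple_part_prod_ratio[OF fin, of y "cpx b" x] by (simp only: D)
  moreover have "(\<Prod>i\<in>I. (z - x i) / (z - y i)) =
      (\<Prod>p\<in>{1..j}. (z - cpx (L j p) - cpx \<theta>) / (z - cpx (L j p) - 1)) *
      (\<Prod>p\<in>{1..n}. (z - cpx (L n p) + cpx \<theta> - 1) / (z - cpx (L n p)))" for z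
    unfolding I_def by (simp add: prod.Plus x_def y_def diff_diff_eq diff_diff_eq2 add_diff_eq diff_add_eq)
  moreover have "(\<Sum>i\<in>D1 <+> D2. (cpx b - x i) * (\<Prod>i'\<in>I - {i}. (cpx b - x i') / (cpx b - y i'))) =
    cpx (1 - \<theta>) * (\<Sum>p\<in>{1..j}. if L j p = b - 1 then cpx (A L j p b) else 0) -
    cpx (1 - \<theta>) * (\<Sum>p\<in>{1..n}. if L n p = b then cpx (B L n p b) else 0)"
  proof -
    have xy: "cpx b - x (Inl p) = cpx (b - L j p - \<theta>)" "cpx b - y (Inl p) = cpx (b - L j p - 1)"
        "cpx b - x (Inr p) = cpx (b - L n p + \<theta> - 1)" "cpx b - y (Inr p) = cpx (b - L n p)" for p
      by (simp_all add: x_def y_def)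
    have "j \<noteq> k" "n \<noteq> N" using j n by auto
    then have coefs: "A L j p b = (\<Prod>q\<in>{1..j} - {p}. (b - L j q - \<theta>) / (b - L j q - 1)) *
        (\<Prod>q\<in>{1..n}. (b - L n q + \<theta> - 1) / (b - L n q))"
      "B L n p b = (\<Prod>q\<in>{1..j}. (b - L j q - \<theta>) / (b - L j q - 1)) *
        (\<Prod>q\<in>{1..n} - {p}. (b - L n q + \<theta> - 1) / (b - L n q))" for p
      by (simp_all only: coef_A_def coef_B_def if_False n(1)[symmetric] n(3))
    have "(cpx b - x (Inl p)) * (\<Prod>i\<in>I - {Inl p}. (cpx b - x i) / (cpx b - y i)) =
        cpx (1 - \<theta>) * cpx (A L j p b)" if "p \<in> D1" for p
    proof -
      have "I - {Inl p} = ({1..j} - {p}) <+> {1..n}" by (auto simp: I_def)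
      moreover have "b - L j p - \<theta> = 1 - \<theta>" using that by (simp add: D1_def)
      ultimately show ?thesis
        by (simp only: coefs prod.Plus finite_Diff finite_atLeastAtMost o_def xy of_real_mult of_real_prod of_real_divide)
    qed
    moreover have "(cpx b - x (Inr p)) * (\<Prod>i\<in>I - {Inr p}. (cpx b - x i) / (cpx b - y i)) =
        - (cpx (1 - \<theta>) * cpx (B L n p b))" if "p \<in> D2" for p
    proof -
      have "I - {Inr p} = {1..j} <+> ({1..n} - {p})" by (auto simp: I_def)
      moreover have "b - L n p + \<theta> - 1 = - (1 - \<theta>)" using that by (simp add: D2_def)
      ultimately show ?thesis
        by (simp only: coefs prod.Plus finite_Diff finite_atLeastAtMost o_def xy of_real_mult of_real_prod
            of_real_divide of_real_minus mult_minus_left)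
    qed
    moreover have "finite D1" "finite D2" by (auto simp: D1_def D2_def)
    ultimately have "(\<Sum>i\<in>D1 <+> D2. (cpx b - x i) * (\<Prod>i'\<in>I - {i}. (cpx b - x i') / (cpx b - y i'))) =
      (\<Sum>p\<in>D1. cpx (1 - \<theta>) * cpx (A L j p b)) - (\<Sum>p\<in>D2. cpx (1 - \<theta>) * cpx (B L n p b))"
      by (simp add: sum.Plus sum_negf)
    then show ?thesis
      unfolding D1_def D2_def sum.inter_filter[OF finite_atLeastAtMost] sum_distrib_left mult_delta_right .
  qed
  ultimately show ?thesis by (simp only: n(3))
qed

section \<open>Averaging and summing the residues\<close>

lemma expect_cmult: "E (\<lambda>L. c * F L) = c * E F"
  by (simp add: expect_E_def sum_distrib_left mult_ac)

lemma expect_diff: "E (\<lambda>L. F L - G L) = E F - E G"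
  by (simp add: expect_E_def sum_subtractf left_diff_distrib)

text \<open>Puts the averages into the triple-sum shape of \<open>cancellation\<close>, with the
  normalisation as a common factor.\<close>

lemma sum_expect_levels:
  "(\<Sum>j\<in>{k..N}. c j * E (\<lambda>L. \<Sum>p\<in>{1..j}. if P L j p then f L j p else 0)) =
    inverse (partition_Z \<theta> M N k w) *
    (\<Sum>(L, j, p)\<in>(SIGMA L:X. SIGMA j:{k..N}. {1..j}). if P L j p then tw L * f L j p * c j else 0)"
proof -
  have "c j * E (\<lambda>L. \<Sum>p\<in>{1..j}. if P L j p then f L j p else 0) =
     (\<Sum>L\<in>X. \<Sum>p\<in>{1..j}. inverse (partition_Z \<theta> M N k w) *
        (if P L j p then tw L * f L j p * c j else 0))" for j
    unfolding expect_E_def prob_P_def sum_distrib_left sum_distrib_right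
    by (intro sum.cong refl) simp
  then have "(\<Sum>j\<in>{k..N}. c j * E (\<lambda>L. \<Sum>p\<in>{1..j}. if P L j p then f L j p else 0)) =
     (\<Sum>L\<in>X. \<Sum>j\<in>{k..N}. \<Sum>p\<in>{1..j}. inverse (partition_Z \<theta> M N k w) *
        (if P L j p then tw L * f L j p * c j else 0))"
    by (simp only: sum.swap[of _ X])
  then show ?thesis
    by (simp add: sum.Sigma finite_X_space sum_distrib_left case_prod_unfold)
qed

lemma sum_expect_cancellation:
  "(\<Sum>j\<in>{k..N}. \<phi> j (cpx b) * E (\<lambda>L. \<Sum>p\<in>{1..j}.
      if L j p = b - 1 \<and> \<not> (p = 1 \<and> b = real M + 1 - \<theta>) then cpx (A L j p b) else 0)) =
   (\<Sum>i\<in>{k..N}. \<phi> (i + 1) (cpx b) * E (\<lambda>L. \<Sum>p\<in>{1..i}.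
      if L i p = b \<and> \<not> (i = N \<and> p = N \<and> b = - real N * \<theta>) then cpx (B L i p b) else 0))"
  unfolding sum_expect_levels using cancellation[of b] by simp

definition SA :: "real \<Rightarrow> nat \<Rightarrow> (nat \<Rightarrow> nat \<Rightarrow> real) \<Rightarrow> complex" where
  "SA b j = (\<lambda>L. \<Sum>p\<in>{1..j}. if L j p = b - 1 then cpx (A L j p b) else 0)"

definition SB :: "real \<Rightarrow> nat \<Rightarrow> (nat \<Rightarrow> nat \<Rightarrow> real) \<Rightarrow> complex" where
  "SB b i = (\<lambda>L. \<Sum>p\<in>{1..i}. if L i p = b then cpx (B L i p b) else 0)"

text \<open>The term of \<open>SA\<close> blocked by the wall at \<open>M\<close>, which the guard
  in \<open>cancellation\<close> excludes. Only the first particle of a level can reach that wall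
  position.\<close>

definition boundary_A :: "real \<Rightarrow> nat \<Rightarrow> (nat \<Rightarrow> nat \<Rightarrow> real) \<Rightarrow> complex" where
  "boundary_A b j = (\<lambda>L. if b = real M + 1 - \<theta> \<and> L j 1 = b - 1 then cpx (A L j 1 b) else 0)"

definition boundary_B :: "real \<Rightarrow> (nat \<Rightarrow> nat \<Rightarrow> real) \<Rightarrow> complex" where
  "boundary_B b = (\<lambda>L. if b = - real N * \<theta> \<and> L N N = b then cpx (B L N N b) else 0)"

lemma sum_remove_term:
  assumes "finite S" "x \<in> S"
  shows "(\<Sum>p\<in>S. if P p \<and> \<not> (p = x \<and> c) then f p else (0::complex)) =
    (\<Sum>p\<in>S. if P p then f p else 0) - (if c \<and> P x then f x else 0)"
proof -
  have "(\<Sum>p\<in>S - {x}. if P p \<and> \<not> (p = x \<and> c) then f p else 0) = (\<Sum>p\<in>S - {x}. if P p then f p else 0)"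
    by (intro sum.cong) auto
  then show ?thesis unfolding sum.remove[OF assms] by auto
qed

text \<open>This is the averaged cancellation, regrouped by the function \<open>\<phi>\<close> in
  front: \<open>SB\<close> on level \<open>j - 1\<close> belongs to summand \<open>j\<close>, and
  \<open>SB\<close> on level \<open>N\<close> to the summand with
  \<open>\<phi> (N + 1)\<close>.\<close>

lemma residue_identity:
  "\<phi> k (cpx b) * (E (SA b k) - E (boundary_A b k)) +
     (\<Sum>j\<in>{k+1..N}. \<phi> j (cpx b) * (E (SA b j) - E (boundary_A b j))) =
   (\<Sum>j\<in>{k+1..N}. \<phi> j (cpx b) * E (SB b (j - 1))) +
     \<phi> (N + 1) (cpx b) * (E (SB b N) - E (boundary_B b))"
proof -
  have "(\<Sum>j\<in>{k..N}. \<phi> j (cpx b) * (E (SA b j) - E (boundary_A b j))) =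
     (\<Sum>j\<in>{k..N}. \<phi> j (cpx b) * E (\<lambda>L. \<Sum>p\<in>{1..j}.
      if L j p = b - 1 \<and> \<not> (p = 1 \<and> b = real M + 1 - \<theta>) then cpx (A L j p b) else 0))"
    using k_pos unfolding expect_diff[symmetric] SA_def boundary_A_def
    by (intro sum.cong refl) (subst sum_remove_term, auto)
  also have "\<dots> = (\<Sum>i\<in>{k..N}. \<phi> (i + 1) (cpx b) * E (\<lambda>L. \<Sum>p\<in>{1..i}.
      if L i p = b \<and> \<not> (i = N \<and> p = N \<and> b = - real N * \<theta>) then cpx (B L i p b) else 0))"
    by (rule sum_expect_cancellation)
  also have "\<dots> = (\<Sum>i\<in>{k..<N}. \<phi> (i + 1) (cpx b) * E (SB b i)) +
      \<phi> (N + 1) (cpx b) * (E (SB b N) - E (boundary_B b))"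
  proof -
    have "{k..N} = insert N {k..<N}" using k_le_N by auto
    moreover have "E (\<lambda>L. \<Sum>p\<in>{1..N}. if L N p = b \<and> \<not> (p = N \<and> b = - real N * \<theta>)
       then cpx (B L N p b) else 0) = E (SB b N) - E (boundary_B b)"
      using k_pos k_le_N unfolding expect_diff[symmetric] SB_def boundary_B_def
      by (subst sum_remove_term) auto
    moreover have "(\<Sum>i\<in>{k..<N}. \<phi> (i + 1) (cpx b) * E (\<lambda>L. \<Sum>p\<in>{1..i}.
      if L i p = b \<and> \<not> (i = N \<and> p = N \<and> b = - real N * \<theta>) then cpx (B L i p b) else 0)) =
      (\<Sum>i\<in>{k..<N}. \<phi> (i + 1) (cpx b) * E (SB b i))"
      unfolding SB_def by (intro sum.cong refl) simp
    ultimately show ?thesis by simp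
  qed
  also have "(\<Sum>i\<in>{k..<N}. \<phi> (i + 1) (cpx b) * E (SB b i)) =
      (\<Sum>j\<in>{k+1..N}. \<phi> j (cpx b) * E (SB b (j - 1)))"
    by (rule sum.reindex_bij_witness[of _ "\<lambda>j. j - 1" "\<lambda>i. i + 1"]) auto
  finally show ?thesis
    using sum.atLeast_Suc_atMost[OF k_le_N, of "\<lambda>j. \<phi> j (cpx b) * (E (SA b j) - E (boundary_A b j))"]
    by simp
qed

text \<open>\<open>Res1\<close> consists of pure poles at the two wall positions, and its
  expectations are the boundary terms evaluated there.\<close>

lemma Res1_simple_part:
  "has_simple_part (Res1 \<theta> M N k w \<phi>) (cpx b)
    (cpx (- \<theta>) * \<phi> (N + 1) (cpx b) * E (boundary_B b) + cpx \<theta> * \<phi> k (cpx b) * E (boundary_A b k) +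
     (\<Sum>j\<in>{k+1..N}. cpx \<theta> * \<phi> j (cpx b) * E (boundary_A b j)))"
proof -
  define s where "s = real M + 1 - \<theta>"
  have E0: "E (\<lambda>_. 0) = 0" by (simp add: expect_E_def)
  \<comment> \<open>For \<open>b \<noteq> x\<close> both the residue and \<open>E G\<close> vanish;
    for \<open>b = x\<close> the values of \<open>\<phi>\<close> coincide. So the residue can be
    written with \<open>\<phi>\<close> at \<open>b\<close> throughout.\<close>
  have part: "has_simple_part (\<lambda>z. c * \<phi> i (cpx x) / (z - cpx x) * E F) (cpx b) (c * \<phi> i (cpx b) * E G)"
    if "b = x \<Longrightarrow> F = G" "b \<noteq> x \<Longrightarrow> G = (\<lambda>_. 0)" for c i x F G
    using has_simple_part_cmult[OF has_simple_part_inverse, of "E F" "c * \<phi> i (cpx x)" "cpx x" "cpx b"] that E0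
    by (cases "b = x") (auto simp: mult_ac)
  have set: "{1..j} - {1} = {2..j::nat}" "{1..j} - {j} = {1..j-1}" for j :: nat
    by auto
  have "has_simple_part (\<lambda>z. cpx (- \<theta>) * \<phi> (N + 1) (cpx (- real N * \<theta>)) / (z - cpx (- real N * \<theta>)) *
     E (\<lambda>L. cpx ((\<Prod>p\<in>{1..N-1}. (L N p + (real N + 1) * \<theta>) / (L N p + real N * \<theta>)) *
                of_bool (L N N = - real N * \<theta>)))) (cpx b)
     (cpx (- \<theta>) * \<phi> (N + 1) (cpx b) * E (boundary_B b))"
  proof (rule part)
    assume b: "b = - real N * \<theta>"
    have "(x + (real N + 1) * \<theta>) / (x + real N * \<theta>) = (b - x - \<theta>) / (b - x)" for x
      unfolding b by (subst minus_divide_divide[symmetric]) (simp add: algebra_simps)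
    then show "(\<lambda>L. cpx ((\<Prod>p\<in>{1..N-1}. (L N p + (real N + 1) * \<theta>) / (L N p + real N * \<theta>)) *
                of_bool (L N N = - real N * \<theta>))) = boundary_B b"
      by (auto simp: fun_eq_iff boundary_B_def coef_B_def b set[simplified])
  qed (auto simp: boundary_B_def)
  then have 1: "has_simple_part (\<lambda>z. cpx (- \<theta>) * \<phi> (N + 1) (cpx (- real N * \<theta>)) / (z + cpx (real N * \<theta>)) *
     E (\<lambda>L. cpx ((\<Prod>p\<in>{1..N-1}. (L N p + (real N + 1) * \<theta>) / (L N p + real N * \<theta>)) *
                of_bool (L N N = - real N * \<theta>)))) (cpx b)
     (cpx (- \<theta>) * \<phi> (N + 1) (cpx b) * E (boundary_B b))"
    by simp
  have 2: "has_simple_part (\<lambda>z. cpx \<theta> * \<phi> k (cpx s) / (z - cpx s) *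
           E (\<lambda>L. cpx ((\<Prod>p\<in>{2..k}. (s - L k p + \<theta> - 1) / (s - L k p - 1)) *
                of_bool (L k 1 = s - 1)))) (cpx b) (cpx \<theta> * \<phi> k (cpx b) * E (boundary_A b k))"
    by (rule part) (auto simp: fun_eq_iff boundary_A_def coef_A_def s_def set[simplified])
  have 3: "has_simple_part (\<lambda>z. cpx \<theta> * \<phi> j (cpx s) / (z - cpx s) *
           E (\<lambda>L. cpx ((\<Prod>p\<in>{2..j}. (s - L j p - \<theta>) / (s - L j p - 1)) *
                (\<Prod>p\<in>{1..j-1}. (s - L (j-1) p + \<theta> - 1) / (s - L (j-1) p)) *
                of_bool (L j 1 = s - 1)))) (cpx b) (cpx \<theta> * \<phi> j (cpx b) * E (boundary_A b j))"
    if "j \<in> {k+1..N}" for j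
    using that by (intro part) (auto simp: fun_eq_iff boundary_A_def coef_A_def s_def set[simplified])
  show ?thesis
    unfolding Res1_def Let_def s_def[symmetric]
    by (intro has_simple_part_add has_simple_part_sum 1 2 3)
qed

lemma R1_simple_part_real:
  assumes "\<theta> \<noteq> 1" and an: "\<And>j. j \<in> {k..N+1} \<Longrightarrow> \<phi> j analytic_on {cpx b}"
  shows "has_simple_part (R1 \<theta> M N k w \<phi>) (cpx b) 0"
proof -
  have 1: "has_simple_part (R1 \<theta> M N k w \<phi>) (cpx b)
    (\<phi> (N + 1) (cpx b) * E (\<lambda>L. cpx (- \<theta>) * SB b N L) + \<phi> k (cpx b) * E (\<lambda>L. cpx \<theta> * SA b k L) +
     cpx (\<theta> / (1 - \<theta>)) * (\<Sum>j\<in>{k+1..N}. \<phi> j (cpx b) *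
        E (\<lambda>L. cpx (1 - \<theta>) * SA b j L - cpx (1 - \<theta>) * SB b (j - 1) L)) -
     (cpx (- \<theta>) * \<phi> (N + 1) (cpx b) * E (boundary_B b) + cpx \<theta> * \<phi> k (cpx b) * E (boundary_A b k) +
     (\<Sum>j\<in>{k+1..N}. cpx \<theta> * \<phi> j (cpx b) * E (boundary_A b j))))"
    unfolding R1_def Let_def SA_def SB_def
    using k_pos k_le_N an
    by (intro has_simple_part_diff has_simple_part_add has_simple_part_mult has_simple_part_cmult
        has_simple_part_sum has_simple_part_expect Res1_simple_part
        simple_part_top simple_part_bottom simple_part_middle) auto
  have 2: "cpx (\<theta> / (1 - \<theta>)) * (\<Sum>j\<in>{k+1..N}. \<phi> j (cpx b) *
        E (\<lambda>L. cpx (1 - \<theta>) * SA b j L - cpx (1 - \<theta>) * SB b (j - 1) L)) =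
     cpx \<theta> * ((\<Sum>j\<in>{k+1..N}. \<phi> j (cpx b) * E (SA b j)) - (\<Sum>j\<in>{k+1..N}. \<phi> j (cpx b) * E (SB b (j - 1))))"
  proof -
    have "cpx (\<theta> / (1 - \<theta>)) * (\<phi> j (cpx b) * (cpx (1 - \<theta>) * x - cpx (1 - \<theta>) * y)) =
        cpx \<theta> * (\<phi> j (cpx b) * x - \<phi> j (cpx b) * y)" for j x y
    proof -
      have "cpx (\<theta> / (1 - \<theta>)) * cpx (1 - \<theta>) = cpx \<theta>"
        using \<open>\<theta> \<noteq> 1\<close> by (simp flip: of_real_mult)
      moreover have "cpx (\<theta> / (1 - \<theta>)) * (\<phi> j (cpx b) * (cpx (1 - \<theta>) * x - cpx (1 - \<theta>) * y)) =
          cpx (\<theta> / (1 - \<theta>)) * cpx (1 - \<theta>) * (\<phi> j (cpx b) * x - \<phi> j (cpx b) * y)"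
        by (simp only: right_diff_distrib mult_ac)
      ultimately show ?thesis by simp
    qed
    then show ?thesis
      unfolding expect_diff expect_cmult sum_distrib_left sum_subtractf[symmetric] by simp
  qed
  have 3: "(\<Sum>j\<in>{k+1..N}. cpx \<theta> * \<phi> j (cpx b) * E (boundary_A b j)) =
      cpx \<theta> * (\<Sum>j\<in>{k+1..N}. \<phi> j (cpx b) * E (boundary_A b j))"
    by (simp add: sum_distrib_left mult_ac)
  have 4: "(\<Sum>j\<in>{k+1..N}. \<phi> j (cpx b) * (E (SA b j) - E (boundary_A b j))) =
     (\<Sum>j\<in>{k+1..N}. \<phi> j (cpx b) * E (SA b j)) - (\<Sum>j\<in>{k+1..N}. \<phi> j (cpx b) * E (boundary_A b j))"
    by (simp add: right_diff_distrib sum_subtractf)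
  \<comment> \<open>After the scaling, the total residue is a multiple of the difference of the two
    sides of \<open>residue_identity\<close>.\<close>
  have "fN * (- t * x) + fk * (t * y) + t * (s1 - s2) - (- t * fN * x' + t * fk * y' + t * s3) = 0"
    if "fk * (y - y') + (s1 - s3) = s2 + fN * (x - x')" for fN fk t x y x' y' s1 s2 s3 :: complex
    using that by algebra
  from 1[unfolded 2 3 expect_cmult of_real_minus this[OF residue_identity[of b, unfolded 4]]]
  show ?thesis .
qed

lemma R1_simple_part_nonreal:
  assumes a: "a \<notin> \<real>" and an: "\<And>j. j \<in> {k..N+1} \<Longrightarrow> \<phi> j analytic_on {a}"
  shows "has_simple_part (R1 \<theta> M N k w \<phi>) a 0"
proof (rule has_simple_part_analytic)
  have nz: "a - cpx x \<noteq> 0" "a - cpx x - 1 \<noteq> 0" "a + cpx x \<noteq> 0" for x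
  proof -
    have "a \<noteq> cpx x" "a \<noteq> cpx (x + 1)" "a \<noteq> cpx (- x)" using a by auto
    then show "a - cpx x \<noteq> 0" "a - cpx x - 1 \<noteq> 0" "a + cpx x \<noteq> 0"
      by (auto simp: algebra_simps add_eq_0_iff)
  qed
  have nz': "a \<noteq> of_nat M + 1 - cpx \<theta>" "a + of_nat N * cpx \<theta> \<noteq> 0"
    using nz(1)[of "real M + 1 - \<theta>"] nz(3)[of "real N * \<theta>"] by auto
  show "R1 \<theta> M N k w \<phi> analytic_on {a}"
    unfolding R1_def Res1_def Let_def expect_E_def
    using k_pos k_le_N by (intro analytic_intros an) (auto simp: nz[simplified] nz')
qed

lemma R1_analytic:
  assumes "\<theta> \<noteq> 1" and an: "\<And>j. j \<in> {k..N+1} \<Longrightarrow> \<phi> j analytic_on S"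
  shows "analytic_removable_on (R1 \<theta> M N k w \<phi>) S"
proof (rule analytic_removable_onI)
  fix a assume a: "a \<in> S"
  then have an': "\<phi> j analytic_on {a}" if "j \<in> {k..N+1}" for j
    using an[OF that] analytic_on_analytic_at by blast
  show "has_simple_part (R1 \<theta> M N k w \<phi>) a 0"
  proof (cases "a \<in> \<real>")
    case True
    then obtain b where "a = cpx b" by (auto elim: Reals_cases)
    then show ?thesis using R1_simple_part_real assms(1) an' by simp
  next
    case False
    then show ?thesis using R1_simple_part_nonreal an' by blast
  qed
qed

end


section \<open>Reflection\<close>

text \<open>In terms of the integers, index \<open>p\<close> on level \<open>j\<close> receives
  \<open>M\<close> minus the entry with index \<open>j + 1 - p\<close>. The shifts by
  \<open>p * \<theta>\<close> and \<open>(j + 1 - p) * \<theta>\<close> add up to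
  \<open>(j + 1) * \<theta>\<close>, so the constant depends on the level but not on
  \<open>p\<close>.\<close>

definition reflect :: "real \<Rightarrow> nat \<Rightarrow> nat \<Rightarrow> nat \<Rightarrow> (nat \<Rightarrow> nat \<Rightarrow> real) \<Rightarrow> nat \<Rightarrow> nat \<Rightarrow> real" where
  "reflect \<theta> M N k L = (\<lambda>j\<in>{k..N}. \<lambda>p\<in>{1..j}. real M - (real j + 1) * \<theta> - L j (j + 1 - p))"

lemma reflect_apply:
  "j \<in> {k..N} \<Longrightarrow> p \<in> {1..j} \<Longrightarrow>
    reflect \<theta> M N k L j p = real M - (real j + 1) * \<theta> - L j (j + 1 - p)"
  by (simp add: reflect_def)

lemma reflect_in_X:
  assumes "L \<in> X_space \<theta> M N k"
  shows "reflect \<theta> M N k L \<in> X_space \<theta> M N k"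
  unfolding X_space_iff
proof (intro conjI ballI)
  show "reflect \<theta> M N k L \<in> extensional {k..N}" by (simp add: reflect_def)
next
  fix j assume j: "j \<in> {k..N}"
  then show "reflect \<theta> M N k L j \<in> extensional {1..j}" by (simp add: reflect_def)
  {
    fix p assume p: "p \<in> {1..j}"
    have eq: "reflect \<theta> M N k L j p + real p * \<theta> =
        real M - (L j (j + 1 - p) + real (j + 1 - p) * \<theta>)"
      using j p by (simp add: reflect_apply of_nat_diff algebra_simps)
    have "j + 1 - p \<in> {1..j}" using p by auto
    then have "L j (j + 1 - p) + real (j + 1 - p) * \<theta> \<in> \<int> \<and> 0 \<le> L j (j + 1 - p) + real (j + 1 - p) * \<theta> \<and>
        L j (j + 1 - p) + real (j + 1 - p) * \<theta> \<le> real M"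
      using assms j unfolding X_space_iff by blast
    then show "reflect \<theta> M N k L j p + real p * \<theta> \<in> \<int>"
      "0 \<le> reflect \<theta> M N k L j p + real p * \<theta>" "reflect \<theta> M N k L j p + real p * \<theta> \<le> real M"
      unfolding eq by auto
  }
  fix p assume p: "p \<in> {1..<j}"
  have "L j (j - p + 1) + \<theta> \<le> L j (j - p)"
    using assms j p unfolding X_space_iff by auto
  then show "reflect \<theta> M N k L j (p + 1) + \<theta> \<le> reflect \<theta> M N k L j p"
    using j p by (simp add: reflect_apply Suc_diff_le)
next
  fix j p assume j: "j \<in> {k..<N}" and p: "p \<in> {1..j}"
  then have p': "j + 1 - p \<in> {1..j}" "j + 1 - p + 1 = j + 1 + 1 - p" "j + 1 + 1 - (p + 1) = j + 1 - p" by auto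
  have *: "L j (j + 1 - p) \<le> L (j + 1) (j + 1 - p)" "L (j + 1) (j + 1 - p + 1) + \<theta> \<le> L j (j + 1 - p)"
    using assms j p'(1) unfolding X_space_iff by blast+
  have "reflect \<theta> M N k L j p = real M - (real j + 1) * \<theta> - L j (j + 1 - p)"
    using j p by (intro reflect_apply) auto
  moreover have "reflect \<theta> M N k L (j + 1) p = real M - (real (j + 1) + 1) * \<theta> - L (j + 1) (j + 1 - p + 1)"
    unfolding p'(2) using j p by (intro reflect_apply) auto
  moreover have "reflect \<theta> M N k L (j + 1) (p + 1) = real M - (real (j + 1) + 1) * \<theta> - L (j + 1) (j + 1 - p)"
    unfolding p'(3)[symmetric] using j p by (intro reflect_apply) auto
  ultimately show "reflect \<theta> M N k L j p \<le> reflect \<theta> M N k L (j + 1) p"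
    "reflect \<theta> M N k L (j + 1) (p + 1) + \<theta> \<le> reflect \<theta> M N k L j p"
    using * by (simp_all add: algebra_simps)
qed

lemma reflect_reflect:
  assumes "L \<in> X_space \<theta> M N k"
  shows "reflect \<theta> M N k (reflect \<theta> M N k L) = L"
proof (intro ext)
  fix j p
  have ext: "L \<in> extensional {k..N}" "j \<in> {k..N} \<Longrightarrow> L j \<in> extensional {1..j}"
    using assms by (auto simp: X_space_iff)
  consider "j \<notin> {k..N}" | "j \<in> {k..N}" "p \<notin> {1..j}" | "j \<in> {k..N}" "p \<in> {1..j}" by blast
  then show "reflect \<theta> M N k (reflect \<theta> M N k L) j p = L j p"
  proof cases
    case 3
    then have "j + 1 - p \<in> {1..j}" "j + 1 - (j + 1 - p) = p" by auto
    then show ?thesis using 3 by (simp add: reflect_apply)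
  qed (use ext in \<open>auto simp: reflect_def extensional_def\<close>)
qed

section \<open>Reversal of indices in products\<close>

lemma prod_triangle_reflect:
  "(\<Prod>q\<in>{1..n::nat}. \<Prod>p\<in>{1..<q}. h p q) = (\<Prod>q\<in>{1..n}. \<Prod>p\<in>{1..<q}. h (n + 1 - q) (n + 1 - p))"
  unfolding prod.Sigma[OF finite_atLeastAtMost ballI[OF finite_atLeastLessThan]]
  by (rule prod.reindex_bij_witness[of _ "\<lambda>(q, p). (n + 1 - p, n + 1 - q)" "\<lambda>(q, p). (n + 1 - p, n + 1 - q)"])
     auto

text \<open>Reversal turns the strict pairs up to \<open>n + 1\<close> into the weak pairs up to
  \<open>n\<close>, the index sets of the two mixed products in \<open>weight_I\<close>.\<close>

lemma prod_triangle_reflect_shift: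
  "(\<Prod>q\<in>{1..n+1::nat}. \<Prod>p\<in>{1..<q}. h p q) = (\<Prod>q\<in>{1..n}. \<Prod>p\<in>{1..q}. h (n + 1 - q) (n + 2 - p))"
  unfolding prod.Sigma[OF finite_atLeastAtMost ballI[OF finite_atLeastLessThan]]
    prod.Sigma[OF finite_atLeastAtMost ballI[OF finite_atLeastAtMost]]
  by (rule prod.reindex_bij_witness[of _ "\<lambda>(q, p). (n + 2 - p, n + 1 - q)" "\<lambda>(q, p). (n + 1 - p, n + 2 - q)"])
     auto

lemma prod_rev:
  assumes "\<And>p. p \<in> {1..n} \<Longrightarrow> f p = g (n + 1 - p)"
  shows "prod f {1..n::nat} = prod g {1..n}"
  using assms by (intro prod.reindex_bij_witness[of _ "\<lambda>p. n + 1 - p" "\<lambda>p. n + 1 - p"]) auto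

lemma prod_rev_drop_first:
  assumes "\<And>p. p \<in> {2..n} \<Longrightarrow> f p = g (n + 1 - p)"
  shows "prod f {2..n::nat} = prod g {1..n-1}"
  using assms by (intro prod.reindex_bij_witness[of _ "\<lambda>p. n + 1 - p" "\<lambda>p. n + 1 - p"]) auto

lemma prod_rev_drop_last:
  assumes "\<And>p. p \<in> {1..n-1} \<Longrightarrow> f p = g (n + 1 - p)"
  shows "prod f {1..n-1::nat} = prod g {2..n}"
  using assms by (intro prod.reindex_bij_witness[of _ "\<lambda>p. n + 1 - p" "\<lambda>p. n + 1 - p"]) auto

text \<open>The constant is that of \<open>reflect\<close> on level \<open>j\<close>; the
  substitution maps the interval from \<open>- j * \<theta>\<close> to \<open>M - \<theta>\<close>
  onto itself, so nonvanishing is inherited.\<close>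

definition reflect_weight :: "real \<Rightarrow> nat \<Rightarrow> (nat \<Rightarrow> real \<Rightarrow> complex) \<Rightarrow> nat \<Rightarrow> real \<Rightarrow> complex" where
  "reflect_weight \<theta> M w j x = w j (real M - (real j + 1) * \<theta> - x)"

lemma prod_triangle_reflect_diff:
  fixes l l' :: "nat \<Rightarrow> real"
  assumes "\<And>p. p \<in> {1..n} \<Longrightarrow> l' p = c - l (n + 1 - p)"
  shows "(\<Prod>q\<in>{1..n}. \<Prod>p\<in>{1..<q}. h (l' p - l' q)) = (\<Prod>q\<in>{1..n}. \<Prod>p\<in>{1..<q}. h (l p - l q))"
proof -
  have "(\<Prod>q\<in>{1..n}. \<Prod>p\<in>{1..<q}. h (l' p - l' q)) =
     (\<Prod>q\<in>{1..n}. \<Prod>p\<in>{1..<q}. h (l' (n + 1 - q) - l' (n + 1 - p)))"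
    by (rule prod_triangle_reflect)
  also have "\<dots> = (\<Prod>q\<in>{1..n}. \<Prod>p\<in>{1..<q}. h (l p - l q))"
  proof (intro prod.cong refl)
    fix q p assume "q \<in> {1..n}" "p \<in> {1..<q}"
    then have "n + 1 - q \<in> {1..n}" "n + 1 - p \<in> {1..n}" "n + 1 - (n + 1 - q) = q" "n + 1 - (n + 1 - p) = p"
      by auto
    then show "h (l' (n + 1 - q) - l' (n + 1 - p)) = h (l p - l q)"
      by (simp add: assms)
  qed
  finally show ?thesis .
qed

text \<open>The reflection constants of adjacent levels differ by \<theta>. This shift turns
  \<open>Gamma_ratio 0 (1 - \<theta>)\<close> into \<open>Gamma_ratio \<theta> 1\<close> and back,
  so the two mixed products change places while the other two are preserved.\<close>

lemma weight_I_reflect: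
  fixes l l' m m' :: "nat \<Rightarrow> real"
  assumes l': "\<And>p. p \<in> {1..j+1} \<Longrightarrow> l' p = real M - (real (j + 1) + 1) * \<theta> - l (j + 1 + 1 - p)"
    and m': "\<And>p. p \<in> {1..j} \<Longrightarrow> m' p = real M - (real j + 1) * \<theta> - m (j + 1 - p)"
  shows "weight_I \<theta> w j l' m' = weight_I \<theta> (reflect_weight \<theta> M w) j l m"
proof -
  have 1: "(\<Prod>q\<in>{1..j+1}. \<Prod>p\<in>{1..<q}. h (l' p - l' q)) = (\<Prod>q\<in>{1..j+1}. \<Prod>p\<in>{1..<q}. h (l p - l q))"
    for h :: "real \<Rightarrow> real" by (rule prod_triangle_reflect_diff) (rule l')
  have 2: "(\<Prod>q\<in>{1..j}. \<Prod>p\<in>{1..<q}. h (m' p - m' q)) = (\<Prod>q\<in>{1..j}. \<Prod>p\<in>{1..<q}. h (m p - m q))"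
    for h :: "real \<Rightarrow> real" by (rule prod_triangle_reflect_diff) (rule m')
  have d: "m' (j + 1 - q) - l' (j + 2 - p) = l p - m q + \<theta>" "l' p - m' q = m (j + 1 - q) - l (j + 2 - p) - \<theta>"
    if "q \<in> {1..j}" "p \<in> {1..q}" for p q
  proof -
    have "j + 1 - q \<in> {1..j}" "j + 2 - p \<in> {1..j+1}" "p \<in> {1..j+1}"
      "j + 1 - (j + 1 - q) = q" "j + 1 + 1 - (j + 2 - p) = p" "j + 1 + 1 - p = j + 2 - p"
      using that by auto
    then show "m' (j + 1 - q) - l' (j + 2 - p) = l p - m q + \<theta>"
      "l' p - m' q = m (j + 1 - q) - l (j + 2 - p) - \<theta>"
      using that by (simp_all only: l' m') (simp_all add: algebra_simps)
  qed
  have shift: "Gamma_ratio 0 (1 - \<theta>) (x + \<theta>) = Gamma_ratio \<theta> 1 x"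
    "Gamma_ratio \<theta> 1 (x - \<theta>) = Gamma_ratio 0 (1 - \<theta>) x" for x
    by (simp_all add: Gamma_ratio_def diff_add_eq add_diff_eq)
  have 3: "(\<Prod>q\<in>{1..j+1}. \<Prod>p\<in>{1..<q}. Gamma_ratio 0 (1 - \<theta>) (m' p - l' q)) =
     (\<Prod>q\<in>{1..j}. \<Prod>p\<in>{1..q}. Gamma_ratio \<theta> 1 (l p - m q))"
    unfolding prod_triangle_reflect_shift by (intro prod.cong refl) (simp only: d shift)
  have 4: "(\<Prod>q\<in>{1..j}. \<Prod>p\<in>{1..q}. Gamma_ratio \<theta> 1 (l' p - m' q)) =
     (\<Prod>q\<in>{1..j+1}. \<Prod>p\<in>{1..<q}. Gamma_ratio 0 (1 - \<theta>) (m p - l q))"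
    unfolding prod_triangle_reflect_shift by (intro prod.cong refl) (simp only: d shift)
  have 5: "(\<Prod>p\<in>{1..j}. w j (m' p)) = (\<Prod>p\<in>{1..j}. reflect_weight \<theta> M w j (m p))"
    by (rule prod_rev) (simp add: m' reflect_weight_def)
  show ?thesis
    unfolding weight_I_Gamma_ratio 1 2 3 4 5 by (simp only: mult_ac)
qed

lemma total_weight_reflect:
  assumes "k \<le> N"
  shows "total_weight \<theta> N k w (reflect \<theta> M N k L) = total_weight \<theta> N k (reflect_weight \<theta> M w) L"
proof -
  have r: "reflect \<theta> M N k L j p = real M - (real j + 1) * \<theta> - L j (j + 1 - p)"
    if "j \<in> {k..N}" "p \<in> {1..j}" for j p
    using that by (rule reflect_apply)
  have I: "weight_I \<theta> w j (reflect \<theta> M N k L (j + 1)) (reflect \<theta> M N k L j) =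
      weight_I \<theta> (reflect_weight \<theta> M w) j (L (j + 1)) (L j)" if "j \<in> {k..<N}" for j
    using that by (intro weight_I_reflect r) auto
  have tri: "(\<Prod>q\<in>{1..j}. \<Prod>p\<in>{1..<q}. h (reflect \<theta> M N k L j p - reflect \<theta> M N k L j q)) =
      (\<Prod>q\<in>{1..j}. \<Prod>p\<in>{1..<q}. h (L j p - L j q))" if "j \<in> {k..N}" for j and h :: "real \<Rightarrow> real"
    by (rule prod_triangle_reflect_diff) (rule r[OF that])
  have "(\<Prod>p\<in>{1..N}. w N (reflect \<theta> M N k L N p)) = (\<Prod>p\<in>{1..N}. reflect_weight \<theta> M w N (L N p))"
    using assms by (intro prod_rev) (simp add: r reflect_weight_def)
  then have "weight_Ht \<theta> N w (reflect \<theta> M N k L N) = weight_Ht \<theta> N (reflect_weight \<theta> M w) (L N)"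
    using assms by (simp only: weight_Ht_Gamma_ratio tri atLeastAtMost_iff order_refl)
  moreover have "weight_Hb \<theta> k (reflect \<theta> M N k L k) = weight_Hb \<theta> k (L k)"
    using assms by (simp only: weight_Hb_Gamma_ratio tri atLeastAtMost_iff order_refl)
  moreover have "(\<Prod>j\<in>{k..<N}. weight_I \<theta> w j (reflect \<theta> M N k L (j + 1)) (reflect \<theta> M N k L j)) =
      (\<Prod>j\<in>{k..<N}. weight_I \<theta> (reflect_weight \<theta> M w) j (L (j + 1)) (L j))"
    by (intro prod.cong refl I)
  ultimately show ?thesis by (simp only: total_weight_def)
qed

lemma sum_reflect:
  "(\<Sum>L\<in>X_space \<theta> M N k. F (reflect \<theta> M N k L)) = (\<Sum>L\<in>X_space \<theta> M N k. F L)"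
  by (rule sum.reindex_bij_witness[of _ "reflect \<theta> M N k" "reflect \<theta> M N k"])
     (auto simp: reflect_in_X reflect_reflect)

lemma expect_reflect:
  assumes "k \<le> N" "\<And>L. F (reflect \<theta> M N k L) = G L"
  shows "expect_E \<theta> M N k w F = expect_E \<theta> M N k (reflect_weight \<theta> M w) G"
proof -
  have Z: "partition_Z \<theta> M N k w = partition_Z \<theta> M N k (reflect_weight \<theta> M w)"
    unfolding partition_Z_def sum_reflect[of "total_weight \<theta> N k w", symmetric]
    using assms(1) by (simp add: total_weight_reflect)
  have "expect_E \<theta> M N k w F =
      (\<Sum>L\<in>X_space \<theta> M N k. F (reflect \<theta> M N k L) * prob_P \<theta> M N k w (reflect \<theta> M N k L))"
    unfolding expect_E_def by (rule sum_reflect[of "\<lambda>L. F L * prob_P \<theta> M N k w L", symmetric])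
  then show ?thesis
    using assms by (simp add: expect_E_def prob_P_def total_weight_reflect Z)
qed

section \<open>Identification of \<open>R2\<close> with a reflected \<open>R1\<close>\<close>

lemma minus_ratio: "a = - c \<Longrightarrow> b = - d \<Longrightarrow> a / b = c / (d :: 'a::field)"
  by simp

text \<open>\<open>C\<close> is the sum of the two wall poles \<open>- N * \<theta>\<close> and
  \<open>M + 1 - \<theta>\<close>, so subtraction from \<open>C\<close> swaps them, just as
  \<open>reflect\<close> swaps the walls at 0 and \<open>M\<close>.\<close>

lemma Res2_reflect:
  assumes "1 \<le> k" "k \<le> N" and C_def: "C = real M + 1 - (real N + 1) * \<theta>"
  shows "Res2 \<theta> M N k w \<phi> z =
    Res1 \<theta> M N k (reflect_weight \<theta> M w) (\<lambda>j y. \<phi> j (cpx C - y)) (cpx C - z)"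
proof -
  let ?E = "expect_E \<theta> M N k w" and ?E' = "expect_E \<theta> M N k (reflect_weight \<theta> M w)"
  define s where "s = real M + 1 - \<theta>"
  note r = reflect_apply
  have a1: "cpx C - cpx (- real N * \<theta>) = cpx s" and a2: "cpx C - cpx s = cpx (- real N * \<theta>)"
    by (simp_all add: C_def s_def algebra_simps)
  have b1: "cpx \<theta> * c / (z - cpx s) = cpx (- \<theta>) * c / (cpx C - z + cpx (real N * \<theta>))"
    and b2: "cpx (- \<theta>) * c / (z + cpx (real N * \<theta>)) = cpx \<theta> * c / (cpx C - z - cpx s)" for c
    by (rule minus_ratio; simp add: C_def s_def algebra_simps)+
  have e1: "?E (\<lambda>L. cpx ((\<Prod>p\<in>{2..N}. (s - L N p + \<theta> - 1) / (s - L N p - 1)) * of_bool (L N 1 = s - 1))) =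
     ?E' (\<lambda>L. cpx ((\<Prod>p\<in>{1..N-1}. (L N p + (real N + 1) * \<theta>) / (L N p + real N * \<theta>)) *
                of_bool (L N N = - real N * \<theta>)))"
  proof (rule expect_reflect[OF assms(2)])
    fix L
    let ?R = "reflect \<theta> M N k L"
    have "(\<Prod>p\<in>{2..N}. (s - ?R N p + \<theta> - 1) / (s - ?R N p - 1)) =
       (\<Prod>p\<in>{1..N-1}. (L N p + (real N + 1) * \<theta>) / (L N p + real N * \<theta>))"
      using assms by (intro prod_rev_drop_first arg_cong2[where f = "(/)"]) (auto simp: r s_def algebra_simps)
    moreover have "?R N 1 = s - 1 \<longleftrightarrow> L N N = - real N * \<theta>"
      using assms by (auto simp: r s_def algebra_simps)
    ultimately show "cpx ((\<Prod>p\<in>{2..N}. (s - ?R N p + \<theta> - 1) / (s - ?R N p - 1)) * of_bool (?R N 1 = s - 1)) =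
       cpx ((\<Prod>p\<in>{1..N-1}. (L N p + (real N + 1) * \<theta>) / (L N p + real N * \<theta>)) *
                of_bool (L N N = - real N * \<theta>))"
      by presburger
  qed
  have e2: "?E (\<lambda>L. cpx ((\<Prod>p\<in>{1..k-1}. (L k p + (real k + 1) * \<theta>) / (L k p + real k * \<theta>)) *
                of_bool (L k k = - real k * \<theta>))) =
     ?E' (\<lambda>L. cpx ((\<Prod>p\<in>{2..k}. (s - L k p + \<theta> - 1) / (s - L k p - 1)) * of_bool (L k 1 = s - 1)))"
  proof (rule expect_reflect[OF assms(2)])
    fix L
    let ?R = "reflect \<theta> M N k L"
    have "(\<Prod>p\<in>{1..k-1}. (?R k p + (real k + 1) * \<theta>) / (?R k p + real k * \<theta>)) =
       (\<Prod>p\<in>{2..k}. (s - L k p + \<theta> - 1) / (s - L k p - 1))"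
      using assms by (intro prod_rev_drop_last arg_cong2[where f = "(/)"]) (auto simp: r s_def algebra_simps)
    moreover have "?R k k = - real k * \<theta> \<longleftrightarrow> L k 1 = s - 1"
      using assms by (auto simp: r s_def algebra_simps)
    ultimately show "cpx ((\<Prod>p\<in>{1..k-1}. (?R k p + (real k + 1) * \<theta>) / (?R k p + real k * \<theta>)) *
                of_bool (?R k k = - real k * \<theta>)) =
       cpx ((\<Prod>p\<in>{2..k}. (s - L k p + \<theta> - 1) / (s - L k p - 1)) * of_bool (L k 1 = s - 1))"
      by presburger
  qed
  have e3: "?E (\<lambda>L. cpx (
                (\<Prod>p\<in>{1..j-1}. (L j p + (real j - 1) * \<theta> + 1) / (L j p + real j * \<theta>)) *
                (\<Prod>p\<in>{1..j-1}. (L (j-1) p + real j * \<theta>) / (L (j-1) p + (real j - 1) * \<theta> + 1)) *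
                of_bool (L j j = - real j * \<theta>))) =
     ?E' (\<lambda>L. cpx (
                (\<Prod>p\<in>{2..j}. (s - L j p - \<theta>) / (s - L j p - 1)) *
                (\<Prod>p\<in>{1..j-1}. (s - L (j-1) p + \<theta> - 1) / (s - L (j-1) p)) *
                of_bool (L j 1 = s - 1)))" if j: "j \<in> {k+1..N}" for j
  proof (rule expect_reflect[OF assms(2)])
    fix L
    let ?R = "reflect \<theta> M N k L"
    obtain n where n: "j = n + 1" "j - 1 = n" using j by (cases j) auto
    have "(\<Prod>p\<in>{1..j-1}. (?R j p + (real j - 1) * \<theta> + 1) / (?R j p + real j * \<theta>)) =
       (\<Prod>p\<in>{2..j}. (s - L j p - \<theta>) / (s - L j p - 1))"
      using j by (intro prod_rev_drop_last arg_cong2[where f = "(/)"]) (auto simp: r s_def algebra_simps)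
    moreover have "(\<Prod>p\<in>{1..j-1}. (?R (j-1) p + real j * \<theta>) / (?R (j-1) p + (real j - 1) * \<theta> + 1)) =
       (\<Prod>p\<in>{1..j-1}. (s - L (j-1) p + \<theta> - 1) / (s - L (j-1) p))"
      using j unfolding n(2)
      by (intro prod_rev arg_cong2[where f = "(/)"]) (auto simp: n(1) r s_def algebra_simps)
    moreover have "?R j j = - real j * \<theta> \<longleftrightarrow> L j 1 = s - 1"
      using j by (auto simp: r s_def algebra_simps)
    ultimately show "cpx (
                (\<Prod>p\<in>{1..j-1}. (?R j p + (real j - 1) * \<theta> + 1) / (?R j p + real j * \<theta>)) *
                (\<Prod>p\<in>{1..j-1}. (?R (j-1) p + real j * \<theta>) / (?R (j-1) p + (real j - 1) * \<theta> + 1)) *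
                of_bool (?R j j = - real j * \<theta>)) =
       cpx ((\<Prod>p\<in>{2..j}. (s - L j p - \<theta>) / (s - L j p - 1)) *
                (\<Prod>p\<in>{1..j-1}. (s - L (j-1) p + \<theta> - 1) / (s - L (j-1) p)) *
                of_bool (L j 1 = s - 1))"
      by presburger
  qed
  show ?thesis
    unfolding Res1_def Res2_def Let_def s_def[symmetric] a1 a2 e1 e2 b1 b2
    by (intro arg_cong2[where f = "(+)"] sum.cong refl) (simp only: e3)
qed

text \<open>The shifts by \<open>(N - j) * \<theta>\<close> in \<open>R2\<close> offset the level
  dependence of the reflection: if \<open>x'\<close> is the reflection of a position
  \<open>x\<close> on level \<open>j\<close> and \<open>y = C - z\<close>, then
  \<open>z - x' + (N - j) * \<theta> = - (y - x - 1)\<close>. Numerator and denominator both change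
  sign.\<close>

lemma R2_reflect:
  assumes "1 \<le> k" "k \<le> N" and C_def: "C = real M + 1 - (real N + 1) * \<theta>"
  shows "R2 \<theta> M N k w \<phi> z =
    R1 \<theta> M N k (reflect_weight \<theta> M w) (\<lambda>j y. \<phi> j (cpx C - y)) (cpx C - z)"
proof -
  let ?E = "expect_E \<theta> M N k w" and ?E' = "expect_E \<theta> M N k (reflect_weight \<theta> M w)"
  define y where "y = cpx C - z"
  have z: "z = cpx C - y" by (simp add: y_def)
  note r = reflect_apply
  have e1: "?E (\<lambda>L. \<Prod>p\<in>{1..N}. (z - cpx (L N p) + cpx \<theta> - 1) / (z - cpx (L N p) - 1)) =
     ?E' (\<lambda>L. \<Prod>p\<in>{1..N}. (y - cpx (L N p) - cpx \<theta>) / (y - cpx (L N p)))"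
    using assms(1,2)
    by (intro expect_reflect prod_rev minus_ratio) (auto simp: r z C_def algebra_simps)
  have e2: "?E (\<lambda>L. \<Prod>p\<in>{1..k}. (z - cpx (L k p) + cpx ((real N - real k - 1) * \<theta>)) /
                                      (z - cpx (L k p) + cpx ((real N - real k) * \<theta>))) =
     ?E' (\<lambda>L. \<Prod>p\<in>{1..k}. (y - cpx (L k p) + cpx \<theta> - 1) / (y - cpx (L k p) - 1))"
    using assms(1,2)
    by (intro expect_reflect prod_rev minus_ratio) (auto simp: r z C_def algebra_simps)
  have e3: "?E (\<lambda>L. (\<Prod>p\<in>{1..j}. (z - cpx (L j p) + cpx ((real N - real j + 1) * \<theta>) - 1) /
                                (z - cpx (L j p) + cpx ((real N - real j) * \<theta>))) *
                  (\<Prod>p\<in>{1..j-1}. (z - cpx (L (j-1) p) + cpx ((real N - real j) * \<theta>)) /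
                                  (z - cpx (L (j-1) p) + cpx ((real N - real j + 1) * \<theta>) - 1))) =
     ?E' (\<lambda>L. (\<Prod>p\<in>{1..j}. (y - cpx (L j p) - cpx \<theta>) / (y - cpx (L j p) - 1)) *
                  (\<Prod>p\<in>{1..j-1}. (y - cpx (L (j-1) p) + cpx \<theta> - 1) / (y - cpx (L (j-1) p))))"
    if j: "j \<in> {k+1..N}" for j
  proof -
    obtain n where n: "j = n + 1" "j - 1 = n" using j by (cases j) auto
    show ?thesis
      unfolding n(2) using assms(2) j
      by (intro expect_reflect arg_cong2[where f = "(*)"] prod_rev minus_ratio)
         (auto simp: n(1) r z C_def algebra_simps)
  qed
  show ?thesis
    unfolding R1_def R2_def Let_def e1 e2 Res2_reflect[OF assms] y_def[symmetric]
    by (simp only: e3 z[symmetric] cong: sum.cong)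
qed

lemma analytic_removable_on_reflect:
  assumes "analytic_removable_on f ((\<lambda>z. c - z) ` A)"
  shows "analytic_removable_on (\<lambda>z. f (c - z)) A"
proof -
  obtain g where g: "g analytic_on (\<lambda>z. c - z) ` A"
    and eq: "\<And>z. z \<in> A \<Longrightarrow> \<forall>\<^sub>F u in at (c - z). f u = g u"
    using assms unfolding analytic_removable_on_def by auto
  have "(\<lambda>z. g (c - z)) analytic_on A"
    using analytic_on_compose[OF _ g] by (simp add: o_def analytic_intros)
  moreover have "\<forall>\<^sub>F u in at z. f (c - u) = g (c - u)" if "z \<in> A" for z
  proof -
    have "filterlim (\<lambda>u. c - u) (at (c - z)) (at z)"
      by (auto simp: filterlim_at eventually_at_filter intro!: tendsto_intros)
    with eq[OF that] show ?thesis by (rule eventually_compose_filterlim)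
  qed
  ultimately show ?thesis unfolding analytic_removable_on_def by blast
qed

theorem theorem2p1:
  fixes \<theta> :: real and N k M :: nat
    and w :: "nat \<Rightarrow> real \<Rightarrow> complex"
    and \<phi>1 \<phi>2 :: "nat \<Rightarrow> complex \<Rightarrow> complex"
    and \<M> :: "complex set"
  assumes "\<theta> > 0" and "\<theta> \<noteq> 1"
    and "1 \<le> k" and "k \<le> N"
    and w_nonzero: "\<And>j x. j \<in> {k..N} \<Longrightarrow> x \<in> {- real j * \<theta> .. real M - \<theta>} \<Longrightarrow> w j x \<noteq> 0"
    and Z_nonzero: "partition_Z \<theta> M N k w \<noteq> 0"
    and "open \<M>"
    and "complex_of_real ` {- real N * \<theta> .. real M + 1 - \<theta>} \<subseteq> \<M>"
    and analytic1: "\<And>j. j \<in> {k..N+1} \<Longrightarrow> \<phi>1 j analytic_on \<M>"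
    and analytic2: "\<And>j. j \<in> {k..N+1} \<Longrightarrow> \<phi>2 j analytic_on \<M>"
    and ratio1: "\<And>j x. j \<in> {k..N} \<Longrightarrow> x \<in> {1 - real j * \<theta> .. real M - \<theta>} \<Longrightarrow>
        \<phi>1 j (complex_of_real x) \<noteq> 0 \<and>
        \<phi>1 (j + 1) (complex_of_real x) / \<phi>1 j (complex_of_real x) = w j (x - 1) / w j x"
    and ratio2: "\<And>j x. j \<in> {k..N} \<Longrightarrow>
        x \<in> {1 - real N * \<theta> .. real M - (real N - real j + 1) * \<theta>} \<Longrightarrow>
        \<phi>2 (j + 1) (complex_of_real x) \<noteq> 0 \<and>
        \<phi>2 j (complex_of_real x) / \<phi>2 (j + 1) (complex_of_real x) =
          w j (x + (real N - real j) * \<theta> - 1) / w j (x + (real N - real j) * \<theta>)"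
  shows "analytic_removable_on (R1 \<theta> M N k w \<phi>1) \<M> \<and> analytic_removable_on (R2 \<theta> M N k w \<phi>2) \<M>"
proof
  interpret up: corners \<theta> N k M w \<phi>1
    using assms by unfold_locales auto
  show "analytic_removable_on (R1 \<theta> M N k w \<phi>1) \<M>"
    using \<open>\<theta> \<noteq> 1\<close> analytic1 by (rule up.R1_analytic)
  define C where "C = real M + 1 - (real N + 1) * \<theta>"
  define w' where "w' = reflect_weight \<theta> M w"
  define \<phi>' where "\<phi>' = (\<lambda>j y. \<phi>2 j (cpx C - y))"
  interpret down: corners \<theta> N k M w' \<phi>'
  proof
    fix j x assume j: "j \<in> {k..N}"
    show "w' j x \<noteq> 0" if "x \<in> {- real j * \<theta> .. real M - \<theta>}"
      unfolding w'_def reflect_weight_def using that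
      by (intro w_nonzero[OF j]) (auto simp: algebra_simps)
    assume x: "x \<in> {1 - real j * \<theta> .. real M - \<theta>}"
    define y where "y = C - x"
    \<comment> \<open>The interval of the second ratio hypothesis is the image of that of the first
      under reflection in \<open>C\<close>.\<close>
    have y: "y \<in> {1 - real N * \<theta> .. real M - (real N - real j + 1) * \<theta>}"
      using x by (auto simp: y_def C_def algebra_simps)
    have w: "w' j (x - 1) = w j (y + (real N - real j) * \<theta>)" "w' j x = w j (y + (real N - real j) * \<theta> - 1)"
      by (simp_all add: w'_def reflect_weight_def y_def C_def algebra_simps)
    have "y + (real N - real j) * \<theta> - 1 \<in> {- real j * \<theta> .. real M - \<theta>}"
      "y + (real N - real j) * \<theta> \<in> {- real j * \<theta> .. real M - \<theta>}"
      using y by (auto simp: algebra_simps)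
    \<comment> \<open>Reflection exchanges \<open>w j\<close> at the two neighbouring points, so the
      quotient in \<open>ratio2\<close> is inverted. Its new denominator \<open>\<phi>2 j\<close> is
      nonzero because both weights are.\<close>
    then have "w j (y + (real N - real j) * \<theta> - 1) \<noteq> 0" "w j (y + (real N - real j) * \<theta>) \<noteq> 0"
      by (auto intro!: w_nonzero[OF j])
    moreover have "\<phi>' i (cpx x) = \<phi>2 i (cpx y)" for i
      by (simp add: \<phi>'_def y_def)
    ultimately show "\<phi>' j (cpx x) \<noteq> 0 \<and> \<phi>' (j + 1) (cpx x) / \<phi>' j (cpx x) = w' j (x - 1) / w' j x"
      using ratio2[OF j y] by (auto simp: w divide_simps mult_ac split: if_splits)
  qed (use assms in auto)
  have "analytic_removable_on (R1 \<theta> M N k w' \<phi>') ((\<lambda>z. cpx C - z) ` \<M>)"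
  proof (rule down.R1_analytic[OF \<open>\<theta> \<noteq> 1\<close>])
    fix j assume "j \<in> {k..N+1}"
    then have "\<phi>2 j analytic_on (\<lambda>z. cpx C - z) ` (\<lambda>z. cpx C - z) ` \<M>"
      using analytic2 by (simp add: image_image)
    then show "\<phi>' j analytic_on (\<lambda>z. cpx C - z) ` \<M>"
      unfolding \<phi>'_def using analytic_on_compose[where g = "\<phi>2 j"] by (simp add: o_def analytic_intros)
  qed
  then have "analytic_removable_on (\<lambda>z. R1 \<theta> M N k w' \<phi>' (cpx C - z)) \<M>"
    by (rule analytic_removable_on_reflect)
  moreover have "R2 \<theta> M N k w \<phi>2 = (\<lambda>z. R1 \<theta> M N k w' \<phi>' (cpx C - z))"
    unfolding w'_def \<phi>'_def by (rule ext) (rule R2_reflect[OF \<open>1 \<le> k\<close> \<open>k \<le> N\<close> C_def])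
  ultimately show "analytic_removable_on (R2 \<theta> M N k w \<phi>2) \<M>"
    by simp
qed

end
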